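(* Let $f\in H_0^1(-1,1)$, $f\not\equiv 0$, let $\gamma>1$, and let $B_0\geq\sqrt{\gamma}\,\omega(f)$. Then for all $L>0$ and all $0<B<B_0$, $$\|f\|_{L^2(-1,1)}\leq k_{L,B_0,B}\,\|F_Bf\|_{L^2(\mathbb{R})}$$ holds with $$k_{L,B_0,B}=c\left(\frac{2B_0}{1-1/\gamma}\right)^{1/w}e^{2L(1-w)/w},\qquad c=\left(\frac{B^{1/4}}{\pi^{1/4}}+\frac{2}{\sqrt B}\right)^2,\qquad w=w_L(B_0,B),$$ where $w_L(\cdot,B)$ is the harmonic measure of the slit $[0,B]\times\{0\}$ in $G_{L,B}$, evaluated at the point $B_0$ of the positive real axis. In particular, with $\gamma$ and $L$ fixed, $$\lim_{B\searrow 0}k_{L,B_0,B}=\infty\quad(\text{for fixed }B_0),$$ $$\lim_{B\nearrow B_0}k_{L,B_0,B}=\left(\frac{B_0^{1/4}}{\pi^{1/4}}+\frac{2}{\sqrt{B_0}}\right)^2\frac{2B_0}{1-1/\gamma}\quad(\text{for fixed }B_0),$$ $$\lim_{B_0\to\infty}k_{L,B_0,B}=\infty\quad(\text{for fixed }B).$$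
   Context: Functions $f$ are real-valued. $H_0^1(-1,1)=\{f\in H^1(-1,1): f(-1)=f(1)=0\}$; its elements are extended by zero to $\mathbb{R}$ and $f_x$ denotes the weak derivative. The Fourier transform of $f\in L^2(-1,1)$ is $\widehat f(\xi)=\frac{1}{\sqrt{2\pi}}\int_{-1}^1 f(x)e^{-ix\xi}\,dx$, $\xi\in\mathbb{R}$. For $B>0$ the truncated Fourier transform is $F_Bf(\xi)=\chi_{[-B,B]}(\xi)\widehat f(\xi)$, where $\chi_{[-B,B]}$ is the characteristic function of $[-B,B]$. The frequency number of a nonzero $f\in H_0^1(-1,1)$ is $\omega(f)=\|f_x\|_{L^2(-1,1)}/\|f\|_{L^2(-1,1)}$. Identify $\mathbb{C}$ with $\mathbb{R}^2$. For $L,B>0$ let $S_L=\{z\in\mathbb{C}:\operatorname{Re}z>0,\ |\operatorname{Im}z|<L\}$ and $G_{L,B}=S_L\setminus([0,B]\times\{0\})$, an open simply connected set. For an open simply connected $U\subset\mathbb{C}$ and a Borel set $A\subset\partial U$, the harmonic measure $w_U(\cdot,A)$ of $A$ in $U$ is the solution of the Dirichlet problem in $U$ with boundary data $\chi_A$. For $U=G_{L,B}$ and $A=[0,B]\times\{0\}$ this is the unique bounded harmonic function on $G_{L,B}$ that tends to $\chi_A(\zeta)$ at every boundary point $\zeta$ other than finitely many exceptional points of $\partial U$ (with $\infty$ regarded as a boundary point of $U$) at which $\chi_A$ is discontinuous. Write $w_L(z,B)=w_{G_{L,B}}(z,[0,B]\times\{0\})$. *)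

theory Defs
  imports "HOL-Complex_Analysis.Complex_Analysis"
begin

text \<open>
  Elements of \<open>L\<^sup>2(I)\<close> are represented by functions on the whole line whose values outside \<open>I\<close>
  are irrelevant: the norms, the Sobolev spaces and the Fourier transform below depend only on the
  a.e. class of the restriction to \<open>I\<close>.
\<close>

definition square_integrable_on :: "(real \<Rightarrow> 'a::{banach, second_countable_topology}) \<Rightarrow> real set \<Rightarrow> bool"
    (infix "square'_integrable'_on" 50) where
  "f square_integrable_on I \<longleftrightarrow>
     f \<in> borel_measurable (lebesgue_on I) \<and> integrable (lebesgue_on I) (\<lambda>x. (norm (f x))\<^sup>2)"

definition L2_norm_on :: "real set \<Rightarrow> (real \<Rightarrow> 'a::real_normed_vector) \<Rightarrow> real" where
  "L2_norm_on I f = sqrt (LINT x|lebesgue_on I. (norm (f x))\<^sup>2)"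

definition test_function :: "real set \<Rightarrow> (real \<Rightarrow> real) \<Rightarrow> bool" where
  "test_function I \<phi> \<longleftrightarrow>
     (\<forall>n x. (deriv ^^ n) \<phi> field_differentiable at x) \<and>
     (\<exists>K. compact K \<and> K \<subseteq> I \<and> (\<forall>x. x \<notin> K \<longrightarrow> \<phi> x = 0))"

definition locally_integrable_on :: "(real \<Rightarrow> real) \<Rightarrow> real set \<Rightarrow> bool"
    (infix "locally'_integrable'_on" 50) where
  "f locally_integrable_on I \<longleftrightarrow> (\<forall>K. compact K \<and> K \<subseteq> I \<longrightarrow> integrable (lebesgue_on K) f)"

definition has_weak_derivative_on :: "(real \<Rightarrow> real) \<Rightarrow> (real \<Rightarrow> real) \<Rightarrow> real set \<Rightarrow> bool" where
  "has_weak_derivative_on f g I \<longleftrightarrow>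
     f locally_integrable_on I \<and> g locally_integrable_on I \<and>
     (\<forall>\<phi>. test_function I \<phi> \<longrightarrow>
        (LINT x|lebesgue_on I. f x * deriv \<phi> x) = - (LINT x|lebesgue_on I. g x * \<phi> x))"

definition H1 :: "real set \<Rightarrow> (real \<Rightarrow> real) set" where
  "H1 I = {f. f square_integrable_on I \<and>
              (\<exists>g. g square_integrable_on I \<and> has_weak_derivative_on f g I)}"

text \<open>The boundary values of an \<open>H\<^sup>1\<close> function are those of its continuous representative \<open>u\<close>.\<close>

definition H10 :: "(real \<Rightarrow> real) set" where
  "H10 = {f \<in> H1 {-1<..<1}.
            \<exists>u. continuous_on {-1..1} u \<and> (AE x in lebesgue_on {-1<..<1}. f x = u x) \<and>
                u (-1) = 0 \<and> u 1 = 0}"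

text \<open>The weak derivative is unique up to null sets, so the choice does not affect its norm.\<close>

definition weak_deriv :: "real set \<Rightarrow> (real \<Rightarrow> real) \<Rightarrow> real \<Rightarrow> real" where
  "weak_deriv I f = (SOME g. g square_integrable_on I \<and> has_weak_derivative_on f g I)"

definition frequency_number :: "(real \<Rightarrow> real) \<Rightarrow> real" where
  "frequency_number f =
     L2_norm_on {-1<..<1} (weak_deriv {-1<..<1} f) / L2_norm_on {-1<..<1} f"

definition fourier :: "(real \<Rightarrow> real) \<Rightarrow> real \<Rightarrow> complex" where
  "fourier f \<xi> = complex_of_real (1 / sqrt (2 * pi)) *
     (LINT x|lebesgue_on {-1<..<1}. complex_of_real (f x) * exp (- \<i> * complex_of_real (x * \<xi>)))"

definition truncated_fourier :: "real \<Rightarrow> (real \<Rightarrow> real) \<Rightarrow> real \<Rightarrow> complex" where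
  "truncated_fourier B f \<xi> = indicator {-B..B} \<xi> * fourier f \<xi>"

text \<open>Here \<open>p, q\<close> are the first-order partial derivatives of \<open>h\<close>, and \<open>px, py, qx, qy\<close> the
  second-order ones; their continuity makes \<open>h\<close> a \<open>C\<^sup>2\<close> function.\<close>

definition harmonic_on :: "(complex \<Rightarrow> real) \<Rightarrow> complex set \<Rightarrow> bool" (infix "harmonic'_on" 50) where
  "h harmonic_on U \<longleftrightarrow>
     (\<exists>p q px py qx qy.
        continuous_on U px \<and> continuous_on U py \<and> continuous_on U qx \<and> continuous_on U qy \<and>
        (\<forall>z\<in>U. (h has_derivative (\<lambda>v. p z * Re v + q z * Im v)) (at z) \<and>
               (p has_derivative (\<lambda>v. px z * Re v + py z * Im v)) (at z) \<and>
               (q has_derivative (\<lambda>v. qx z * Re v + qy z * Im v)) (at z) \<and>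
               px z + qy z = 0))"

text \<open>
  The bounded solution of the Dirichlet problem with boundary data \<open>indicator A\<close>, for bounded
  \<open>A \<subseteq> frontier U\<close>. The boundary values are attained except at finitely many discontinuities of the
  data. If \<open>U\<close> is unbounded, then \<open>\<infinity>\<close> is a boundary point, and since \<open>A\<close> is bounded the data is
  continuous there with value \<open>0\<close>; for bounded \<open>U\<close> the last condition is vacuous.
\<close>

definition is_harmonic_measure :: "complex set \<Rightarrow> complex set \<Rightarrow> (complex \<Rightarrow> real) \<Rightarrow> bool" where
  "is_harmonic_measure U A h \<longleftrightarrow>
     h harmonic_on U \<and> bounded (h ` U) \<and>
     (\<exists>E. finite E \<and>
          E \<subseteq> {\<zeta> \<in> frontier U. \<not> continuous (at \<zeta> within frontier U) (indicator A :: complex \<Rightarrow> real)} \<and>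
          (\<forall>\<zeta> \<in> frontier U - E. (h \<longlongrightarrow> indicator A \<zeta>) (at \<zeta> within U))) \<and>
     (h \<longlongrightarrow> 0) (inf at_infinity (principal U))"

text \<open>The conditions determine \<open>h\<close> only on \<open>U\<close>, so this is meaningful for \<open>z \<in> U\<close>.\<close>

definition harmonic_measure :: "complex set \<Rightarrow> complex \<Rightarrow> complex set \<Rightarrow> real" where
  "harmonic_measure U z A = (SOME h. is_harmonic_measure U A h) z"

definition half_strip :: "real \<Rightarrow> complex set" where
  "half_strip L = {z. Re z > 0 \<and> \<bar>Im z\<bar> < L}"

definition slit :: "real \<Rightarrow> complex set" where
  "slit B = complex_of_real ` {0..B}"

definition slit_half_strip :: "real \<Rightarrow> real \<Rightarrow> complex set" where
  "slit_half_strip L B = half_strip L - slit B"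

definition slit_measure :: "real \<Rightarrow> complex \<Rightarrow> real \<Rightarrow> real" where
  "slit_measure L z B = harmonic_measure (slit_half_strip L B) z (slit B)"

definition k_const :: "real \<Rightarrow> real \<Rightarrow> real \<Rightarrow> real \<Rightarrow> real" where
  "k_const \<gamma> L B0 B =
     (let w = slit_measure L (complex_of_real B0) B;
          c = (B powr (1/4) / pi powr (1/4) + 2 / sqrt B)\<^sup>2
      in c * (2 * B0 / (1 - 1/\<gamma>)) powr (1/w) * exp (2 * L * (1 - w) / w))"

end

theory Submission
  imports Defs "HOL-Probability.Probability"
begin

text \<open>
  Write \<open>F\<close> for the Fourier transform of \<open>f\<close>, an entire function with \<open>|F z| \<le> \<parallel>f\<parallel> e\<^sup>L / sqrt pi\<close> for
  \<open>|Im z| \<le> L\<close>. Since \<open>f\<close> has frequency number at most \<open>B0 / sqrt \<gamma>\<close>, the band \<open>[-B0, B0]\<close> carries at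
  least the fraction \<open>1 - 1/\<gamma>\<close> of the energy of \<open>F\<close> (\<open>band_energy_ge\<close>), so
  \<open>(1 - 1/\<gamma>) \<parallel>f\<parallel>\<^sup>2 \<le> 2 B0 sup |F|\<^sup>2\<close>, the supremum over the band; as \<open>|F|\<close> is even, \<open>[0, B0]\<close> suffices.
  By the two constants theorem in the slit half strip (\<open>two_constants\<close>), \<open>|F| \<le> \<mu>\<^sup>w M\<^sup>1\<^sup>-\<^sup>w\<close> on \<open>[0, B0]\<close>,
  where \<open>\<mu>\<close> is a bound on the slit \<open>[0, B]\<close> and \<open>M\<close> the bound in the strip. Finally \<open>\<mu>\<^sup>2\<close> can be taken as a
  multiple of \<open>\<parallel>f\<parallel>\<close> times the norm of the truncated transform, because \<open>|F|\<close> is Lipschitz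
  (\<open>band_sup_le\<close>). Solving for \<open>\<parallel>f\<parallel>\<close> gives the constant \<open>k\<close> (\<open>norm_le_k_const\<close>).

  The harmonic measure is computed in closed form: with \<open>q = sinh (pi B / (2 L)) / sinh (pi z / (2 L))\<close> it
  is \<open>(2/pi) Re Arcsin q\<close>. Uniqueness follows from a maximum principle with one exceptional boundary
  point, the origin, where the boundary data jump. On the real axis the formula shows that the harmonic
  measure decreases along \<open>(B, \<infinity>)\<close> and tends to \<open>1\<close> as \<open>B \<rightarrow> B0\<close>, which gives the second limit. The
  other two only need \<open>0 < w \<le> 1\<close> and \<open>2 B0 / (1 - 1/\<gamma>) \<ge> 1\<close>; for the given \<open>B0\<close> the latter holds by
  the Poincare inequality.

  For the energy estimate, \<open>f\<close> is identified with the primitive of its weak derivative by the lemma of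
  du Bois-Reymond, and Plancherel's theorem is replaced by a regularisation of the energy integral with
  a Gaussian factor (\<open>ft_gaussian\<close>).
\<close>

section \<open>Harmonic functions and the maximum principle\<close>

text \<open>The second derivative test: \<open>g'\<close> is only assumed differentiable at \<open>0\<close>.\<close>

lemma local_max_second_derivative_nonpos:
  fixes g g' :: "real \<Rightarrow> real"
  assumes "r > 0"
    and g: "\<And>t. \<bar>t\<bar> < r \<Longrightarrow> (g has_real_derivative g' t) (at t)"
    and g': "(g' has_real_derivative l) (at 0)"
    and le: "\<And>t. \<bar>t\<bar> < r \<Longrightarrow> g t \<le> g 0"
  shows "l \<le> 0"
proof (rule ccontr)
  assume "\<not> l \<le> 0"
  then have "l > 0" by simp
  have "g' 0 = 0"
    using DERIV_local_max[OF g[of 0] \<open>r > 0\<close>] le \<open>r > 0\<close> by simp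
  obtain d where d: "d > 0" "\<And>h. \<lbrakk>h > 0; h < d\<rbrakk> \<Longrightarrow> g' 0 < g' (0 + h)"
    using DERIV_pos_inc_right[OF g' \<open>l > 0\<close>] by blast
  define s where "s = min d r / 2"
  have s: "0 < s" "s < d" "s < r" using d \<open>r > 0\<close> by (auto simp: s_def)
  have "g 0 < g s"
  proof (rule DERIV_pos_imp_increasing_open[OF s(1)])
    show "\<exists>y. DERIV g x :> y \<and> 0 < y" if "0 < x" "x < s" for x
      using g[of x] d(2)[of x] that s \<open>g' 0 = 0\<close> by (intro exI[of _ "g' x"]) auto
    have "isCont g x" if "0 \<le> x" "x \<le> s" for x
      using g[of x] that s by (intro DERIV_isCont) auto
    then show "continuous_on {0..s} g"
      by (simp add: continuous_at_imp_continuous_on)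
  qed
  with le[of s] s show False by simp
qed

lemma harmonic_onE:
  assumes "h harmonic_on U"
  obtains p q px py qx qy where
    "continuous_on U px" "continuous_on U py" "continuous_on U qx" "continuous_on U qy"
    "\<And>z. z \<in> U \<Longrightarrow> (h has_derivative (\<lambda>v. p z * Re v + q z * Im v)) (at z)"
    "\<And>z. z \<in> U \<Longrightarrow> (p has_derivative (\<lambda>v. px z * Re v + py z * Im v)) (at z)"
    "\<And>z. z \<in> U \<Longrightarrow> (q has_derivative (\<lambda>v. qx z * Re v + qy z * Im v)) (at z)"
    "\<And>z. z \<in> U \<Longrightarrow> px z + qy z = 0"
  using assms unfolding harmonic_on_def by blast

lemma harmonic_onI:
  assumes
    "continuous_on U px" "continuous_on U py" "continuous_on U qx" "continuous_on U qy"
    "\<And>z. z \<in> U \<Longrightarrow> (h has_derivative (\<lambda>v. p z * Re v + q z * Im v)) (at z)"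
    "\<And>z. z \<in> U \<Longrightarrow> (p has_derivative (\<lambda>v. px z * Re v + py z * Im v)) (at z)"
    "\<And>z. z \<in> U \<Longrightarrow> (q has_derivative (\<lambda>v. qx z * Re v + qy z * Im v)) (at z)"
    "\<And>z. z \<in> U \<Longrightarrow> px z + qy z = 0"
  shows "h harmonic_on U"
  unfolding harmonic_on_def
  by (intro exI[of _ p] exI[of _ q] exI[of _ px] exI[of _ py] exI[of _ qx] exI[of _ qy]
      conjI ballI assms)

lemma harmonic_on_subset:
  assumes "h harmonic_on U" "V \<subseteq> U"
  shows "h harmonic_on V"
proof -
  obtain p q px py qx qy where h:
    "continuous_on U px" "continuous_on U py" "continuous_on U qx" "continuous_on U qy"
    "\<And>z. z \<in> U \<Longrightarrow> (h has_derivative (\<lambda>v. p z * Re v + q z * Im v)) (at z)"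
    "\<And>z. z \<in> U \<Longrightarrow> (p has_derivative (\<lambda>v. px z * Re v + py z * Im v)) (at z)"
    "\<And>z. z \<in> U \<Longrightarrow> (q has_derivative (\<lambda>v. qx z * Re v + qy z * Im v)) (at z)"
    "\<And>z. z \<in> U \<Longrightarrow> px z + qy z = 0"
    using assms(1) by (rule harmonic_onE) (rule that)
  show ?thesis
    by (rule harmonic_onI[where p = p and q = q and px = px and py = py and qx = qx and qy = qy])
       (use h assms(2) in \<open>auto intro: continuous_on_subset\<close>)
qed

lemma harmonic_on_cong:
  assumes "h harmonic_on U" "open U" "\<And>z. z \<in> U \<Longrightarrow> h z = k z"
  shows "k harmonic_on U"
proof -
  obtain p q px py qx qy where h:
    "continuous_on U px" "continuous_on U py" "continuous_on U qx" "continuous_on U qy"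
    "\<And>z. z \<in> U \<Longrightarrow> (h has_derivative (\<lambda>v. p z * Re v + q z * Im v)) (at z)"
    "\<And>z. z \<in> U \<Longrightarrow> (p has_derivative (\<lambda>v. px z * Re v + py z * Im v)) (at z)"
    "\<And>z. z \<in> U \<Longrightarrow> (q has_derivative (\<lambda>v. qx z * Re v + qy z * Im v)) (at z)"
    "\<And>z. z \<in> U \<Longrightarrow> px z + qy z = 0"
    using assms(1) by (rule harmonic_onE) (rule that)
  have *: "(k has_derivative D) (at z)" if "(h has_derivative D) (at z)" "z \<in> U" for D z
    using has_derivative_transform_within_open[OF that(1) assms(2) that(2)] assms(3) by auto
  show ?thesis
    by (rule harmonic_onI[where p = p and q = q and px = px and py = py and qx = qx and qy = qy])
       (use h * in auto)
qed

lemma harmonic_on_imp_continuous_on: "h harmonic_on U \<Longrightarrow> continuous_on U h"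
  by (erule harmonic_onE) (blast intro: continuous_at_imp_continuous_on has_derivative_continuous)

lemma harmonic_on_lincomb:
  assumes "h harmonic_on U" "k harmonic_on U"
  shows "(\<lambda>z. a * h z + b * k z) harmonic_on U"
proof -
  obtain p q px py qx qy where h:
    "continuous_on U px" "continuous_on U py" "continuous_on U qx" "continuous_on U qy"
    "\<And>z. z \<in> U \<Longrightarrow> (h has_derivative (\<lambda>v. p z * Re v + q z * Im v)) (at z)"
    "\<And>z. z \<in> U \<Longrightarrow> (p has_derivative (\<lambda>v. px z * Re v + py z * Im v)) (at z)"
    "\<And>z. z \<in> U \<Longrightarrow> (q has_derivative (\<lambda>v. qx z * Re v + qy z * Im v)) (at z)"
    "\<And>z. z \<in> U \<Longrightarrow> px z + qy z = 0"
    using assms(1) by (rule harmonic_onE) (rule that)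
  obtain p' q' px' py' qx' qy' where k:
    "continuous_on U px'" "continuous_on U py'" "continuous_on U qx'" "continuous_on U qy'"
    "\<And>z. z \<in> U \<Longrightarrow> (k has_derivative (\<lambda>v. p' z * Re v + q' z * Im v)) (at z)"
    "\<And>z. z \<in> U \<Longrightarrow> (p' has_derivative (\<lambda>v. px' z * Re v + py' z * Im v)) (at z)"
    "\<And>z. z \<in> U \<Longrightarrow> (q' has_derivative (\<lambda>v. qx' z * Re v + qy' z * Im v)) (at z)"
    "\<And>z. z \<in> U \<Longrightarrow> px' z + qy' z = 0"
    using assms(2) by (rule harmonic_onE) (rule that)
  have lin: "((\<lambda>z. a * F z + b * G z) has_derivative
      (\<lambda>v. (a * x + b * x') * Re v + (a * y + b * y') * Im v)) (at z)"
    if "(F has_derivative (\<lambda>v. x * Re v + y * Im v)) (at z)"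
       "(G has_derivative (\<lambda>v. x' * Re v + y' * Im v)) (at z)" for F G x y x' y' z
    by (rule has_derivative_eq_rhs[OF has_derivative_add[OF
          has_derivative_mult_right[OF that(1)] has_derivative_mult_right[OF that(2)]]])
       (auto simp: algebra_simps)
  have eq: "a * px z + b * px' z + (a * qy z + b * qy' z) = 0" if "z \<in> U" for z
  proof -
    have eq: "a * px z + b * px' z + (a * qy z + b * qy' z) = a * (px z + qy z) + b * (px' z + qy' z)"
      by (simp add: algebra_simps)
    then show ?thesis using h(8) k(8) that by simp
  qed
  show ?thesis
    by (rule harmonic_onI[where p = "\<lambda>z. a * p z + b * p' z" and q = "\<lambda>z. a * q z + b * q' z"
          and px = "\<lambda>z. a * px z + b * px' z" and py = "\<lambda>z. a * py z + b * py' z"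
          and qx = "\<lambda>z. a * qx z + b * qx' z" and qy = "\<lambda>z. a * qy z + b * qy' z"])
       (use h(1-4) k(1-4) lin[OF h(5) k(5)] lin[OF h(6) k(6)] lin[OF h(7) k(7)] eq
         in \<open>auto intro!: continuous_on_add continuous_on_mult_left\<close>)
qed

lemma harmonic_on_const: "(\<lambda>z. c) harmonic_on U"
  by (rule harmonic_onI[where p = "\<lambda>_. 0" and q = "\<lambda>_. 0" and px = "\<lambda>_. 0" and py = "\<lambda>_. 0"
        and qx = "\<lambda>_. 0" and qy = "\<lambda>_. 0"]) auto

lemma harmonic_on_Re:
  assumes "open U" "\<phi> holomorphic_on U"
  shows "(\<lambda>z. Re (\<phi> z)) harmonic_on U"
proof -
  have 1: "(\<phi> has_field_derivative deriv \<phi> z) (at z)" if "z \<in> U" for z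
    using assms that by (simp add: holomorphic_derivI)
  have h2: "deriv \<phi> holomorphic_on U" using assms by (simp add: holomorphic_deriv)
  then have 2: "(deriv \<phi> has_field_derivative deriv (deriv \<phi>) z) (at z)" if "z \<in> U" for z
    using assms that by (simp add: holomorphic_derivI)
  have c: "continuous_on U (deriv (deriv \<phi>))"
    using h2 assms by (simp add: holomorphic_deriv holomorphic_on_imp_continuous_on)
  have R: "((\<lambda>z. Re (F z)) has_derivative (\<lambda>v. Re D * Re v + (- Im D) * Im v)) (at z)"
    "((\<lambda>z. - Im (F z)) has_derivative (\<lambda>v. (- Im D) * Re v + (- Re D) * Im v)) (at z)"
    if "(F has_field_derivative D) (at z)" for F D z
    using has_derivative_Re[OF that[unfolded has_field_derivative_def]]
      has_derivative_minus[OF has_derivative_Im[OF that[unfolded has_field_derivative_def]]]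
    by (auto elim!: has_derivative_eq_rhs simp: algebra_simps)
  show ?thesis
    by (rule harmonic_onI[where p = "\<lambda>z. Re (deriv \<phi> z)" and q = "\<lambda>z. - Im (deriv \<phi> z)"
          and px = "\<lambda>z. Re (deriv (deriv \<phi>) z)" and py = "\<lambda>z. - Im (deriv (deriv \<phi>) z)"
          and qx = "\<lambda>z. - Im (deriv (deriv \<phi>) z)" and qy = "\<lambda>z. - Re (deriv (deriv \<phi>) z)"])
       (use R[OF 1] R[OF 2] c in \<open>auto intro!: continuous_on_Re continuous_on_Im continuous_on_minus\<close>)
qed

text \<open>Adding \<open>d |z|\<^sup>2\<close> makes the Laplacian strictly positive.\<close>

lemma harmonic_plus_square_no_local_max:
  assumes h: "h harmonic_on U" and "open U" "z \<in> U" "d > 0"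
    and max: "\<And>w. w \<in> U \<Longrightarrow> h w + d * (cmod w)\<^sup>2 \<le> h z + d * (cmod z)\<^sup>2"
  shows False
proof -
  obtain p q px py qx qy where D:
    "\<And>z. z \<in> U \<Longrightarrow> (h has_derivative (\<lambda>v. p z * Re v + q z * Im v)) (at z)"
    "\<And>z. z \<in> U \<Longrightarrow> (p has_derivative (\<lambda>v. px z * Re v + py z * Im v)) (at z)"
    "\<And>z. z \<in> U \<Longrightarrow> (q has_derivative (\<lambda>v. qx z * Re v + qy z * Im v)) (at z)"
    "\<And>z. z \<in> U \<Longrightarrow> px z + qy z = 0"
    using h by (rule harmonic_onE) (rule that)
  obtain r where r: "r > 0" "ball z r \<subseteq> U" using \<open>open U\<close> \<open>z \<in> U\<close> by (meson openE)
  have inU: "z + of_real t * e \<in> U" if "\<bar>t\<bar> < r" "cmod e = 1" for t e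
    using that r(2) by (auto simp: dist_norm norm_mult subset_iff)
  have line: "((\<lambda>t. F (z + of_real t * e)) has_real_derivative x * Re e + y * Im e) (at t)"
    if "(F has_derivative (\<lambda>v. x * Re v + y * Im v)) (at (z + of_real t * e))" for F x y t e
  proof -
    have "((\<lambda>t. z + of_real t * e) has_derivative (\<lambda>s. of_real s * e)) (at t)"
      by (auto intro!: derivative_eq_intros)
    from has_derivative_compose[OF this that] show ?thesis
      unfolding has_field_derivative_def
      by (rule has_derivative_eq_rhs) (auto simp: algebra_simps)
  qed
  have sq: "((\<lambda>t. d * (cmod (z + of_real t * e))\<^sup>2) has_real_derivative
      2 * d * (Re (z + of_real t * e) * Re e + Im (z + of_real t * e) * Im e)) (at t)" for t e
    unfolding cmod_power2 by (auto intro!: derivative_eq_intros simp: algebra_simps)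
  have sq': "((\<lambda>t. 2 * d * (Re (z + of_real t * e) * Re e + Im (z + of_real t * e) * Im e))
      has_real_derivative 2 * d * ((Re e)\<^sup>2 + (Im e)\<^sup>2)) (at t)" for t e
    by (auto intro!: derivative_eq_intros simp: algebra_simps power2_eq_square)
  have "px z + 2 * d \<le> 0"
  proof (rule local_max_second_derivative_nonpos[OF r(1)])
    let ?w = "\<lambda>t. z + of_real t * (1::complex)"
    show "((\<lambda>t. h (?w t) + d * (cmod (?w t))\<^sup>2) has_real_derivative
        p (?w t) + 2 * d * (Re (?w t) * Re 1 + Im (?w t) * Im 1)) (at t)" if "\<bar>t\<bar> < r" for t
      using DERIV_add[OF line[OF D(1)[OF inU[OF that]]] sq[of 1 t], of 1] by simp
    show "((\<lambda>t. p (?w t) + 2 * d * (Re (?w t) * Re 1 + Im (?w t) * Im 1))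
        has_real_derivative px z + 2 * d) (at 0)"
      using DERIV_add[OF line[of p "px z" "py z" 0 1] sq'[of 1 0]] D(2)[OF \<open>z \<in> U\<close>] by simp
    show "h (?w t) + d * (cmod (?w t))\<^sup>2 \<le> h (?w 0) + d * (cmod (?w 0))\<^sup>2" if "\<bar>t\<bar> < r" for t
      using max[OF inU[OF that, of 1]] by simp
  qed
  moreover have "qy z + 2 * d \<le> 0"
  proof (rule local_max_second_derivative_nonpos[OF r(1)])
    let ?w = "\<lambda>t. z + of_real t * \<i>"
    show "((\<lambda>t. h (?w t) + d * (cmod (?w t))\<^sup>2) has_real_derivative
        q (?w t) + 2 * d * (Re (?w t) * Re \<i> + Im (?w t) * Im \<i>)) (at t)" if "\<bar>t\<bar> < r" for t
      using DERIV_add[OF line[OF D(1)[OF inU[OF that]]] sq[of \<i> t], of \<i>] by simp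
    show "((\<lambda>t. q (?w t) + 2 * d * (Re (?w t) * Re \<i> + Im (?w t) * Im \<i>))
        has_real_derivative qy z + 2 * d) (at 0)"
      using DERIV_add[OF line[of q "qx z" "qy z" 0 \<i>] sq'[of \<i> 0]] D(3)[OF \<open>z \<in> U\<close>] by simp
    show "h (?w t) + d * (cmod (?w t))\<^sup>2 \<le> h (?w 0) + d * (cmod (?w 0))\<^sup>2" if "\<bar>t\<bar> < r" for t
      using max[OF inU[OF that, of \<i>]] by simp
  qed
  ultimately show False using D(4)[OF \<open>z \<in> U\<close>] \<open>d > 0\<close> by simp
qed

lemma harmonic_ln_cmod_locally:
  assumes "open U" "F holomorphic_on U" "z \<in> U" "F z \<noteq> 0"
  obtains N where "open N" "z \<in> N" "N \<subseteq> U" "\<And>w. w \<in> N \<Longrightarrow> F w \<noteq> 0"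
    "(\<lambda>w. ln (cmod (F w))) harmonic_on N"
proof -
  define N where "N = U \<inter> {w. 0 < Re (F w / F z)} "
  have cont: "continuous_on U (\<lambda>w. Re (F w / F z))"
    using assms holomorphic_on_imp_continuous_on by (intro continuous_intros) auto
  have "open N"
    using continuous_open_preimage[OF cont \<open>open U\<close>, of "{0<..}"]
    by (simp add: N_def vimage_def)
  have nz: "F w \<noteq> 0" "F w / F z \<notin> \<real>\<^sub>\<le>\<^sub>0" if "w \<in> N" for w
    using that by (auto simp: N_def complex_nonpos_Reals_iff)
  have "(\<lambda>w. Ln (F w / F z) + of_real (ln (cmod (F z)))) holomorphic_on N"
  proof (rule holomorphic_on_add[OF holomorphic_on_Ln' holomorphic_on_const])
    have "F holomorphic_on N" using holomorphic_on_subset[OF assms(2)] by (simp add: N_def)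
    then show "(\<lambda>w. F w / F z) holomorphic_on N"
      by (rule holomorphic_on_divide[OF _ holomorphic_on_const]) (rule assms(4))
  qed (rule nz)
  then have "(\<lambda>w. Re (Ln (F w / F z) + of_real (ln (cmod (F z))))) harmonic_on N"
    by (rule harmonic_on_Re[OF \<open>open N\<close>])
  then have "(\<lambda>w. ln (cmod (F w))) harmonic_on N"
    by (rule harmonic_on_cong[OF _ \<open>open N\<close>]) (use nz(1) assms(4) in \<open>simp add: norm_divide ln_div\<close>)
  moreover have "z \<in> N" "N \<subseteq> U" using assms(3,4) by (auto simp: N_def)
  ultimately show ?thesis using that[OF \<open>open N\<close>] nz(1) by blast
qed

text \<open>
  A maximum principle for the subharmonic function \<open>ln |F| - H\<close>, stated multiplicatively so that
  zeros of \<open>F\<close> need no special treatment. The domain may be unbounded; the boundary condition is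
  \<open>limsup \<le> 1\<close> at each finite boundary point and at infinity. At a point where the perturbed function
  is maximal \<open>F\<close> does not vanish, so there \<open>ln |F| - H\<close> is harmonic.
\<close>

lemma maximum_principle:
  assumes U: "open U" and F: "F holomorphic_on U" and H: "H harmonic_on U"
    and bd: "\<And>\<zeta> c. \<zeta> \<in> frontier U \<Longrightarrow> c > 1 \<Longrightarrow>
      eventually (\<lambda>z. cmod (F z) * exp (- H z) < c) (at \<zeta> within U)"
    and inf: "\<And>c. c > 1 \<Longrightarrow>
      eventually (\<lambda>z. cmod (F z) * exp (- H z) < c) (inf at_infinity (principal U))"
    and "z \<in> U"
  shows "cmod (F z) * exp (- H z) \<le> 1"
proof (rule ccontr)
  define V where "V z = cmod (F z) * exp (- H z)" for z
  assume "\<not> ?thesis"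
  then have Vz: "V z > 1" by (simp add: V_def)
  define c where "c = sqrt (V z)"
  have c: "c > 1" "c * c = V z" using Vz by (auto simp: c_def)
  have contV: "continuous_on U V"
    unfolding V_def using F H
    by (intro continuous_intros holomorphic_on_imp_continuous_on harmonic_on_imp_continuous_on)
  define K where "K = {w \<in> U. V w \<ge> c}"
  have zK: "z \<in> K" using c Vz \<open>z \<in> U\<close> mult_right_mono[of 1 c c] by (simp add: K_def)
  obtain R where R: "\<And>w. w \<in> U \<Longrightarrow> cmod w \<ge> R \<Longrightarrow> V w < c"
    using inf[OF \<open>c > 1\<close>] unfolding V_def eventually_inf_principal eventually_at_infinity by blast
  have Rb: "cmod w < R" if "w \<in> K" for w using R[of w] that by (force simp: K_def)
  have "closed K"
    unfolding closed_limpt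
  proof (intro allI impI)
    fix \<zeta> assume lim: "\<zeta> islimpt K"
    then have "\<zeta> islimpt U" by (rule islimpt_subset) (auto simp: K_def)
    have ne: "at \<zeta> within K \<noteq> bot" using lim by (simp add: trivial_limit_within)
    show "\<zeta> \<in> K"
    proof (cases "\<zeta> \<in> U")
      case True
      have "(V \<longlongrightarrow> V \<zeta>) (at \<zeta> within K)"
        using contV True unfolding continuous_on_def
        by (metis (no_types, lifting) K_def mem_Collect_eq subsetI tendsto_within_subset)
      then have "c \<le> V \<zeta>"
        by (rule tendsto_lowerbound[OF _ _ ne]) (auto simp: eventually_at_filter K_def)
      with True show ?thesis by (simp add: K_def)
    next
      case False
      have "\<zeta> \<in> frontier U"
        using \<open>\<zeta> islimpt U\<close> False U by (simp add: frontier_def closure_def interior_open)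
      from bd[OF this \<open>c > 1\<close>] have "eventually (\<lambda>w. V w < c) (at \<zeta> within K)"
        unfolding V_def by (rule filter_leD[rotated]) (auto simp: K_def intro!: at_le)
      moreover have "eventually (\<lambda>w. V w \<ge> c) (at \<zeta> within K)"
        by (auto simp: eventually_at_filter K_def)
      ultimately have "eventually (\<lambda>w. False) (at \<zeta> within K)" by eventually_elim auto
      with ne show ?thesis by simp
    qed
  qed
  moreover have "bounded K" using Rb by (auto simp: bounded_iff intro: less_imp_le)
  ultimately have "compact K" by (simp add: compact_eq_bounded_closed)
  have "R > 0" using Rb[OF zK] by (meson less_le_trans norm_ge_zero not_le)
  have Vpos: "V w > 0" if "w \<in> K" for w using that c by (auto simp: K_def)
  \<comment> \<open>The perturbation is smaller than the gap \<open>ln c\<close> between the level of \<open>z\<close> and that of \<open>K\<close>.\<close>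
  define d where "d = ln c / (2 * R\<^sup>2)"
  have d: "d > 0" "d * R\<^sup>2 < ln c" using c \<open>R > 0\<close> by (auto simp: d_def)
  have "continuous_on K (\<lambda>w. ln (V w) + d * (cmod w)\<^sup>2)"
    using Vpos contV by (intro continuous_intros) (auto intro: continuous_on_subset simp: K_def, fastforce)
  then obtain y where y: "y \<in> K" "\<And>w. w \<in> K \<Longrightarrow> ln (V w) + d * (cmod w)\<^sup>2 \<le> ln (V y) + d * (cmod y)\<^sup>2"
    using continuous_attains_sup[OF \<open>compact K\<close>] zK by blast
  have "d * (cmod y)\<^sup>2 < ln c"
  proof -
    have "d * (cmod y)\<^sup>2 \<le> d * R\<^sup>2"
      using d Rb[OF y(1)] by (intro mult_left_mono power_mono) auto
    with d show ?thesis by linarith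
  qed
  moreover have "ln (V z) = 2 * ln c" using c by (metis ln_mult_pos mult_2 less_trans zero_less_one)
  moreover have "0 \<le> d * (cmod z)\<^sup>2" using d by simp
  ultimately have "ln (V y) > ln c" using y(2)[OF zK] by linarith
  then have "V y > c" using Vpos[OF y(1)] c by simp
  have "y \<in> U" using y by (simp add: K_def)
  have "F y \<noteq> 0" using Vpos[OF y(1)] by (auto simp: V_def)
  then obtain N where N: "open N" "y \<in> N" "N \<subseteq> U" "\<And>w. w \<in> N \<Longrightarrow> F w \<noteq> 0"
    "(\<lambda>w. ln (cmod (F w))) harmonic_on N"
    using harmonic_ln_cmod_locally[OF U F \<open>y \<in> U\<close>] by metis
  define N' where "N' = N \<inter> (U \<inter> V -` {c<..})"
  have "open N'" unfolding N'_def
    using N(1) continuous_open_preimage[OF contV U, of "{c<..}"] by auto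
  have "(\<lambda>w. 1 * ln (cmod (F w)) + (-1) * H w) harmonic_on N'"
    by (intro harmonic_on_lincomb harmonic_on_subset[OF N(5)] harmonic_on_subset[OF H])
       (auto simp: N'_def)
  then have "(\<lambda>w. ln (V w)) harmonic_on N'"
    by (rule harmonic_on_cong[OF _ \<open>open N'\<close>]) (use N(4) in \<open>auto simp: N'_def V_def ln_mult\<close>)
  then show False
  proof (rule harmonic_plus_square_no_local_max[OF _ \<open>open N'\<close> _ \<open>d > 0\<close>])
    show "y \<in> N'" using N \<open>y \<in> U\<close> \<open>V y > c\<close> by (simp add: N'_def)
    show "ln (V w) + d * (cmod w)\<^sup>2 \<le> ln (V y) + d * (cmod y)\<^sup>2" if "w \<in> N'" for w
      using that by (intro y) (auto simp: N'_def K_def)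
  qed
qed

text \<open>
  In the right half-plane a bounded function may violate the boundary condition at \<open>0\<close>: the barrier
  \<open>ln |1 + 1/z|\<close> is positive and harmonic there and tends to infinity at \<open>0\<close>, so that any positive
  multiple of it restores the boundary condition.
\<close>

lemma maximum_principle_except_zero:
  assumes U: "open U" "U \<subseteq> {z. Re z > 0}" and F: "F holomorphic_on U" and H: "H harmonic_on U"
    and M: "\<And>z. z \<in> U \<Longrightarrow> cmod (F z) * exp (- H z) \<le> M"
    and bd: "\<And>\<zeta> c. \<zeta> \<in> frontier U \<Longrightarrow> \<zeta> \<noteq> 0 \<Longrightarrow> c > 1 \<Longrightarrow>
      eventually (\<lambda>z. cmod (F z) * exp (- H z) < c) (at \<zeta> within U)"
    and inf: "\<And>c. c > 1 \<Longrightarrow>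
      eventually (\<lambda>z. cmod (F z) * exp (- H z) < c) (inf at_infinity (principal U))"
    and "z \<in> U"
  shows "cmod (F z) * exp (- H z) \<le> 1"
proof -
  define b where "b z = Re (Ln (1 + 1 / z))" for z
  have Re1: "Re (1 + 1 / z) > 1" if "Re z > 0" for z
    using that by (auto simp: Re_divide cmod_def zero_less_divide_iff add_pos_nonneg)
  have bpos: "b z \<ge> 0" if "Re z > 0" for z
  proof -
    have "1 \<le> cmod (1 + 1 / z)" using Re1[OF that] complex_Re_le_cmod[of "1 + 1/z"] by linarith
    moreover have "1 + 1 / z \<noteq> 0"
      using Re1[OF that] by (metis not_one_less_zero zero_complex.sel(1))
    ultimately show ?thesis by (simp add: b_def)
  qed
  have "(\<lambda>z. Ln (1 + 1 / z)) holomorphic_on U"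
    using Re1 U(2) by (intro holomorphic_intros) (fastforce simp: complex_nonpos_Reals_iff)+
  then have bh: "b harmonic_on U" unfolding b_def using U harmonic_on_Re by blast
  have *: "cmod (F z) * exp (- (1 * H z + \<epsilon> * b z)) \<le> 1" if "\<epsilon> > 0" for \<epsilon>
  proof (rule maximum_principle[OF U(1) F harmonic_on_lincomb[OF H bh] _ _ \<open>z \<in> U\<close>])
    have le: "cmod (F z) * exp (- (1 * H z + \<epsilon> * b z)) \<le> cmod (F z) * exp (- H z)" if "z \<in> U" for z
      using that U(2) bpos[of z] \<open>\<epsilon> > 0\<close> by (intro mult_left_mono) auto
    show "eventually (\<lambda>z. cmod (F z) * exp (- (1 * H z + \<epsilon> * b z)) < c) (inf at_infinity (principal U))"
      if "c > 1" for c
      using inf[OF that] unfolding eventually_inf_principal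
      by (rule eventually_mono) (use le in fastforce)
    show "eventually (\<lambda>z. cmod (F z) * exp (- (1 * H z + \<epsilon> * b z)) < c) (at \<zeta> within U)"
      if "\<zeta> \<in> frontier U" "c > 1" for \<zeta> c
    proof (cases "\<zeta> = 0")
      case False
      show ?thesis using bd[OF that(1) False that(2)] unfolding eventually_at_filter
        by (rule eventually_mono) (use le in fastforce)
    next
      case True
      have inv: "filterlim (\<lambda>z. 1 / z) at_infinity (at (0::complex) within U)"
        using filterlim_mono[OF filterlim_inverse_at_infinity[where 'a=complex] order_refl at_le[of U UNIV 0]]
        by (simp add: inverse_eq_divide[abs_def])
      have "filterlim (\<lambda>z. 1 + 1 / z) at_infinity (at 0 within U)"
        by (rule tendsto_add_filterlim_at_infinity[OF tendsto_const inv])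
      then have "filterlim (\<lambda>z. cmod (1 + 1 / z)) at_top (at 0 within U)"
        by (rule filterlim_at_infinity_imp_norm_at_top)
      then have "filterlim (\<lambda>z. ln (cmod (1 + 1 / z))) at_top (at 0 within U)"
        by (rule filterlim_compose[OF ln_at_top])
      moreover have "eventually (\<lambda>z. b z = ln (cmod (1 + 1 / z))) (at 0 within U)"
        using Re1 U(2) unfolding eventually_at_filter b_def
        by (intro always_eventually allI impI Re_Ln)
           (metis (no_types, lifting) mem_Collect_eq not_one_less_zero subsetD zero_complex.sel(1))
      ultimately have "filterlim b at_top (at 0 within U)"
        by (simp add: filterlim_cong)
      then have "filterlim (\<lambda>z. \<epsilon> * b z) at_top (at 0 within U)"
        by (rule filterlim_tendsto_pos_mult_at_top[OF tendsto_const \<open>\<epsilon> > 0\<close>])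
      then have "((\<lambda>z. exp (- (\<epsilon> * b z))) \<longlongrightarrow> 0) (at 0 within U)"
        by (intro filterlim_compose[OF exp_at_bot]) (simp add: filterlim_uminus_at_top)
      then have "((\<lambda>z. M * exp (- (\<epsilon> * b z))) \<longlongrightarrow> M * 0) (at 0 within U)"
        by (intro tendsto_intros)
      then have "eventually (\<lambda>z. M * exp (- (\<epsilon> * b z)) < c) (at 0 within U)"
        by (rule order_tendstoD(2)) (use \<open>c > 1\<close> in simp)
      then show ?thesis unfolding True eventually_at_filter
      proof (rule eventually_mono, intro impI)
        fix z assume z: "z \<noteq> 0 \<longrightarrow> z \<in> U \<longrightarrow> M * exp (- (\<epsilon> * b z)) < c" "z \<noteq> 0" "z \<in> U"
        have "cmod (F z) * exp (- (1 * H z + \<epsilon> * b z)) = cmod (F z) * exp (- H z) * exp (- (\<epsilon> * b z))"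
          by (simp add: exp_diff exp_minus field_simps)
        also have "\<dots> \<le> M * exp (- (\<epsilon> * b z))" using M z by (intro mult_right_mono) auto
        finally show "cmod (F z) * exp (- (1 * H z + \<epsilon> * b z)) < c" using z by simp
      qed
    qed
  qed
  have "((\<lambda>\<epsilon>. cmod (F z) * exp (- (1 * H z + \<epsilon> * b z))) \<longlongrightarrow> cmod (F z) * exp (- (1 * H z + 0 * b z))) (at_right 0)"
    by (intro tendsto_intros)
  then have "cmod (F z) * exp (- (1 * H z + 0 * b z)) \<le> 1"
    by (rule tendsto_upperbound) (use * eventually_at_right_less[of 0] in \<open>auto elim: eventually_mono\<close>)
  then show ?thesis by simp
qed

section \<open>The harmonic measure of the slit\<close>

lemma cmod_sin_diff:
  "cmod (sin w + 1) - cmod (sin w - 1) = 2 * sin (Re w)"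
proof -
  define a b where "a = Re w" and "b = Im w"
  have sc: "sin w = Complex (sin a * cosh b) (cos a * sinh b)"
    by (rule complex_eqI) (simp_all add: Re_sin Im_sin a_def b_def cosh_field_def sinh_field_def)
  have e: "(cos a)\<^sup>2 = 1 - (sin a)\<^sup>2" "(sinh b)\<^sup>2 = (cosh b)\<^sup>2 - 1"
    by (simp_all add: cosh_square_eq cos_squared_eq)
  have "cmod (sin w + of_real s) = cosh b + s * sin a" if "s = 1 \<or> s = -1" for s
  proof -
    have "cosh b \<ge> 1" "\<bar>s * sin a\<bar> \<le> 1" using that by (auto simp: cosh_real_ge_1)
    then have nn: "cosh b + s * sin a \<ge> 0" by linarith
    have "(cmod (sin w + of_real s))\<^sup>2 = (sin a * cosh b + s)\<^sup>2 + (cos a * sinh b)\<^sup>2"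
      by (simp add: sc cmod_power2)
    also have "\<dots> = (cosh b + s * sin a)\<^sup>2"
      unfolding power_mult_distrib e using that by (auto simp: algebra_simps power2_eq_square)
    finally show ?thesis using nn by (simp add: power2_eq_iff_nonneg)
  qed
  from this[of 1] this[of "-1"] show ?thesis by (simp add: a_def)
qed

text \<open>
  The right-hand side, unlike \<open>Arcsin\<close>, is continuous on the whole plane. This gives the boundary
  values on both sides of the slit at once.
\<close>

lemma Re_Arcsin_eq:
  assumes "Re q > 0"
  shows "Re (Arcsin q) = arcsin ((cmod (q + 1) - cmod (q - 1)) / 2)"
proof -
  have "0 \<le> Re (cos (Arcsin q))" using assms by (metis cos_Arcsin Re_csqrt)
  then have "0 \<le> cos (Re (Arcsin q)) * ((exp (Im (Arcsin q)) + exp (- Im (Arcsin q))) / 2)"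
    by (simp add: Re_cos)
  then have "0 \<le> cos (Re (Arcsin q))"
    by (simp add: zero_le_mult_iff) (metis add_less_cancel_right add.left_neutral add_pos_pos exp_gt_zero less_asym not_le)
  then have "\<bar>Re (Arcsin q)\<bar> \<le> pi / 2"
    using Re_Arcsin_bound[of q] cos_monotone_0_pi[of "pi/2" "\<bar>Re (Arcsin q)\<bar>"] by fastforce
  then show ?thesis
    using cmod_sin_diff[of "Arcsin q"] by (simp add: arcsin_sin)
qed

lemma cmod_of_real_plus_minus_1:
  "cmod (of_real r + 1) = \<bar>r + 1\<bar>" "cmod (of_real r - 1) = \<bar>r - 1\<bar>"
  using norm_of_real[of "r + 1", where 'a = complex] norm_of_real[of "r - 1", where 'a = complex]
  by (simp_all del: norm_of_real)

lemma cmod_sum_diff_bounds: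
  "- 1 \<le> (cmod (q + 1) - cmod (q - 1)) / 2" "(cmod (q + 1) - cmod (q - 1)) / 2 \<le> 1"
proof -
  have "\<bar>cmod (q + 1) - cmod (q - 1)\<bar> \<le> cmod ((q + 1) - (q - 1))" by (rule norm_triangle_ineq3)
  also have "\<dots> = 2" by simp
  finally show "- 1 \<le> (cmod (q + 1) - cmod (q - 1)) / 2" "(cmod (q + 1) - cmod (q - 1)) / 2 \<le> 1"
    by simp_all
qed

text \<open>
  The function \<open>z \<mapsto> sinh (pi z / (2 L))\<close> maps the half strip conformally onto the right half-plane and
  the slit \<open>[0, B]\<close> onto the segment \<open>[0, sinh (pi B / (2 L))]\<close>. The quotient below therefore maps the
  slit half strip onto the right half-plane without \<open>[1, \<infinity>)\<close>; the origin, where the boundary data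
  jump, corresponds to infinity.
\<close>

definition slit_coord :: "real \<Rightarrow> real \<Rightarrow> complex \<Rightarrow> complex" where
  "slit_coord L B z = of_real (sinh (pi * B / (2 * L))) / sinh (of_real (pi / (2 * L)) * z)"

text \<open>
  On the slit half strip this is \<open>(2/pi) Re Arcsin\<close> of the coordinate above, with boundary values \<open>0\<close> where
  the coordinate is imaginary and \<open>1\<close> where it lies in \<open>[1, \<infinity>)\<close>: it is the harmonic measure of the slit,
  in closed form.
\<close>

definition slit_potential :: "real \<Rightarrow> real \<Rightarrow> complex \<Rightarrow> real" where
  "slit_potential L B z =
     2 / pi * arcsin ((cmod (slit_coord L B z + 1) - cmod (slit_coord L B z - 1)) / 2)"

lemma Re_sinh_complex: "Re (sinh w) = sinh (Re w) * cos (Im w)"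
  and Im_sinh_complex: "Im (sinh w) = cosh (Re w) * sin (Im w)"
  by (simp_all add: sinh_conv_sin Im_sin Re_sin cosh_field_def sinh_field_def field_simps)

lemma sinh_complex_of_real: "sinh (complex_of_real x) = of_real (sinh x)"
  by (rule complex_eqI) (simp_all add: Re_sinh_complex Im_sinh_complex)

lemma sinh_le_cmod_sinh:
  assumes "Re w \<ge> 0" shows "sinh (Re w) \<le> cmod (sinh w)"
proof (rule power2_le_imp_le)
  have "(cmod (sinh w))\<^sup>2 = (sinh (Re w))\<^sup>2 * (cos (Im w))\<^sup>2 + (cosh (Re w))\<^sup>2 * (sin (Im w))\<^sup>2"
    by (simp add: cmod_power2 Re_sinh_complex Im_sinh_complex power_mult_distrib)
  also have "\<dots> = (sinh (Re w))\<^sup>2 * ((sin (Im w))\<^sup>2 + (cos (Im w))\<^sup>2) + (sin (Im w))\<^sup>2"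
    unfolding cosh_square_eq by (simp only: algebra_simps)
  finally have "(cmod (sinh w))\<^sup>2 = (sinh (Re w))\<^sup>2 + (sin (Im w))\<^sup>2" by simp
  then show "(sinh (Re w))\<^sup>2 \<le> (cmod (sinh w))\<^sup>2" by simp
qed simp

context
  fixes L B :: real
  assumes L: "L > 0" and B: "B > 0"
begin

lemma open_slit_half_strip: "open (slit_half_strip L B)"
proof -
  have 1: "open {z. Re z > 0 \<and> \<bar>Im z\<bar> < L}"
    by (intro open_Collect_conj open_Collect_less continuous_intros)
  have "compact (slit B)"
    unfolding slit_def by (intro compact_continuous_image continuous_intros) auto
  then show ?thesis unfolding slit_half_strip_def half_strip_def
    by (intro open_Diff 1 compact_imp_closed)
qed

lemma slit_half_strip_right: "slit_half_strip L B \<subseteq> {z. Re z > 0}"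
  by (auto simp: slit_half_strip_def half_strip_def)

lemma mem_slit: "z \<in> slit B \<longleftrightarrow> Im z = 0 \<and> 0 \<le> Re z \<and> Re z \<le> B"
  by (auto simp: slit_def image_iff complex_eq_iff intro!: bexI[of _ "Re z"])

lemma frontier_slit_half_strip:
  assumes "\<zeta> \<in> frontier (slit_half_strip L B)"
  shows "\<zeta> \<in> slit B \<or> \<zeta> \<notin> slit B \<and> 0 \<le> Re \<zeta> \<and> \<bar>Im \<zeta>\<bar> \<le> L \<and> (Re \<zeta> = 0 \<or> \<bar>Im \<zeta>\<bar> = L)"
proof -
  have "closure (slit_half_strip L B) \<subseteq> {z. 0 \<le> Re z \<and> \<bar>Im z\<bar> \<le> L}"
  proof (rule closure_minimal)
    show "closed {z. 0 \<le> Re z \<and> \<bar>Im z\<bar> \<le> L}"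
      by (intro closed_Collect_conj closed_Collect_le continuous_intros)
  qed (auto simp: slit_half_strip_def half_strip_def)
  then have "0 \<le> Re \<zeta>" "\<bar>Im \<zeta>\<bar> \<le> L" using assms by (auto simp: frontier_def)
  moreover have "\<zeta> \<notin> slit_half_strip L B"
    using assms open_slit_half_strip by (auto simp: frontier_def interior_open)
  ultimately show ?thesis by (auto simp: slit_half_strip_def half_strip_def)
qed

lemma scaled_Im_bounds:
  "\<bar>y\<bar> \<le> L \<Longrightarrow> \<bar>pi / (2 * L) * y\<bar> < pi" "\<bar>y\<bar> < L \<Longrightarrow> \<bar>pi / (2 * L) * y\<bar> < pi / 2"
proof -
  have eq: "\<bar>pi / (2 * L) * y\<bar> = pi / 2 * (\<bar>y\<bar> / L)" using L by (simp add: abs_mult)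
  show "\<bar>pi / (2 * L) * y\<bar> < pi / 2" if "\<bar>y\<bar> < L"
    unfolding eq using that L mult_strict_left_mono[of "\<bar>y\<bar> / L" 1 "pi / 2"] by simp
  show "\<bar>pi / (2 * L) * y\<bar> < pi" if "\<bar>y\<bar> \<le> L"
    unfolding eq using that L mult_left_mono[of "\<bar>y\<bar> / L" 1 "pi / 2"] pi_gt_zero
    by (simp del: pi_gt_zero)
qed

lemma sinh_strip_nz:
  assumes "0 \<le> Re z" "\<bar>Im z\<bar> \<le> L" "z \<noteq> 0"
  shows "sinh (of_real (pi / (2 * L)) * z) \<noteq> 0"
proof
  assume 0: "sinh (of_real (pi / (2 * L)) * z) = 0"
  have "sinh (pi / (2 * L) * Re z) \<le> 0"
    using sinh_le_cmod_sinh[of "of_real (pi / (2 * L)) * z"] 0 assms L by simp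
  then have Re: "Re z = 0"
    using assms(1) L pi_gt_zero by (auto simp: mult_le_0_iff divide_le_0_iff simp del: pi_gt_zero)
  have "Im (sinh (of_real (pi / (2 * L)) * z)) = 0" using 0 by simp
  then have s: "sin (pi / (2 * L) * Im z) = 0"
    using Re by (simp add: Im_sinh_complex)
  have "\<bar>pi / (2 * L) * Im z\<bar> < pi"
    using assms(2) by (rule scaled_Im_bounds)
  with s have "pi / (2 * L) * Im z = 0"
    using sin_eq_0_pi by (smt (verit))
  with Re L \<open>z \<noteq> 0\<close> show False by (simp add: complex_eq_iff)
qed

lemma Re_slit_coord_pos:
  assumes "0 < Re z" "\<bar>Im z\<bar> < L"
  shows "Re (slit_coord L B z) > 0"
proof -
  have "Re (sinh (of_real (pi / (2 * L)) * z)) > 0"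
  proof -
    have "\<bar>pi / (2 * L) * Im z\<bar> < pi / 2" using assms(2) by (rule scaled_Im_bounds)
    then have "cos (pi / (2 * L) * Im z) > 0" by (intro cos_gt_zero_pi) linarith+
    then show ?thesis using assms L by (simp add: Re_sinh_complex)
  qed
  moreover have "sinh (pi * B / (2 * L)) > 0" using L B by simp
  ultimately show ?thesis
    unfolding slit_coord_def
    by (simp add: Re_divide zero_less_divide_iff)
       (metis power2_eq_square add_pos_nonneg mult_pos_pos zero_le_power2)
qed

lemma slit_coord_of_real:
  "slit_coord L B (of_real x) = of_real (sinh (pi * B / (2 * L)) / sinh (pi * x / (2 * L)))"
proof -
  have "of_real (pi / (2 * L)) * (of_real x :: complex) = of_real (pi * x / (2 * L))" by simp
  then have "sinh (of_real (pi / (2 * L)) * of_real x) = complex_of_real (sinh (pi * x / (2 * L)))"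
    by (simp only: sinh_complex_of_real)
  then show ?thesis unfolding slit_coord_def by simp
qed

lemma slit_coord_avoids_cut:
  assumes "z \<in> slit_half_strip L B" "Im (slit_coord L B z) = 0"
  shows "\<bar>Re (slit_coord L B z)\<bar> < 1"
proof -
  have z: "0 < Re z" "\<bar>Im z\<bar> < L" "z \<notin> slit B"
    using assms(1) by (auto simp: slit_half_strip_def half_strip_def)
  define S where "S = sinh (of_real (pi / (2 * L)) * z)"
  have "S \<noteq> 0" unfolding S_def using z by (intro sinh_strip_nz) auto
  have "Im S = 0"
    using assms(2) \<open>S \<noteq> 0\<close> B L unfolding slit_coord_def S_def[symmetric]
    by (auto simp: Im_divide complex_eq_iff)
  then have s: "sin (pi / (2 * L) * Im z) = 0"
    by (simp add: S_def Im_sinh_complex)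
  have "\<bar>pi / (2 * L) * Im z\<bar> < pi"
    using z(2) by (intro scaled_Im_bounds) simp
  with s have "pi / (2 * L) * Im z = 0"
    using sin_eq_0_pi by (smt (verit))
  then have "Im z = 0" using L by simp
  then have zz: "z = of_real (Re z)" by (simp add: complex_eq_iff)
  have "Re z > B" using z \<open>Im z = 0\<close> by (auto simp: mem_slit)
  then have "sinh (pi * B / (2 * L)) < sinh (pi * Re z / (2 * L))"
    using L by (simp add: divide_strict_right_mono)
  moreover have "sinh (pi * B / (2 * L)) > 0" using L B by simp
  ultimately show ?thesis
    by (subst zz) (simp add: slit_coord_of_real)
qed

lemma slit_coord_holomorphic: "slit_coord L B holomorphic_on slit_half_strip L B"
proof -
  have "(\<lambda>z. sinh (of_real (pi / (2 * L)) * z)) holomorphic_on slit_half_strip L B"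
    unfolding sinh_field_def by (intro holomorphic_intros)  auto
  then show ?thesis
    unfolding slit_coord_def
    by (rule holomorphic_on_divide[OF holomorphic_on_const])
       (rule sinh_strip_nz, auto simp: slit_half_strip_def half_strip_def)
qed

lemma slit_potential_harmonic: "slit_potential L B harmonic_on slit_half_strip L B"
proof -
  have "(\<lambda>z. Arcsin (slit_coord L B z)) holomorphic_on slit_half_strip L B"
  proof (rule holomorphic_on_compose_gen[OF slit_coord_holomorphic, unfolded o_def])
    show "Arcsin holomorphic_on slit_coord L B ` slit_half_strip L B"
      by (rule holomorphic_on_Arcsin) (use slit_coord_avoids_cut in auto)
  qed simp
  then have "(\<lambda>z. Re (Arcsin (slit_coord L B z))) harmonic_on slit_half_strip L B"
    by (rule harmonic_on_Re[OF open_slit_half_strip])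
  then have "(\<lambda>z. 2 / pi * Re (Arcsin (slit_coord L B z)) + 0 * 0) harmonic_on slit_half_strip L B"
    using harmonic_on_lincomb harmonic_on_const by blast
  then show ?thesis
    by (rule harmonic_on_cong[OF _ open_slit_half_strip])
       (subst Re_Arcsin_eq, auto simp: slit_potential_def slit_half_strip_def half_strip_def
          intro!: Re_slit_coord_pos)
qed

lemma slit_potential_bounds: "\<bar>slit_potential L B z\<bar> \<le> 1"
proof -
  have "\<bar>arcsin ((cmod (slit_coord L B z + 1) - cmod (slit_coord L B z - 1)) / 2)\<bar> \<le> pi / 2"
    using arcsin_lbound[OF cmod_sum_diff_bounds, of "slit_coord L B z"]
      arcsin_ubound[OF cmod_sum_diff_bounds, of "slit_coord L B z"] by linarith
  then show ?thesis
    unfolding slit_potential_def by (simp add: abs_mult divide_le_eq)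
qed

lemma slit_potential_tendsto:
  assumes "(slit_coord L B \<longlongrightarrow> q) F"
  shows "(slit_potential L B \<longlongrightarrow> 2 / pi * arcsin ((cmod (q + 1) - cmod (q - 1)) / 2)) F"
proof -
  have "continuous_on UNIV (\<lambda>q. 2 / pi * arcsin ((cmod (q + 1) - cmod (q - 1)) / 2))"
    by (intro continuous_intros ballI conjI cmod_sum_diff_bounds) auto
  then have "isCont (\<lambda>q. 2 / pi * arcsin ((cmod (q + 1) - cmod (q - 1)) / 2)) q"
    by (simp add: continuous_on_eq_continuous_at)
  from isCont_tendsto_compose[OF this assms] show ?thesis
    unfolding slit_potential_def .
qed

lemma isCont_slit_coord:
  assumes "0 \<le> Re z" "\<bar>Im z\<bar> \<le> L" "z \<noteq> 0"
  shows "(slit_coord L B \<longlongrightarrow> slit_coord L B z) (at z within U)"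
proof -
  have "isCont (\<lambda>z. sinh (of_real (pi / (2 * L)) * z :: complex)) z"
    unfolding sinh_field_def by (intro continuous_intros) auto
  then have "((\<lambda>z. sinh (of_real (pi / (2 * L)) * z)) \<longlongrightarrow> sinh (of_real (pi / (2 * L)) * z)) (at z within U)"
    by (metis continuous_within continuous_at_imp_continuous_at_within)
  then show ?thesis
    unfolding slit_coord_def using sinh_strip_nz[OF assms] by (intro tendsto_intros) auto
qed

lemma slit_potential_boundary:
  assumes \<zeta>: "\<zeta> \<in> frontier (slit_half_strip L B)" "\<zeta> \<noteq> 0"
  shows "(slit_potential L B \<longlongrightarrow> indicator (slit B) \<zeta>) (at \<zeta> within U)"
proof -
  have strip: "0 \<le> Re \<zeta>" "\<bar>Im \<zeta>\<bar> \<le> L"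
    using frontier_slit_half_strip[OF \<zeta>(1)] L by (auto simp: mem_slit)
  have lim: "(slit_potential L B \<longlongrightarrow> slit_potential L B \<zeta>) (at \<zeta> within U)"
    using slit_potential_tendsto[OF isCont_slit_coord[OF strip \<zeta>(2)]]
    by (simp add: slit_potential_def)
  have "slit_potential L B \<zeta> = indicator (slit B) \<zeta>"
  proof (cases "\<zeta> \<in> slit B")
    case True
    then have x: "\<zeta> = of_real (Re \<zeta>)" "0 < Re \<zeta>" "Re \<zeta> \<le> B"
      using \<zeta>(2) by (auto simp: mem_slit complex_eq_iff)
    define r where "r = sinh (pi * B / (2 * L)) / sinh (pi * Re \<zeta> / (2 * L))"
    have "r \<ge> 1"
      unfolding r_def using x L by (simp add: divide_right_mono)
    moreover have "slit_coord L B \<zeta> = of_real r"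
      using slit_coord_of_real[of "Re \<zeta>"] x(1) by (simp add: r_def)
    ultimately have "cmod (slit_coord L B \<zeta> + 1) = r + 1" "cmod (slit_coord L B \<zeta> - 1) = r - 1"
      by (simp_all add: cmod_of_real_plus_minus_1)
    then show ?thesis using True by (simp add: slit_potential_def)
  next
    case False
    define S where "S = sinh (of_real (pi / (2 * L)) * \<zeta>)"
    have "Re S = 0"
    proof -
      consider "Re \<zeta> = 0" | "\<bar>Im \<zeta>\<bar> = L" using frontier_slit_half_strip[OF \<zeta>(1)] False by blast
      then show ?thesis
      proof cases
        case 2
        then have "pi / (2 * L) * Im \<zeta> = pi / 2 \<or> pi / (2 * L) * Im \<zeta> = - (pi / 2)"
          using L by (auto simp: abs_if split: if_splits)
        then have "cos (pi / (2 * L) * Im \<zeta>) = 0" by (metis cos_minus cos_pi_half)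
        then show ?thesis by (simp add: S_def Re_sinh_complex)
      qed (simp add: S_def Re_sinh_complex)
    qed
    then have "Re (slit_coord L B \<zeta>) = 0"
      unfolding slit_coord_def S_def[symmetric] by (simp add: Re_divide)
    then have "cmod (slit_coord L B \<zeta> + 1) = cmod (slit_coord L B \<zeta> - 1)"
      by (simp add: cmod_def)
    then show ?thesis using False by (simp add: slit_potential_def)
  qed
  with lim show ?thesis by simp
qed

lemma slit_potential_at_infinity:
  "(slit_potential L B \<longlongrightarrow> 0) (inf at_infinity (principal (slit_half_strip L B)))"
  (is "(_ \<longlongrightarrow> _) ?F")
proof -
  have ev: "eventually (\<lambda>z. z \<in> slit_half_strip L B) ?F"
    by (simp add: eventually_inf_principal)
  have "filterlim cmod at_top ?F"
    by (rule filterlim_mono[OF filterlim_norm_at_top order_refl]) simp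
  then have "filterlim (\<lambda>z. - L + cmod z) at_top ?F"
    by (rule filterlim_tendsto_add_at_top[OF tendsto_const])
  then have "filterlim Re at_top ?F"
  proof (rule filterlim_at_top_mono)
    show "eventually (\<lambda>z. - L + cmod z \<le> Re z) ?F"
      using ev
    proof eventually_elim
      case (elim z)
      then have "0 < Re z" "\<bar>Im z\<bar> < L" by (auto simp: slit_half_strip_def half_strip_def)
      then show ?case using cmod_le[of z] by linarith
    qed
  qed
  then have "filterlim (\<lambda>z. pi / (2 * L) * Re z) at_top ?F"
    using L by (intro filterlim_tendsto_pos_mult_at_top[OF tendsto_const]) auto
  then have "filterlim (\<lambda>z. sinh (pi / (2 * L) * Re z)) at_top ?F"
    by (rule filterlim_compose[OF sinh_real_at_top])
  then have "filterlim (\<lambda>z. cmod (sinh (of_real (pi / (2 * L)) * z))) at_top ?F"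
  proof (rule filterlim_at_top_mono)
    show "eventually (\<lambda>z. sinh (pi / (2 * L) * Re z) \<le> cmod (sinh (of_real (pi / (2 * L)) * z))) ?F"
      using ev
    proof eventually_elim
      case (elim z)
      then show ?case
        using sinh_le_cmod_sinh[of "of_real (pi / (2 * L)) * z"] L
        by (auto simp: slit_half_strip_def half_strip_def)
    qed
  qed
  then have "filterlim (\<lambda>z. sinh (of_real (pi / (2 * L)) * z)) at_infinity ?F"
    by (rule filterlim_norm_at_top_imp_at_infinity)
  then have "(slit_coord L B \<longlongrightarrow> 0) ?F"
    unfolding slit_coord_def by (rule tendsto_divide_0[OF tendsto_const])
  from slit_potential_tendsto[OF this] show ?thesis by simp
qed

text \<open>
  The exceptional point \<open>0\<close> is admissible: the points \<open>i t\<close> with small \<open>t > 0\<close> are boundary points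
  off the slit.
\<close>

lemma zero_in_discontinuities:
  "0 \<in> frontier (slit_half_strip L B)"
  "\<not> continuous (at 0 within frontier (slit_half_strip L B)) (indicator (slit B) :: complex \<Rightarrow> real)"
proof -
  have imag: "Complex 0 t \<in> frontier (slit_half_strip L B)" if "0 \<le> t" "t < L" for t
  proof -
    define x where "x n = Complex (1 / Suc n) (t + (L - t) / (2 * real (Suc n)))" for n :: nat
    have "x n \<in> slit_half_strip L B" for n
    proof -
      have lt: "(L - t) / (2 * real (Suc n)) < L - t"
        using that divide_strict_left_mono[of 1 "2 * real (Suc n)" "L - t"] by simp
      moreover have "0 < t + (L - t) / (2 * real (Suc n))"
        using that by (intro add_nonneg_pos) auto
      ultimately have "0 < Im (x n)" "Im (x n) < L" using lt by (simp_all only: x_def complex.sel)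
      moreover have "0 < Re (x n)" by (simp add: x_def)
      ultimately show ?thesis
        by (simp add: slit_half_strip_def half_strip_def mem_slit)
    qed
    moreover have "x \<longlonglongrightarrow> Complex 0 (t + 0)"
      unfolding x_def
    proof (intro tendsto_intros)
      show "(\<lambda>n. 1 / real (Suc n)) \<longlonglongrightarrow> 0"
        using LIMSEQ_inverse_real_of_nat by (simp add: inverse_eq_divide)
      from tendsto_mult[OF tendsto_const[of "(L - t) / 2"] this]
      show "(\<lambda>n. (L - t) / (2 * real (Suc n))) \<longlonglongrightarrow> 0" by simp
    qed
    ultimately have "Complex 0 t \<in> closure (slit_half_strip L B)"
      by (auto simp: closure_sequential intro!: exI[of _ x])
    moreover have "Complex 0 t \<notin> slit_half_strip L B"
      by (auto simp: slit_half_strip_def half_strip_def)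
    ultimately show ?thesis using open_slit_half_strip by (simp add: frontier_def interior_open)
  qed
  show "0 \<in> frontier (slit_half_strip L B)" using imag[of 0] L by (simp add: complex_eq_iff zero_complex.code)
  show "\<not> continuous (at 0 within frontier (slit_half_strip L B)) (indicator (slit B) :: complex \<Rightarrow> real)"
  proof
    assume c: "continuous (at 0 within frontier (slit_half_strip L B)) (indicator (slit B) :: complex \<Rightarrow> real)"
    obtain d where d: "d > 0" and *: "\<And>x. x \<in> frontier (slit_half_strip L B) \<Longrightarrow> dist x 0 < d \<Longrightarrow>
        dist (indicator (slit B) x :: real) (indicator (slit B) (0::complex)) < 1"
      using c[unfolded continuous_within_eps_delta, rule_format, of 1] by auto
    define t where "t = min d L / 2"
    have t: "0 < t" "t < d" "t < L" using d L by (auto simp: t_def)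
    have "dist (indicator (slit B) (Complex 0 t) :: real) (indicator (slit B) (0::complex)) < 1"
      using t by (intro * imag) (auto simp: cmod_def)
    then show False using t B by (simp add: indicator_def mem_slit)
  qed
qed

lemma slit_potential_is_harmonic_measure:
  "is_harmonic_measure (slit_half_strip L B) (slit B) (slit_potential L B)"
  unfolding is_harmonic_measure_def
proof (intro conjI exI[of _ "{0}"])
  show "bounded (slit_potential L B ` slit_half_strip L B)"
    unfolding bounded_iff using slit_potential_bounds by auto
qed (use slit_potential_harmonic zero_in_discontinuities slit_potential_boundary
      slit_potential_at_infinity in auto)

text \<open>
  No other boundary point is a discontinuity. In particular the data are continuous at the tip \<open>B\<close>, near which the boundary
  consists of slit points only.
\<close>

lemma discontinuities_subset:
  assumes "\<zeta> \<in> frontier (slit_half_strip L B)" "\<zeta> \<noteq> 0"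
  shows "continuous (at \<zeta> within frontier (slit_half_strip L B)) (indicator (slit B) :: complex \<Rightarrow> real)"
proof -
  define N where "N = (if \<zeta> \<in> slit B then {z. 0 < Re z \<and> \<bar>Im z\<bar> < L} else - slit B)"
  have "compact (slit B)"
    unfolding slit_def by (intro compact_continuous_image continuous_intros) auto
  then have "open (- slit B)" using compact_imp_closed by blast
  moreover have "open {z. 0 < Re z \<and> \<bar>Im z\<bar> < L}"
    by (intro open_Collect_conj open_Collect_less continuous_intros)
  ultimately have "open N" by (simp add: N_def)
  have "\<zeta> \<in> N" using assms L by (auto simp: N_def mem_slit complex_eq_iff)
  have eq: "indicator (slit B) z = (indicator (slit B) \<zeta> :: real)"
    if "z \<in> N" "z \<in> frontier (slit_half_strip L B)" for z
    using that frontier_slit_half_strip[OF that(2)] by (auto simp: N_def split: if_splits)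
  have "eventually (\<lambda>z. z \<in> N) (at \<zeta> within frontier (slit_half_strip L B))"
    using \<open>open N\<close> \<open>\<zeta> \<in> N\<close> by (simp add: eventually_at_topological) blast
  then have "eventually (\<lambda>z. (indicator (slit B) z :: real) = indicator (slit B) \<zeta>)
      (at \<zeta> within frontier (slit_half_strip L B))"
    by (simp add: eventually_at_filter) (elim eventually_mono, use eq in blast)
  then show ?thesis
    unfolding continuous_within by (rule tendsto_eventually)
qed

text \<open>Uniqueness, by exchanging \<open>h\<close> and \<open>k\<close>.\<close>

lemma harmonic_measure_le:
  assumes h: "is_harmonic_measure (slit_half_strip L B) (slit B) h"
    and k: "is_harmonic_measure (slit_half_strip L B) (slit B) k"
    and z: "z \<in> slit_half_strip L B"
  shows "h z \<le> k z"
proof -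
  let ?U = "slit_half_strip L B"
  have lim: "((\<lambda>z. h z - k z) \<longlongrightarrow> 0) (at \<zeta> within ?U)" if \<zeta>: "\<zeta> \<in> frontier ?U" "\<zeta> \<noteq> 0" for \<zeta>
  proof -
    have "(g \<longlongrightarrow> indicator (slit B) \<zeta>) (at \<zeta> within ?U)" if g: "is_harmonic_measure ?U (slit B) g" for g
      using g discontinuities_subset[OF \<zeta>] \<zeta>(1) unfolding is_harmonic_measure_def by blast
    from tendsto_diff[OF this[OF h] this[OF k]] show ?thesis by simp
  qed
  have liminf: "((\<lambda>z. h z - k z) \<longlongrightarrow> 0) (inf at_infinity (principal ?U))"
    using tendsto_diff[of h 0 _ k 0] h k unfolding is_harmonic_measure_def by simp
  have small: "eventually (\<lambda>z. cmod 1 * exp (- (1 * k z + (-1) * h z)) < c) F"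
    if "((\<lambda>z. h z - k z) \<longlongrightarrow> 0) F" "c > 1" for F and c :: real
  proof -
    have "((\<lambda>z. exp (h z - k z)) \<longlongrightarrow> exp 0) F" by (intro tendsto_intros that)
    from order_tendstoD(2)[OF this, of c] \<open>c > 1\<close> show ?thesis by simp
  qed
  obtain M1 M2 where M: "\<And>z. z \<in> ?U \<Longrightarrow> \<bar>h z\<bar> \<le> M1" "\<And>z. z \<in> ?U \<Longrightarrow> \<bar>k z\<bar> \<le> M2"
    using h k unfolding is_harmonic_measure_def bounded_iff by auto
  have "cmod 1 * exp (- (1 * k z + (-1) * h z)) \<le> 1"
  proof (rule maximum_principle_except_zero[OF open_slit_half_strip slit_half_strip_right
          holomorphic_on_const harmonic_on_lincomb, where M = "exp (M1 + M2)"])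
    show "cmod 1 * exp (- (1 * k z + (-1) * h z)) \<le> exp (M1 + M2)" if "z \<in> ?U" for z
      using M[OF that] by auto
  qed (use small lim liminf h k z in \<open>auto simp: is_harmonic_measure_def\<close>)
  then show ?thesis by simp
qed

lemma slit_measure_eq_potential:
  assumes zU: "z \<in> slit_half_strip L B"
  shows "slit_measure L z B = slit_potential L B z"
proof -
  have "is_harmonic_measure (slit_half_strip L B) (slit B)
      (SOME h. is_harmonic_measure (slit_half_strip L B) (slit B) h)"
    using slit_potential_is_harmonic_measure by (rule someI[of _ "slit_potential L B"])
  then show ?thesis
    unfolding slit_measure_def harmonic_measure_def
    using harmonic_measure_le[OF _ slit_potential_is_harmonic_measure zU]
      harmonic_measure_le[OF slit_potential_is_harmonic_measure _ zU] by (intro antisym)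
qed

lemma of_real_in_slit_half_strip: "b > B \<Longrightarrow> of_real b \<in> slit_half_strip L B"
  using B L by (simp add: slit_half_strip_def half_strip_def mem_slit)

lemma slit_measure_eq:
  assumes "b > B"
  shows "slit_measure L (of_real b) B = 2 / pi * arcsin (sinh (pi * B / (2 * L)) / sinh (pi * b / (2 * L)))"
proof -
  have "slit_measure L (of_real b) B = slit_potential L B (of_real b)"
    using assms by (intro slit_measure_eq_potential of_real_in_slit_half_strip)
  also have "\<dots> = 2 / pi * arcsin (sinh (pi * B / (2 * L)) / sinh (pi * b / (2 * L)))"
  proof -
    define r where "r = sinh (pi * B / (2 * L)) / sinh (pi * b / (2 * L))"
    have "0 < r" "r < 1" unfolding r_def using assms B L by (simp_all add: divide_strict_right_mono)
    then have "cmod (of_real r + 1) = r + 1" "cmod (of_real r - 1) = 1 - r"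
      by (simp_all add: cmod_of_real_plus_minus_1)
    then show ?thesis by (simp add: slit_potential_def slit_coord_of_real r_def[symmetric])
  qed
  finally show ?thesis .
qed

text \<open>
  The two constants theorem for the slit half strip, at points of the real axis to the right of the
  slit.
\<close>

lemma two_constants:
  assumes F: "F holomorphic_on UNIV"
    and M: "\<And>z. \<bar>Im z\<bar> \<le> L \<Longrightarrow> cmod (F z) \<le> M"
    and \<mu>: "\<mu> > 0" "\<mu> \<le> M" "\<And>z. z \<in> slit B \<Longrightarrow> cmod (F z) \<le> \<mu>"
    and "b > B"
  shows "cmod (F (of_real b)) \<le> \<mu> powr (slit_measure L (of_real b) B) * M powr (1 - slit_measure L (of_real b) B)"
proof -
  let ?U = "slit_half_strip L B"
  let ?h = "slit_potential L B"
  have "M > 0" using \<mu> by simp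
  have bU: "of_real b \<in> ?U" using \<open>b > B\<close> by (rule of_real_in_slit_half_strip)
  define H where "H z = ln M * 1 + (ln \<mu> - ln M) * ?h z" for z
  have FM: "cmod (F z) \<le> M" if "z \<in> ?U" for z
    using that by (intro M) (simp add: slit_half_strip_def half_strip_def)
  have FH: "cmod (F z) * exp (- H z) \<le> exp (?h z * (ln M - ln \<mu>))" if "z \<in> ?U" for z
  proof -
    have "cmod (F z) * exp (- H z) \<le> exp (ln M) * exp (- H z)"
      using FM[OF that] \<open>M > 0\<close> by (intro mult_right_mono) auto
    also have "\<dots> = exp (?h z * (ln M - ln \<mu>))"
      by (simp add: H_def algebra_simps flip: exp_add)
    finally show ?thesis .
  qed
  have lnle: "ln \<mu> \<le> ln M" using \<mu> by simp
  have small: "eventually (\<lambda>z. cmod (F z) * exp (- H z) < c) G"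
    if "(?h \<longlongrightarrow> 0) G" "eventually (\<lambda>z. z \<in> ?U) G" "c > 1" for G c
  proof -
    have "((\<lambda>z. exp (?h z * (ln M - ln \<mu>))) \<longlongrightarrow> exp (0 * (ln M - ln \<mu>))) G"
      by (intro tendsto_intros that)
    then have "eventually (\<lambda>z. exp (?h z * (ln M - ln \<mu>)) < c) G"
      using that(3) order_tendstoD(2) by fastforce
    with that(2) show ?thesis
      by eventually_elim (use FH in fastforce)
  qed
  have contF: "(F \<longlongrightarrow> F \<zeta>) (at \<zeta> within S)" for \<zeta> S
    using holomorphic_on_imp_continuous_on[OF F] 
    by (meson UNIV_I continuous_on_def subset_UNIV tendsto_within_subset)
  have "cmod (F (of_real b)) * exp (- H (of_real b)) \<le> 1"
  proof (rule maximum_principle_except_zero[OF open_slit_half_strip slit_half_strip_right _ _ _ _ _ bU,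
        where M = "exp (ln M - ln \<mu>)"])
    show "F holomorphic_on ?U" using F by (rule holomorphic_on_subset) simp
    show "H harmonic_on ?U" unfolding H_def
      by (intro harmonic_on_lincomb harmonic_on_const slit_potential_harmonic)
    show "cmod (F z) * exp (- H z) \<le> exp (ln M - ln \<mu>)" if "z \<in> ?U" for z
    proof -
      have "?h z * (ln M - ln \<mu>) \<le> 1 * (ln M - ln \<mu>)"
        using slit_potential_bounds[of z] lnle by (intro mult_right_mono) auto
      then show ?thesis using FH[OF that] by (smt (verit) exp_le_cancel_iff)
    qed
    show "eventually (\<lambda>z. cmod (F z) * exp (- H z) < c) (inf at_infinity (principal ?U))"
      if "c > 1" for c using small[OF slit_potential_at_infinity _ that]
      by (simp add: eventually_inf_principal)
    show "eventually (\<lambda>z. cmod (F z) * exp (- H z) < c) (at \<zeta> within ?U)"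
      if \<zeta>: "\<zeta> \<in> frontier ?U" "\<zeta> \<noteq> 0" and "c > 1" for \<zeta> c
    proof (cases "\<zeta> \<in> slit B")
      case True
      have "((\<lambda>z. cmod (F z) * exp (- H z)) \<longlongrightarrow> cmod (F \<zeta>) * exp (- (ln M * 1 + (ln \<mu> - ln M) * 1))) (at \<zeta> within ?U)"
        unfolding H_def using slit_potential_boundary[OF \<zeta>] True
        by (intro tendsto_intros contF) auto
      then show ?thesis
      proof (rule order_tendstoD(2))
        have "cmod (F \<zeta>) * exp (- (ln M * 1 + (ln \<mu> - ln M) * 1)) \<le> 1"
          using \<mu> True by (simp add: exp_minus field_simps)
        with \<open>c > 1\<close> show "cmod (F \<zeta>) * exp (- (ln M * 1 + (ln \<mu> - ln M) * 1)) < c" by linarith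
      qed
    next
      case False
      then show ?thesis
        using small[of "at \<zeta> within ?U", OF _ _ \<open>c > 1\<close>] slit_potential_boundary[OF \<zeta>, of ?U]
        by (simp add: eventually_at_filter)
    qed
  qed
  then have "cmod (F (of_real b)) \<le> exp (H (of_real b))"
    by (simp add: exp_minus field_simps)
  also have "?h (of_real b) = slit_measure L (of_real b) B"
    using slit_measure_eq_potential[OF bU] by simp
  then have "exp (H (of_real b)) = \<mu> powr (slit_measure L (of_real b) B) * M powr (1 - slit_measure L (of_real b) B)"
    using \<mu> \<open>M > 0\<close> by (simp add: H_def powr_def algebra_simps flip: exp_add)
  finally show ?thesis .
qed

end

lemma slit_measure_props:
  assumes "L > 0" "B > 0" "B < b"
  shows "0 < slit_measure L (of_real b) B" "slit_measure L (of_real b) B \<le> 1"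
    and "b \<le> b' \<Longrightarrow> slit_measure L (of_real b') B \<le> slit_measure L (of_real b) B"
proof -
  let ?r = "\<lambda>b. sinh (pi * B / (2 * L)) / sinh (pi * b / (2 * L))"
  have r: "0 < ?r b" "?r b \<le> 1" if "B < b" for b
    using that assms by (simp_all add: divide_right_mono)
  note eq = slit_measure_eq[OF assms(1,2)]
  have "0 < arcsin (?r b)" using r[OF assms(3)] arcsin_less_mono[of 0 "?r b"] by simp
  then show "0 < slit_measure L (of_real b) B" unfolding eq[OF assms(3)] by simp
  have "arcsin (?r b) \<le> pi / 2" using r[OF assms(3)] by (intro arcsin_ubound) auto
  then show "slit_measure L (of_real b) B \<le> 1" unfolding eq[OF assms(3)] by (simp add: field_simps)
  show "slit_measure L (of_real b') B \<le> slit_measure L (of_real b) B" if "b \<le> b'"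
  proof -
    have "B < b'" using that assms by simp
    have "?r b' \<le> ?r b"
      using that assms by (intro divide_left_mono) (auto simp: divide_right_mono)
    then have "arcsin (?r b') \<le> arcsin (?r b)"
      using r[OF assms(3)] r[OF \<open>B < b'\<close>] by (intro arcsin_le_arcsin) auto
    then show ?thesis unfolding eq[OF assms(3)] eq[OF \<open>B < b'\<close>] by (simp add: divide_right_mono)
  qed
qed

lemma slit_measure_tendsto_1:
  assumes "L > 0" "b > 0"
  shows "((\<lambda>B. slit_measure L (of_real b) B) \<longlongrightarrow> 1) (at_left b)"
proof -
  let ?r = "\<lambda>B. sinh (pi * B / (2 * L)) / sinh (pi * b / (2 * L))"
  have nz: "sinh (pi * b / (2 * L)) > 0" using assms by simp
  have ev: "eventually (\<lambda>B. B \<in> {0<..<b}) (at_left b)"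
    using eventually_at_left_real[OF assms(2)] .
  have "isCont ?r b"
    unfolding sinh_field_def using assms by (intro continuous_intros) (auto simp: sinh_field_def[symmetric])
  then have "(?r \<longlongrightarrow> ?r b) (at_left b)"
    by (simp add: isCont_def filterlim_at_split)
  moreover have "?r b = 1" using nz by (metis divide_self less_irrefl)
  ultimately have lim: "(?r \<longlongrightarrow> 1) (at_left b)" by (simp only:)
  have "((\<lambda>B. 2 / pi * arcsin (?r B)) \<longlongrightarrow> 2 / pi * arcsin 1) (at_left b)"
  proof (intro tendsto_intros continuous_on_tendsto_compose[OF continuous_on_arcsin' lim])
    show "eventually (\<lambda>B. ?r B \<in> {-1..1}) (at_left b)"
      using ev
    proof eventually_elim
      case (elim B)
      then have "0 < sinh (pi * B / (2 * L))" "sinh (pi * B / (2 * L)) \<le> sinh (pi * b / (2 * L))"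
        using assms by (simp_all add: divide_right_mono)
      then have "0 \<le> ?r B" "?r B \<le> 1" by simp_all
      then show ?case unfolding atLeastAtMost_iff by linarith
    qed
  qed simp
  then have "((\<lambda>B. 2 / pi * arcsin (?r B)) \<longlongrightarrow> 1) (at_left b)" by simp
  moreover have "eventually (\<lambda>B. slit_measure L (of_real b) B = 2 / pi * arcsin (?r B)) (at_left b)"
    using ev by eventually_elim (use assms slit_measure_eq in auto)
  ultimately show ?thesis by (simp add: tendsto_cong)
qed

section \<open>Fourier transform and Gaussian regularisation\<close>

lemma Cauchy_Schwarz_integral:
  fixes f g :: "'a \<Rightarrow> real"
  assumes [measurable]: "f \<in> borel_measurable M" "g \<in> borel_measurable M"
    and f: "integrable M (\<lambda>x. (f x)\<^sup>2)" and g: "integrable M (\<lambda>x. (g x)\<^sup>2)"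
  shows "integrable M (\<lambda>x. f x * g x)"
    and "(\<integral>x. \<bar>f x * g x\<bar> \<partial>M)\<^sup>2 \<le> (\<integral>x. (f x)\<^sup>2 \<partial>M) * (\<integral>x. (g x)\<^sup>2 \<partial>M)"
proof -
  show int: "integrable M (\<lambda>x. f x * g x)"
  proof (rule Bochner_Integration.integrable_bound[OF Bochner_Integration.integrable_add[OF f g]])
    have "\<bar>a * b\<bar> \<le> a\<^sup>2 + b\<^sup>2" for a b :: real
      using sum_squares_bound[of a b] sum_squares_bound[of a "-b"] by (auto simp: abs_le_iff)
    then show "AE x in M. norm (f x * g x) \<le> norm ((f x)\<^sup>2 + (g x)\<^sup>2)" by simp
  qed simp
  define A C D where "A = (\<integral>x. (f x)\<^sup>2 \<partial>M)" and "C = (\<integral>x. \<bar>f x * g x\<bar> \<partial>M)"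
    and "D = (\<integral>x. (g x)\<^sup>2 \<partial>M)"
  have q: "0 \<le> t\<^sup>2 * A - 2 * t * C + D" for t
  proof -
    have "0 \<le> (\<integral>x. t\<^sup>2 * (f x)\<^sup>2 - 2 * t * \<bar>f x * g x\<bar> + (g x)\<^sup>2 \<partial>M)"
    proof (rule Bochner_Integration.integral_nonneg)
      fix x
      have "t\<^sup>2 * (f x)\<^sup>2 - 2 * t * \<bar>f x * g x\<bar> + (g x)\<^sup>2 = (t * \<bar>f x\<bar> - \<bar>g x\<bar>)\<^sup>2"
        by (simp add: power2_diff power_mult_distrib abs_mult)
      then show "0 \<le> t\<^sup>2 * (f x)\<^sup>2 - 2 * t * \<bar>f x * g x\<bar> + (g x)\<^sup>2" by simp
    qed
    also have "\<dots> = t\<^sup>2 * A - 2 * t * C + D"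
      using f g int by (simp add: A_def C_def D_def)
    finally show ?thesis .
  qed
  have "A \<ge> 0" by (simp add: A_def)
  show "C\<^sup>2 \<le> A * D"
  proof (cases "A = 0")
    case True
    then have "AE x in M. (f x)\<^sup>2 = 0"
      using f integral_nonneg_eq_0_iff_AE[OF f] by (simp add: A_def)
    then have "AE x in M. \<bar>f x * g x\<bar> = 0" by (rule eventually_mono) simp
    then have "C = (\<integral>x. 0 \<partial>M)" unfolding C_def by (intro integral_cong_AE) auto
    with True show ?thesis by simp
  next
    case False
    with \<open>A \<ge> 0\<close> have "A > 0" by simp
    with q[of "C / A"] show ?thesis
      by (simp add: power2_eq_square field_simps)
  qed
qed

lemma integrable_prod_mult:
  fixes f :: "'a \<Rightarrow> real" and g :: "'b \<Rightarrow> real"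
  assumes "pair_sigma_finite M1 M2" and f: "integrable M1 f" and g: "integrable M2 g"
  shows "integrable (M1 \<Otimes>\<^sub>M M2) (\<lambda>(x, y). f x * g y)"
proof -
  interpret pair_sigma_finite M1 M2 by fact
  have [measurable]: "f \<in> borel_measurable M1" "g \<in> borel_measurable M2"
    using f g by auto
  show ?thesis
    by (rule Fubini_integrable) (use f g in \<open>auto simp: abs_mult\<close>)
qed

text \<open>
  The Fourier transform of an integrable function on the line. It is applied to functions that vanish
  outside \<open>(-1, 1)\<close>, for which it agrees with the transform over \<open>(-1, 1)\<close>.
\<close>

definition ft :: "(real \<Rightarrow> real) \<Rightarrow> real \<Rightarrow> complex" where
  "ft g \<xi> = complex_of_real (1 / sqrt (2 * pi)) *
     (LINT x|lborel. complex_of_real (g x) * exp (- \<i> * complex_of_real (x * \<xi>)))"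

lemma cmod_exp_imaginary [simp]: "cmod (exp (- (\<i> * complex_of_real x))) = 1"
  using norm_exp_i_times[of "-x"] by simp

lemma integrable_ft_kernel:
  assumes "integrable lborel (g :: real \<Rightarrow> real)"
  shows "integrable lborel (\<lambda>x. complex_of_real (g x) * exp (- \<i> * complex_of_real (x * \<xi>)))"
proof (rule Bochner_Integration.integrable_bound[OF assms])
  have [measurable]: "g \<in> borel_measurable borel" using assms by auto
  show "(\<lambda>x. complex_of_real (g x) * exp (- \<i> * complex_of_real (x * \<xi>))) \<in> borel_measurable lborel"
    by measurable
qed (simp add: norm_mult)

lemma ft_measurable [measurable]:
  assumes [measurable]: "g \<in> borel_measurable borel"
  shows "ft g \<in> borel_measurable borel"
  unfolding ft_def by measurable

lemma cmod_ft_le: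
  assumes "integrable lborel (g :: real \<Rightarrow> real)"
  shows "cmod (ft g \<xi>) \<le> 1 / sqrt (2 * pi) * (LINT x|lborel. \<bar>g x\<bar>)"
proof -
  have "cmod (LINT x|lborel. complex_of_real (g x) * exp (- \<i> * complex_of_real (x * \<xi>)))
      \<le> (LINT x|lborel. cmod (complex_of_real (g x) * exp (- \<i> * complex_of_real (x * \<xi>))))"
    by (rule integral_norm_bound)
  also have "\<dots> = (LINT x|lborel. \<bar>g x\<bar>)" by (simp add: norm_mult)
  finally show ?thesis
    by (simp add: ft_def norm_mult norm_divide divide_right_mono)
qed

lemma gaussian_integrable:
  assumes "\<sigma> > 0" shows "integrable lborel (\<lambda>\<xi>::real. exp (- (\<sigma> * \<xi>)\<^sup>2 / 2))"
proof -
  have "(\<lambda>\<xi>. sqrt (2 * pi * (1 / \<sigma>)\<^sup>2) * normal_density 0 (1 / \<sigma>) \<xi>) = (\<lambda>\<xi>. exp (- (\<sigma> * \<xi>)\<^sup>2 / 2))"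
    using assms by (auto simp: normal_density_def power_divide power_mult_distrib mult.commute)
  then show ?thesis
    using integrable_normal_density[of "1 / \<sigma>" 0] assms by (metis integrable_mult_right divide_pos_pos zero_less_one)
qed

lemma gaussian_transform:
  assumes "\<sigma> > 0"
  shows "(CLINT \<xi>|lborel. exp (- \<i> * complex_of_real (t * \<xi>)) * complex_of_real (exp (- (\<sigma> * \<xi>)\<^sup>2 / 2)))
    = complex_of_real (2 * pi * normal_density 0 \<sigma> t)"
proof -
  have "complex_of_real (exp (- (t / \<sigma>)\<^sup>2 / 2)) = char std_normal_distribution (- t / \<sigma>)"
    by (simp add: char_std_normal_distribution)
  also have "\<dots> = (CLINT x|lborel. std_normal_density x *\<^sub>R iexp (- t / \<sigma> * x))"
    unfolding char_def by (subst integral_density) auto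
  also have "\<dots> = \<sigma> *\<^sub>R (CLINT \<xi>|lborel. std_normal_density (0 + \<sigma> * \<xi>) *\<^sub>R iexp (- t / \<sigma> * (0 + \<sigma> * \<xi>)))"
    using assms by (subst lborel_integral_real_affine[of \<sigma> _ 0]) auto
  also have "(\<lambda>\<xi>. std_normal_density (0 + \<sigma> * \<xi>) *\<^sub>R iexp (- t / \<sigma> * (0 + \<sigma> * \<xi>))) =
      (\<lambda>\<xi>. complex_of_real (1 / sqrt (2 * pi)) *
         (exp (- \<i> * complex_of_real (t * \<xi>)) * complex_of_real (exp (- (\<sigma> * \<xi>)\<^sup>2 / 2))))"
    using assms by (auto simp: std_normal_density_def scaleR_conv_of_real mult_ac)
  finally have "complex_of_real (exp (- (t / \<sigma>)\<^sup>2 / 2)) = complex_of_real (\<sigma> / sqrt (2 * pi)) *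
      (CLINT \<xi>|lborel. exp (- \<i> * complex_of_real (t * \<xi>)) * complex_of_real (exp (- (\<sigma> * \<xi>)\<^sup>2 / 2)))"
    by (simp add: scaleR_conv_of_real)
  moreover have "complex_of_real (2 * pi * normal_density 0 \<sigma> t) =
      complex_of_real (sqrt (2 * pi) / \<sigma>) * complex_of_real (exp (- (t / \<sigma>)\<^sup>2 / 2))"
  proof -
    have "2 * pi * normal_density 0 \<sigma> t = sqrt (2 * pi) / \<sigma> * exp (- (t / \<sigma>)\<^sup>2 / 2)"
      using assms real_sqrt_mult_self[of "2 * pi"]
      by (simp add: normal_density_def real_sqrt_mult power_divide divide_simps mult_ac del: real_sqrt_mult_self)
    then show ?thesis by (metis of_real_mult)
  qed
  moreover have "complex_of_real (sqrt (2 * pi) / \<sigma>) * complex_of_real (\<sigma> / sqrt (2 * pi)) = 1"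
    using assms by (simp flip: of_real_mult)
  ultimately show ?thesis by (simp only: mult.assoc[symmetric]) simp
qed

lemma integrable_gaussian_form:
  assumes G: "integrable lborel (G :: real \<Rightarrow> real)"
  shows "integrable (lborel \<Otimes>\<^sub>M lborel) (\<lambda>(x, y). G x * G y * normal_density 0 \<sigma> (x - y))"
proof -
  have [measurable]: "G \<in> borel_measurable borel" using G by auto
  have "integrable (lborel \<Otimes>\<^sub>M lborel) (\<lambda>(x, y). G x * G y)"
    by (rule integrable_prod_mult[OF _ G G]) (simp add: pair_sigma_finite_def sigma_finite_lborel)
  then have "integrable (lborel \<Otimes>\<^sub>M lborel) (\<lambda>z. (1 / sqrt (2 * pi * \<sigma>\<^sup>2)) * (case z of (x, y) \<Rightarrow> G x * G y))"
    by (rule integrable_mult_right)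
  then show ?thesis
  proof (rule Bochner_Integration.integrable_bound)
    show "AE z in lborel \<Otimes>\<^sub>M lborel. norm (case z of (x, y) \<Rightarrow> G x * G y * normal_density 0 \<sigma> (x - y))
        \<le> norm ((1 / sqrt (2 * pi * \<sigma>\<^sup>2)) * (case z of (x, y) \<Rightarrow> G x * G y))"
    proof (intro AE_I2, safe)
      fix x y :: real
      have "normal_density 0 \<sigma> (x - y) \<le> 1 / sqrt (2 * pi * \<sigma>\<^sup>2) * 1"
        unfolding normal_density_def by (intro mult_left_mono) auto
      then have "\<bar>G x * G y\<bar> * normal_density 0 \<sigma> (x - y) \<le> \<bar>G x * G y\<bar> * (1 / sqrt (2 * pi * \<sigma>\<^sup>2))"
        by (intro mult_left_mono) auto
      then show "norm (G x * G y * normal_density 0 \<sigma> (x - y))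
          \<le> norm ((1 / sqrt (2 * pi * \<sigma>\<^sup>2)) * (G x * G y))"
        by (simp add: abs_mult mult_ac)
    qed
  qed measurable
qed

text \<open>
  The identity behind Plancherel's theorem: with a Gaussian factor the energy integral in frequency is
  the quadratic form of a Gaussian kernel of width \<open>\<sigma>\<close>. The kernel is an approximate identity as
  \<open>\<sigma> \<rightarrow> 0\<close>, which yields both an upper bound and, for bounded continuous functions, the limit.
\<close>

lemma ft_gaussian:
  assumes G: "integrable lborel (G :: real \<Rightarrow> real)" and "\<sigma> > 0"
  shows "integrable lborel (\<lambda>\<xi>. (cmod (ft G \<xi>))\<^sup>2 * exp (- (\<sigma> * \<xi>)\<^sup>2 / 2))"
    and "(LINT \<xi>|lborel. (cmod (ft G \<xi>))\<^sup>2 * exp (- (\<sigma> * \<xi>)\<^sup>2 / 2)) =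
      (LINT z|(lborel \<Otimes>\<^sub>M lborel). (case z of (x, y) \<Rightarrow> G x * G y * normal_density 0 \<sigma> (x - y)))"
proof -
  have [measurable]: "G \<in> borel_measurable borel" using G by auto
  have L: "pair_sigma_finite (lborel :: real measure) (lborel :: real measure)"
    by (simp add: pair_sigma_finite_def sigma_finite_lborel)
  interpret P: pair_sigma_finite "lborel :: real measure" "lborel \<Otimes>\<^sub>M (lborel :: real measure)"
    unfolding lborel_prod by (simp add: pair_sigma_finite_def sigma_finite_lborel)
  let ?E = "\<lambda>\<xi>::real. exp (- (\<sigma> * \<xi>)\<^sup>2 / 2)"
  show "integrable lborel (\<lambda>\<xi>. (cmod (ft G \<xi>))\<^sup>2 * ?E \<xi>)"
  proof (rule Bochner_Integration.integrable_bound)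
    let ?C = "(1 / sqrt (2 * pi) * (LINT x|lborel. \<bar>G x\<bar>))\<^sup>2"
    show "integrable lborel (\<lambda>\<xi>. ?C * ?E \<xi>)"
      using gaussian_integrable[OF \<open>\<sigma> > 0\<close>] by (rule integrable_mult_right)
    have "(cmod (ft G \<xi>))\<^sup>2 * ?E \<xi> \<le> ?C * ?E \<xi>" for \<xi>
      using cmod_ft_le[OF G] by (intro mult_right_mono power_mono) auto
    then show "AE \<xi> in lborel. norm ((cmod (ft G \<xi>))\<^sup>2 * ?E \<xi>) \<le> norm (?C * ?E \<xi>)"
      by (intro AE_I2) (simp add: abs_mult)
  qed measurable
  have GG: "integrable (lborel \<Otimes>\<^sub>M lborel) (\<lambda>(x, y). G x * G y)"
    by (rule integrable_prod_mult[OF L G G])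
  define H where "H \<xi> z = complex_of_real (G (fst z) * G (snd z)) *
      (exp (- \<i> * complex_of_real ((fst z - snd z) * \<xi>)) * complex_of_real (?E \<xi>))"
    for \<xi> :: real and z :: "real \<times> real"
  have Hint: "integrable (lborel \<Otimes>\<^sub>M (lborel \<Otimes>\<^sub>M lborel)) (\<lambda>(\<xi>, z). H \<xi> z)"
  proof (rule Bochner_Integration.integrable_bound)
    show "integrable (lborel \<Otimes>\<^sub>M (lborel \<Otimes>\<^sub>M lborel)) (\<lambda>(\<xi>, z). ?E \<xi> * (case z of (x, y) \<Rightarrow> G x * G y))"
      by (rule integrable_prod_mult[OF P.pair_sigma_finite_axioms gaussian_integrable[OF \<open>\<sigma> > 0\<close>] GG])
    show "(\<lambda>(\<xi>, z). H \<xi> z) \<in> borel_measurable (lborel \<Otimes>\<^sub>M (lborel \<Otimes>\<^sub>M lborel))"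
      unfolding H_def by measurable
    show "AE w in lborel \<Otimes>\<^sub>M (lborel \<Otimes>\<^sub>M lborel). norm (case w of (\<xi>, z) \<Rightarrow> H \<xi> z)
        \<le> norm (case w of (\<xi>, z) \<Rightarrow> ?E \<xi> * (case z of (x, y) \<Rightarrow> G x * G y))"
      by (intro AE_I2) (auto simp: H_def norm_mult abs_mult split: prod.split)
  qed
  have inner1: "(LINT z|(lborel \<Otimes>\<^sub>M lborel). H \<xi> z) =
      complex_of_real (2 * pi) * complex_of_real ((cmod (ft G \<xi>))\<^sup>2 * ?E \<xi>)" for \<xi>
  proof -
    let ?g = "\<lambda>x. complex_of_real (G x) * exp (- \<i> * complex_of_real (x * \<xi>))"
    let ?h = "\<lambda>y. complex_of_real (G y) * exp (\<i> * complex_of_real (y * \<xi>))"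
    have "integrable (lborel \<Otimes>\<^sub>M lborel) (\<lambda>z. ?g (fst z) * ?h (snd z))"
      by (rule Bochner_Integration.integrable_bound[OF GG])
         (auto simp: norm_mult abs_mult split: prod.split)
    from lborel_pair.integral_fst'[OF this]
    have prod: "(LINT z|(lborel \<Otimes>\<^sub>M lborel). ?g (fst z) * ?h (snd z)) = (LINT x|lborel. ?g x) * (LINT x|lborel. ?h x)"
      by simp
    have h: "(LINT x|lborel. ?h x) = cnj (LINT x|lborel. ?g x)"
      by (subst Bochner_Integration.integral_cnj[symmetric]) (simp add: exp_cnj)
    have "(LINT z|(lborel \<Otimes>\<^sub>M lborel). H \<xi> z) =
        (LINT z|(lborel \<Otimes>\<^sub>M lborel). ?g (fst z) * ?h (snd z) * complex_of_real (?E \<xi>))"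
      by (rule Bochner_Integration.integral_cong)
         (auto simp: H_def exp_add[symmetric] algebra_simps)
    also have "\<dots> = (LINT x|lborel. ?g x) * cnj (LINT x|lborel. ?g x) * complex_of_real (?E \<xi>)"
      using prod h by simp
    also have "(LINT x|lborel. ?g x) = complex_of_real (sqrt (2 * pi)) * ft G \<xi>"
      by (simp add: ft_def flip: of_real_mult)
    also have "complex_of_real (sqrt (2 * pi)) * ft G \<xi> * cnj (complex_of_real (sqrt (2 * pi)) * ft G \<xi>)
        = complex_of_real (2 * pi * (cmod (ft G \<xi>))\<^sup>2)"
      by (subst complex_norm_square[symmetric]) (simp add: norm_mult power_mult_distrib)
    finally show ?thesis by simp
  qed
  have inner2: "(LINT \<xi>|lborel. H \<xi> z) =
      complex_of_real (2 * pi) * complex_of_real (G (fst z) * G (snd z) * normal_density 0 \<sigma> (fst z - snd z))" for z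
    unfolding H_def integral_mult_right_zero gaussian_transform[OF \<open>\<sigma> > 0\<close>] by (simp add: mult_ac)
  have "(LINT \<xi>|lborel. (LINT z|(lborel \<Otimes>\<^sub>M lborel). H \<xi> z)) = (LINT z|(lborel \<Otimes>\<^sub>M lborel). (LINT \<xi>|lborel. H \<xi> z))"
    using P.Fubini_integral[OF Hint] by simp
  then have "complex_of_real (2 * pi) * complex_of_real (LINT \<xi>|lborel. (cmod (ft G \<xi>))\<^sup>2 * ?E \<xi>) =
     complex_of_real (2 * pi) * complex_of_real (LINT z|(lborel \<Otimes>\<^sub>M lborel). G (fst z) * G (snd z) * normal_density 0 \<sigma> (fst z - snd z))"
    unfolding inner1 inner2 integral_mult_right_zero integral_complex_of_real .
  then show "(LINT \<xi>|lborel. (cmod (ft G \<xi>))\<^sup>2 * ?E \<xi>) =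
      (LINT z|(lborel \<Otimes>\<^sub>M lborel). (case z of (x, y) \<Rightarrow> G x * G y * normal_density 0 \<sigma> (x - y)))"
    by (simp add: case_prod_beta del: of_real_mult)
qed

lemma gaussian_form_le:
  assumes G: "integrable lborel (G :: real \<Rightarrow> real)" and G2: "integrable lborel (\<lambda>x. (G x)\<^sup>2)" and "\<sigma> > 0"
  shows "(LINT z|(lborel \<Otimes>\<^sub>M lborel). (case z of (x, y) \<Rightarrow> G x * G y * normal_density 0 \<sigma> (x - y)))
    \<le> (LINT x|lborel. (G x)\<^sup>2)"
proof -
  have [measurable]: "G \<in> borel_measurable borel" using G by auto
  let ?K = "normal_density 0 \<sigma>"
  let ?N = "LINT x|lborel. (G x)\<^sup>2"
  have K1: "(\<integral>\<^sup>+y. ennreal (?K (x - y)) \<partial>lborel) = 1" for x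
  proof -
    have "?K (x - y) = normal_density x \<sigma> y" for y
      by (simp add: normal_density_def power2_commute)
    then show ?thesis
      using \<open>\<sigma> > 0\<close> by (simp add: nn_integral_eq_integral)
  qed
  have K2: "(\<integral>\<^sup>+x. ennreal (?K (x - y)) \<partial>lborel) = 1" for y
  proof -
    have "?K (x - y) = normal_density y \<sigma> x" for x by (simp add: normal_density_def)
    then show ?thesis
      using \<open>\<sigma> > 0\<close> by (simp add: nn_integral_eq_integral)
  qed
  have N: "(\<integral>\<^sup>+x. ennreal ((G x)\<^sup>2) \<partial>lborel) = ennreal ?N"
    using G2 by (simp add: nn_integral_eq_integral)
  have split: "ennreal (c * (a * k) + c * (b * k)) = ennreal c * (ennreal a * ennreal k) + ennreal c * (ennreal b * ennreal k)"
    if "a \<ge> 0" "b \<ge> 0" "c \<ge> 0" "k \<ge> 0" for a b c k :: real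
    using that by (simp add: ennreal_mult)
  let ?I = "LINT z|(lborel \<Otimes>\<^sub>M lborel). (case z of (x, y) \<Rightarrow> G x * G y * ?K (x - y))"
  have "ennreal (norm ?I) \<le> (\<integral>\<^sup>+z. norm (case z of (x, y) \<Rightarrow> G x * G y * ?K (x - y)) \<partial>(lborel \<Otimes>\<^sub>M lborel))"
    by (rule integral_norm_bound_ennreal[OF integrable_gaussian_form[OF G]])
  also have "\<dots> \<le> (\<integral>\<^sup>+z. ennreal (1/2) * (ennreal ((G (fst z))\<^sup>2) * ennreal (?K (fst z - snd z)))
        + ennreal (1/2) * (ennreal ((G (snd z))\<^sup>2) * ennreal (?K (fst z - snd z))) \<partial>(lborel \<Otimes>\<^sub>M lborel))"
  proof (rule nn_integral_mono, safe)
    fix x y :: real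
    have "\<bar>G x * G y\<bar> \<le> 1/2 * ((G x)\<^sup>2 + (G y)\<^sup>2)"
      using sum_squares_bound[of "G x" "G y"] sum_squares_bound[of "G x" "- G y"] by (auto simp: abs_le_iff)
    then have "\<bar>G x * G y\<bar> * ?K (x - y) \<le> 1/2 * ((G x)\<^sup>2 + (G y)\<^sup>2) * ?K (x - y)"
      by (intro mult_right_mono) auto
    then have "ennreal (norm (G x * G y * ?K (x - y))) \<le>
        ennreal (1/2 * ((G x)\<^sup>2 * ?K (x - y)) + 1/2 * ((G y)\<^sup>2 * ?K (x - y)))"
      by (intro ennreal_leI) (simp add: abs_mult algebra_simps)
    also have "\<dots> = ennreal (1/2) * (ennreal ((G x)\<^sup>2) * ennreal (?K (x - y)))
        + ennreal (1/2) * (ennreal ((G y)\<^sup>2) * ennreal (?K (x - y)))"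
      by (rule split) auto
    finally show "ennreal (norm (G x * G y * ?K (x - y))) \<le>
        ennreal (1/2) * (ennreal ((G (fst (x, y)))\<^sup>2) * ennreal (?K (fst (x, y) - snd (x, y))))
        + ennreal (1/2) * (ennreal ((G (snd (x, y)))\<^sup>2) * ennreal (?K (fst (x, y) - snd (x, y))))"
      by (simp only: fst_conv snd_conv)
  qed
  also have "\<dots> = ennreal (1/2) * (\<integral>\<^sup>+z. ennreal ((G (fst z))\<^sup>2) * ennreal (?K (fst z - snd z)) \<partial>(lborel \<Otimes>\<^sub>M lborel))
      + ennreal (1/2) * (\<integral>\<^sup>+z. ennreal ((G (snd z))\<^sup>2) * ennreal (?K (fst z - snd z)) \<partial>(lborel \<Otimes>\<^sub>M lborel))"
    by (simp add: nn_integral_add nn_integral_cmult)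
  also have "(\<integral>\<^sup>+z. ennreal ((G (fst z))\<^sup>2) * ennreal (?K (fst z - snd z)) \<partial>(lborel \<Otimes>\<^sub>M lborel)) = ennreal ?N"
    by (subst lborel.nn_integral_fst[symmetric]) (simp_all add: nn_integral_cmult K1 N)
  also have "(\<integral>\<^sup>+z. ennreal ((G (snd z))\<^sup>2) * ennreal (?K (fst z - snd z)) \<partial>(lborel \<Otimes>\<^sub>M lborel)) = ennreal ?N"
    by (subst lborel_pair.nn_integral_snd[symmetric]) (simp_all add: nn_integral_cmult K2 N)
  also have "ennreal (1/2) * ennreal ?N + ennreal (1/2) * ennreal ?N = ennreal ?N"
    by (subst distrib_right[symmetric], subst ennreal_plus[symmetric]) auto
  finally have "norm ?I \<le> ?N" by (simp add: ennreal_le_iff)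
  then show ?thesis by simp
qed

lemma gaussian_form_tendsto:
  fixes U :: "real \<Rightarrow> real"
  assumes U: "integrable lborel U" and cont: "continuous_on UNIV U" and M: "\<And>x. \<bar>U x\<bar> \<le> M"
  shows "(\<lambda>n. LINT z|(lborel \<Otimes>\<^sub>M lborel). (case z of (x, y) \<Rightarrow> U x * U y * normal_density 0 (1 / Suc n) (x - y)))
    \<longlonglongrightarrow> (LINT x|lborel. (U x)\<^sup>2)"
proof -
  have [measurable]: "U \<in> borel_measurable borel" using U by auto
  have "M \<ge> 0" using M[of 0] by linarith
  define inner where "inner n x = (LINT z|lborel. U (x - z / Suc n) * std_normal_density z)" for n :: nat and x
  have [measurable]: "inner n \<in> borel_measurable borel" for n unfolding inner_def by measurable
  have eq: "(LINT z|(lborel \<Otimes>\<^sub>M lborel). (case z of (x, y) \<Rightarrow> U x * U y * normal_density 0 (1 / Suc n) (x - y)))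
      = (LINT x|lborel. U x * inner n x)" for n
  proof -
    let ?\<sigma> = "1 / real (Suc n)"
    have "(LINT y|lborel. U x * U y * normal_density 0 ?\<sigma> (x - y)) = U x * inner n x" for x
    proof -
      \<comment> \<open>substituting \<open>y = x - \<sigma> z\<close>\<close>
      have "(LINT y|lborel. U y * normal_density 0 ?\<sigma> (x - y)) =
          \<bar>- ?\<sigma>\<bar> *\<^sub>R (LINT z|lborel. U (x + (- ?\<sigma>) * z) * normal_density 0 ?\<sigma> (x - (x + (- ?\<sigma>) * z)))"
        by (rule lborel_integral_real_affine) simp
      also have "\<dots> = (LINT z|lborel. \<bar>- ?\<sigma>\<bar> * (U (x + (- ?\<sigma>) * z) * normal_density 0 ?\<sigma> (x - (x + (- ?\<sigma>) * z))))"
        by simp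
      also have "\<dots> = inner n x"
        unfolding inner_def
      proof (rule Bochner_Integration.integral_cong[OF refl])
        fix z :: real
        have "normal_density 0 ?\<sigma> (?\<sigma> * z) * ?\<sigma> = std_normal_density z"
          by (simp add: normal_density_def real_sqrt_mult real_sqrt_divide power_divide del: of_nat_Suc)
        then show "\<bar>- ?\<sigma>\<bar> * (U (x + (- ?\<sigma>) * z) * normal_density 0 ?\<sigma> (x - (x + (- ?\<sigma>) * z)))
            = U (x - z / Suc n) * std_normal_density z"
          by (simp add: mult_ac del: of_nat_Suc) (metis times_divide_eq_right mult.commute)
      qed
      finally show ?thesis by (simp add: mult.assoc)
    qed
    then show ?thesis
      by (subst lborel_pair.integral_fst'[OF integrable_gaussian_form[OF U], symmetric]) simp
  qed
  have bnd: "\<bar>U (x - z / Suc n) * std_normal_density z\<bar> \<le> M * std_normal_density z" for x z n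
    by (simp add: abs_mult M mult_right_mono del: of_nat_Suc)
  have intM: "integrable lborel (\<lambda>z. M * std_normal_density z)" by simp
  have inner_le: "\<bar>inner n x\<bar> \<le> M" for n x
  proof -
    have "\<bar>inner n x\<bar> \<le> (LINT z|lborel. \<bar>U (x - z / Suc n) * std_normal_density z\<bar>)"
      unfolding inner_def by (rule integral_abs_bound)
    also have "\<dots> \<le> (LINT z|lborel. M * std_normal_density z)"
      by (rule integral_mono[OF Bochner_Integration.integrable_bound[OF intM] intM])
         (use bnd \<open>M \<ge> 0\<close> in \<open>auto simp del: of_nat_Suc\<close>)
    finally show ?thesis by simp
  qed
  have inner_lim: "(\<lambda>n. inner n x) \<longlonglongrightarrow> U x" for x
  proof -
    have "(\<lambda>n. inner n x) \<longlonglongrightarrow> (LINT z|lborel. U x * std_normal_density z)"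
      unfolding inner_def
    proof (rule integral_dominated_convergence[OF _ _ intM])
      show "AE z in lborel. (\<lambda>n. U (x - z / Suc n) * std_normal_density z) \<longlonglongrightarrow> U x * std_normal_density z"
      proof (intro AE_I2 tendsto_mult_right)
        fix z
        have "(\<lambda>n. x - z * inverse (real (Suc n))) \<longlonglongrightarrow> x - z * 0"
          by (intro tendsto_intros LIMSEQ_inverse_real_of_nat)
        then have "(\<lambda>n. x - z / Suc n) \<longlonglongrightarrow> x" by (simp add: divide_inverse)
        with cont show "(\<lambda>n. U (x - z / Suc n)) \<longlonglongrightarrow> U x"
          by (rule continuous_on_tendsto_compose) auto
      qed
    qed (use bnd in \<open>auto simp del: of_nat_Suc\<close>)
    then show ?thesis by simp
  qed
  have "(\<lambda>n. LINT x|lborel. U x * inner n x) \<longlonglongrightarrow> (LINT x|lborel. U x * U x)"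
  proof (rule integral_dominated_convergence[where w = "\<lambda>x. M * \<bar>U x\<bar>"])
    show "AE x in lborel. (\<lambda>n. U x * inner n x) \<longlonglongrightarrow> U x * U x"
      by (intro AE_I2 tendsto_mult_left inner_lim)
    show "AE x in lborel. norm (U x * inner n x) \<le> M * \<bar>U x\<bar>" for n
      using inner_le by (intro AE_I2) (simp add: abs_mult mult.commute[of M] mult_left_mono)
  qed (use U in auto)
  then show ?thesis unfolding eq by (simp add: power2_eq_square)
qed

text \<open>
  Integration by parts against the primitive of an integrable function, which need not be
  differentiable anywhere. It is Fubini's theorem on the triangle \<open>t \<le> x\<close>.
\<close>

lemma primitive_by_parts:
  fixes \<Psi> \<psi> :: "real \<Rightarrow> 'a :: euclidean_space"
  assumes G: "integrable lborel (G :: real \<Rightarrow> real)" and supp: "\<And>x. x \<notin> {-1<..<1} \<Longrightarrow> G x = 0"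
    and \<Psi>: "\<And>x. -1 \<le> x \<Longrightarrow> x \<le> 1 \<Longrightarrow> (\<Psi> has_vector_derivative \<psi> x) (at x within {-1..1})"
    and \<psi>: "continuous_on {-1..1} \<psi>"
  shows "(LINT x|lborel. indicator {-1..1} x *\<^sub>R ((LINT t|lborel. indicator {..x} t * G t) *\<^sub>R \<psi> x))
    = (LINT t|lborel. G t) *\<^sub>R \<Psi> 1 - (LINT t|lborel. G t *\<^sub>R \<Psi> t)"
proof -
  have [measurable]: "G \<in> borel_measurable borel" using G by auto
  have L: "pair_sigma_finite (lborel :: real measure) (lborel :: real measure)"
    by (simp add: pair_sigma_finite_def sigma_finite_lborel)
  have \<Psi>c: "continuous_on {-1..1} \<Psi>"
    using \<Psi> by (auto intro!: continuous_on_vector_derivative)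
  have int\<psi>: "integrable lborel (\<lambda>x. indicator {-1..1} x *\<^sub>R \<psi> x)"
    using borel_integrable_atLeastAtMost'[OF \<psi>] by (simp add: set_integrable_def)
  have [measurable]: "(\<lambda>x. indicator {-1..1} x *\<^sub>R \<psi> x) \<in> borel_measurable borel"
    using int\<psi> by auto
  have m\<Psi>: "(\<lambda>x. indicator {-1..1} x *\<^sub>R \<Psi> x) \<in> borel_measurable borel"
    by (rule borel_measurable_continuous_on_indicator[OF _ \<Psi>c]) simp
  define H where "H x t = (indicator {..x} t * G t) *\<^sub>R (indicator {-1..1} x *\<^sub>R \<psi> x)" for x t :: real
  have Hint: "integrable (lborel \<Otimes>\<^sub>M lborel) (\<lambda>(x, t). H x t)"
  proof (rule Bochner_Integration.integrable_bound)
    show "integrable (lborel \<Otimes>\<^sub>M lborel) (\<lambda>(x, t). norm (indicator {-1..1} x *\<^sub>R \<psi> x) * \<bar>G t\<bar>)"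
      by (rule integrable_prod_mult[OF L integrable_norm[OF int\<psi>] integrable_abs[OF G]])
    have "(\<lambda>(x, t). H x t) = (\<lambda>z. ((if snd z \<le> fst z then 1 else 0) * G (snd z)) *\<^sub>R
        (indicator {-1..1} (fst z) *\<^sub>R \<psi> (fst z)))"
      by (auto simp: H_def indicator_def)
    also have "\<dots> \<in> borel_measurable (lborel \<Otimes>\<^sub>M lborel)"
      by (intro borel_measurable_scaleR
          measurable_compose[OF measurable_fst borel_measurable_integrable[OF int\<psi>]]) measurable
    finally show "(\<lambda>(x, t). H x t) \<in> borel_measurable (lborel \<Otimes>\<^sub>M lborel)" .
    show "AE z in lborel \<Otimes>\<^sub>M lborel. norm (case z of (x, t) \<Rightarrow> H x t)
        \<le> norm (case z of (x, t) \<Rightarrow> norm (indicator {-1..1} x *\<^sub>R \<psi> x) * \<bar>G t\<bar>)"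
      by (intro AE_I2) (auto simp: H_def indicator_def split: prod.split)
  qed
  have in1: "(LINT t|lborel. H x t) = indicator {-1..1} x *\<^sub>R ((LINT t|lborel. indicator {..x} t * G t) *\<^sub>R \<psi> x)" for x
  proof -
    have "(\<lambda>t. indicator {..x} t * G t) = (\<lambda>t. indicator {..x} t *\<^sub>R G t)" by simp
    then have "integrable lborel (\<lambda>t. indicator {..x} t * G t)"
      using integrable_mult_indicator[OF _ G, of "{..x}"] by simp
    then show ?thesis unfolding H_def by (simp add: mult.commute)
  qed
  have in2: "(LINT x|lborel. H x t) = G t *\<^sub>R \<Psi> 1 - G t *\<^sub>R (indicator {-1..1} t *\<^sub>R \<Psi> t)" for t
  proof (cases "t \<in> {-1<..<1}")
    case True
    have "(\<lambda>x. H x t) = (\<lambda>x. G t *\<^sub>R (indicator {t..1} x *\<^sub>R \<psi> x))"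
      using True by (auto simp: H_def indicator_def fun_eq_iff)
    moreover have "(LINT x|lborel. indicator {t..1} x *\<^sub>R \<psi> x) = \<Psi> 1 - \<Psi> t"
    proof (rule integral_FTC_atLeastAtMost)
      show "(\<Psi> has_vector_derivative \<psi> x) (at x within {t..1})" if "t \<le> x" "x \<le> 1" for x
        using has_vector_derivative_within_subset[OF \<Psi>[of x], of "{t..1}"] that True by auto
      show "continuous_on {t..1} \<psi>" using continuous_on_subset[OF \<psi>] True by auto
    qed (use True in auto)
    ultimately show ?thesis using True by (simp add: scaleR_diff_right del: scaleR_scaleR)
  next
    case False
    then show ?thesis using supp[OF False] by (simp add: H_def)
  qed
  have "(LINT x|lborel. indicator {-1..1} x *\<^sub>R ((LINT t|lborel. indicator {..x} t * G t) *\<^sub>R \<psi> x))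
      = (LINT t|lborel. G t *\<^sub>R \<Psi> 1 - G t *\<^sub>R (indicator {-1..1} t *\<^sub>R \<Psi> t))"
    using lborel_pair.Fubini_integral[OF Hint] by (simp add: in1 in2)
  also have "\<dots> = (LINT t|lborel. G t *\<^sub>R \<Psi> 1) - (LINT t|lborel. G t *\<^sub>R (indicator {-1..1} t *\<^sub>R \<Psi> t))"
  proof (rule Bochner_Integration.integral_diff)
    show "integrable lborel (\<lambda>t. G t *\<^sub>R \<Psi> 1)" using G by simp
    have "compact (\<Psi> ` {-1..1})" using \<Psi>c by (intro compact_continuous_image) auto
    then obtain C where C: "\<And>x. x \<in> {-1..1} \<Longrightarrow> norm (\<Psi> x) \<le> C"
      using compact_imp_bounded bounded_iff by (metis imageI)
    have "C \<ge> 0" using C[of 0] norm_ge_zero[of "\<Psi> 0"] by (simp del: norm_ge_zero)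
    show "integrable lborel (\<lambda>t. G t *\<^sub>R (indicator {-1..1} t *\<^sub>R \<Psi> t))"
    proof (rule Bochner_Integration.integrable_bound[of _ "\<lambda>t. C * G t"])
      show "AE t in lborel. norm (G t *\<^sub>R (indicator {-1..1} t *\<^sub>R \<Psi> t)) \<le> norm (C * G t)"
        using C \<open>C \<ge> 0\<close> by (intro AE_I2) (auto simp: indicator_def abs_mult mult.commute[of C] intro: mult_left_mono)
      show "(\<lambda>t. G t *\<^sub>R (indicator {-1..1} t *\<^sub>R \<Psi> t)) \<in> borel_measurable lborel"
        using borel_measurable_scaleR[OF \<open>G \<in> borel_measurable borel\<close> m\<Psi>]
        by (simp only: measurable_lborel1 measurable_lborel2)
    qed (use G in auto)
  qed
  also have "(\<lambda>t. G t *\<^sub>R (indicator {-1..1} t *\<^sub>R \<Psi> t)) = (\<lambda>t. G t *\<^sub>R \<Psi> t)"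
  proof
    show "G t *\<^sub>R (indicator {-1..1} t *\<^sub>R \<Psi> t) = G t *\<^sub>R \<Psi> t" for t
      using supp[of t] by (cases "t \<in> {-1..1}") auto
  qed
  also have "(LINT t|lborel. G t *\<^sub>R \<Psi> 1) = (LINT t|lborel. G t) *\<^sub>R \<Psi> 1"
    using G by (intro integral_scaleR_left) auto
  finally show ?thesis .
qed

section \<open>Test functions and the lemma of du Bois-Reymond\<close>

text \<open>
  A class of functions supported in \<open>[p, q]\<close> that contains \<open>exp (- 1 / ((x - p) (q - x)))\<close> and is closed
  under differentiation. All of them are therefore smooth.
\<close>

definition bump :: "real \<Rightarrow> real \<Rightarrow> nat \<Rightarrow> real poly \<Rightarrow> real \<Rightarrow> real" where
  "bump p q k P x = (if p < x \<and> x < q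
     then poly P x / ((x - p) * (q - x)) ^ k * exp (- 1 / ((x - p) * (q - x))) else 0)"

lemma exp_minus_inverse_le:
  assumes "g > 0" shows "exp (- 1 / g :: real) \<le> fact n * g ^ n"
proof -
  have "(1 / g) ^ n /\<^sub>R fact n = (\<Sum>i\<in>{n}. (1 / g) ^ i /\<^sub>R fact i)" by simp
  also have "\<dots> \<le> (\<Sum>i. (1 / g) ^ i /\<^sub>R fact i)"
    by (rule sum_le_suminf[OF summable_exp_generic]) (use assms in auto)
  finally have "(1 / g) ^ n / fact n \<le> exp (1 / g)" by (simp add: exp_def divide_inverse mult.commute)
  then have "1 / exp (1 / g) \<le> 1 / ((1 / g) ^ n / fact n)"
    using assms by (intro divide_left_mono) auto
  then show ?thesis by (simp add: exp_minus power_divide divide_inverse power_inverse mult.commute)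
qed

text \<open>The bound holds at every \<open>x0\<close> outside the open interval, and makes the derivative at \<open>x0\<close> vanish.\<close>

lemma bump_flat:
  assumes "p < q"
  shows "\<exists>C. \<forall>x x0. x0 \<notin> {p<..<q} \<longrightarrow> \<bar>bump p q k P x\<bar> \<le> C * (x - x0)\<^sup>2"
proof -
  have "compact (poly P ` {p..q})" by (intro compact_continuous_image continuous_intros) auto
  then obtain M where M: "\<And>x. x \<in> {p..q} \<Longrightarrow> \<bar>poly P x\<bar> \<le> M"
    using compact_imp_bounded bounded_iff by (metis imageI real_norm_def)
  have "M \<ge> 0" using M[of p] assms by auto
  define C where "C = M * fact (k + 2) * (q - p)\<^sup>2"
  have "C \<ge> 0" using \<open>M \<ge> 0\<close> by (simp add: C_def)
  have "\<bar>bump p q k P x\<bar> \<le> C * (x - x0)\<^sup>2" if x0: "x0 \<notin> {p<..<q}" for x x0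
  proof (cases "p < x \<and> x < q")
    case True
    define g where "g = (x - p) * (q - x)"
    have "g > 0" using True by (simp add: g_def)
    have "g \<le> (q - p) * \<bar>x - x0\<bar>"
    proof (cases "x0 \<le> p")
      case True' : True
      then have "(x - p) * (q - x) \<le> \<bar>x - x0\<bar> * (q - p)" using True by (intro mult_mono) auto
      then show ?thesis by (simp add: g_def mult.commute)
    next
      case False
      then have "x0 \<ge> q" using x0 by auto
      then show ?thesis unfolding g_def using True by (intro mult_mono) auto
    qed
    then have g2: "g\<^sup>2 \<le> (q - p)\<^sup>2 * (x - x0)\<^sup>2"
      using \<open>g > 0\<close> power_mono[of g "(q - p) * \<bar>x - x0\<bar>" 2] by (simp add: power_mult_distrib)
    have "\<bar>bump p q k P x\<bar> = \<bar>poly P x\<bar> / g ^ k * exp (- 1 / g)"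
      using True \<open>g > 0\<close> by (simp add: bump_def g_def[symmetric] abs_mult)
    also have "\<dots> \<le> M / g ^ k * (fact (k + 2) * g ^ (k + 2))"
      using M[of x] True \<open>g > 0\<close> \<open>M \<ge> 0\<close> exp_minus_inverse_le[OF \<open>g > 0\<close>, of "k + 2"]
      by (intro mult_mono divide_right_mono) auto
    also have "\<dots> = M * fact (k + 2) * g\<^sup>2"
      using \<open>g > 0\<close> by (simp add: power_add field_simps power2_eq_square)
    also have "\<dots> \<le> M * fact (k + 2) * ((q - p)\<^sup>2 * (x - x0)\<^sup>2)"
      using \<open>M \<ge> 0\<close> g2 by (intro mult_left_mono) auto
    finally show ?thesis by (simp add: C_def mult_ac)
  qed (use \<open>C \<ge> 0\<close> in \<open>auto simp: bump_def\<close>)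
  then show ?thesis by blast
qed

lemma bump_deriv:
  assumes "p < q"
  shows "\<exists>Q. \<forall>x. (bump p q k P has_real_derivative bump p q (k + 2) Q x) (at x)"
proof -
  define g where "g = [:- p, 1:] * [:q, - 1:]"
  define Q where "Q = pderiv P * g\<^sup>2 - smult (of_nat k) (P * pderiv g * g) + P * pderiv g"
  have g: "poly g x = (x - p) * (q - x)" for x by (simp add: g_def algebra_simps)
  have "(bump p q k P has_real_derivative bump p q (k + 2) Q x) (at x)" for x
  proof (cases "x \<in> {p<..<q}")
    case True
    then have "poly g x > 0" by (simp add: g)
    then have nz: "poly g x \<noteq> 0" by simp
    have "((\<lambda>x. poly P x / poly g x ^ k * exp (- 1 / poly g x)) has_real_derivative
        poly Q x / poly g x ^ (k + 2) * exp (- 1 / poly g x)) (at x)"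
    proof -
      have dg: "(poly g has_real_derivative poly (pderiv g) x) (at x)" by (rule poly_DERIV)
      have dpow: "((\<lambda>x. poly g x ^ k) has_real_derivative of_nat k * (poly g x ^ k * (poly (pderiv g) x / poly g x))) (at x)"
        by (rule DERIV_cong[OF DERIV_power[OF dg]]) (use nz in \<open>cases k; simp add: field_simps\<close>)
      have dexp: "((\<lambda>x. exp (- 1 / poly g x)) has_real_derivative
          exp (- 1 / poly g x) * (poly (pderiv g) x / (poly g x)\<^sup>2)) (at x)"
        using nz by (auto intro!: derivative_eq_intros dg simp: power2_eq_square)
      show ?thesis
        by (rule DERIV_cong[OF DERIV_mult[OF DERIV_divide[OF poly_DERIV dpow] dexp]])
           (use nz in \<open>auto simp: Q_def field_simps power2_eq_square\<close>)
    qed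
    moreover have "poly Q x / poly g x ^ (k + 2) * exp (- 1 / poly g x) = bump p q (k + 2) Q x"
      using True by (simp add: bump_def g)
    ultimately have "((\<lambda>x. poly P x / poly g x ^ k * exp (- 1 / poly g x)) has_real_derivative bump p q (k + 2) Q x) (at x)"
      by simp
    then show ?thesis
      by (rule has_field_derivative_transform_within_open[of _ _ _ "{p<..<q}"])
         (use True in \<open>auto simp: bump_def g\<close>)
  next
    case False
    obtain C where C: "\<And>y. \<bar>bump p q k P y\<bar> \<le> C * (y - x)\<^sup>2"
      using bump_flat[OF assms, of k P] False by blast
    have "((\<lambda>h. (bump p q k P (x + h) - bump p q k P x) / h) \<longlongrightarrow> 0) (at 0)"
    proof (rule Lim_null_comparison)
      show "eventually (\<lambda>h. norm ((bump p q k P (x + h) - bump p q k P x) / h) \<le> C * \<bar>h\<bar>) (at 0)"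
      proof (rule eventually_at_filter[THEN iffD2, OF always_eventually], safe)
        fix h :: real assume "h \<noteq> 0"
        have "bump p q k P x = 0" using False by (auto simp: bump_def)
        then show "norm ((bump p q k P (x + h) - bump p q k P x) / h) \<le> C * \<bar>h\<bar>"
          using C[of "x + h"] \<open>h \<noteq> 0\<close>
          by (simp add: field_simps power2_eq_square abs_if split: if_splits)
      qed
      have "((\<lambda>h. C * \<bar>h\<bar>) \<longlongrightarrow> C * \<bar>0\<bar>) (at (0::real))" by (intro tendsto_intros)
      then show "((\<lambda>h. C * \<bar>h\<bar>) \<longlongrightarrow> 0) (at (0::real))" by simp
    qed
    moreover have "bump p q (k + 2) Q x = 0" using False by (auto simp: bump_def)
    ultimately show ?thesis by (simp add: DERIV_def)
  qed
  then show ?thesis by blast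
qed

lemma bump_smooth:
  assumes "p < q"
  shows "(deriv ^^ n) (bump p q k P) field_differentiable at x"
proof -
  have "\<exists>k' P'. (deriv ^^ n) (bump p q k P) = bump p q k' P'"
  proof (induction n)
    case (Suc n)
    then obtain k' P' where IH: "(deriv ^^ n) (bump p q k P) = bump p q k' P'" by blast
    obtain Q where "\<And>x. (bump p q k' P' has_real_derivative bump p q (k' + 2) Q x) (at x)"
      using bump_deriv[OF assms] by blast
    then have "deriv (bump p q k' P') = bump p q (k' + 2) Q" by (intro ext DERIV_imp_deriv)
    then show ?case using IH by auto
  qed auto
  then show ?thesis
    using bump_deriv[OF assms] unfolding field_differentiable_def by metis
qed

lemma higher_deriv_lincomb:
  fixes f g :: "real \<Rightarrow> real"
  assumes f: "\<And>n x. (deriv ^^ n) f field_differentiable at x"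
    and g: "\<And>n x. (deriv ^^ n) g field_differentiable at x"
  shows "(deriv ^^ n) (\<lambda>x. a * f x + b * g x) = (\<lambda>x. a * (deriv ^^ n) f x + b * (deriv ^^ n) g x)"
proof (induction n)
  case (Suc n)
  have "deriv (\<lambda>x. a * (deriv ^^ n) f x + b * (deriv ^^ n) g x) x
      = a * deriv ((deriv ^^ n) f) x + b * deriv ((deriv ^^ n) g) x" for x
    by (intro DERIV_imp_deriv DERIV_add DERIV_cmult field_differentiable_derivI f g)
  then show ?case by (simp only: funpow.simps o_apply Suc.IH)
qed simp

text \<open>A smooth step from \<open>0\<close> to \<open>1\<close> across \<open>[p, q]\<close>, with its derivative \<open>b\<close>.\<close>

lemma smooth_step_exists:
  fixes p q :: real
  assumes "p < q"
  obtains S b :: "real \<Rightarrow> real" where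
    "\<And>x. (S has_real_derivative b x) (at x)" "\<And>n x. (deriv ^^ n) b field_differentiable at x"
    "\<And>x. b x \<ge> 0" "\<And>x. x \<notin> {p<..<q} \<Longrightarrow> b x = 0" "\<And>x. x \<le> p \<Longrightarrow> S x = 0" "\<And>x. x \<ge> q \<Longrightarrow> S x = 1"
proof -
  define \<beta> where "\<beta> = bump p q 0 1"
  define T where "T x = integral {p - 1..x} \<beta>" for x
  have sm: "(deriv ^^ n) \<beta> field_differentiable at x" for n x
    unfolding \<beta>_def by (rule bump_smooth[OF assms])
  have cont: "continuous_on A \<beta>" for A
    using sm[of 0] by (auto intro!: continuous_at_imp_continuous_on field_differentiable_imp_continuous_at)
  have zero: "\<beta> x = 0" if "x \<notin> {p<..<q}" for x using that by (auto simp: \<beta>_def bump_def)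
  have pos: "\<beta> x > 0" if "x \<in> {p<..<q}" for x using that by (auto simp: \<beta>_def bump_def)
  have T0: "T x = 0" if "x \<le> p" for x
  proof -
    have "T x = integral {p - 1..x} (\<lambda>x. 0)"
      unfolding T_def using that zero by (intro integral_cong) auto
    then show ?thesis by simp
  qed
  have dT: "(T has_real_derivative \<beta> x) (at x)" for x
  proof (cases "x < p")
    case True
    have "((\<lambda>_. 0) has_real_derivative \<beta> x) (at x)" using zero[of x] True by simp
    then show ?thesis
      by (rule has_field_derivative_transform_within_open[of _ _ _ "{..<p}"]) (use True T0 in auto)
  next
    case False
    have "(T has_real_derivative \<beta> x) (at x within {p - 1..x + 1})"
      unfolding T_def using False by (intro integral_has_real_derivative cont) auto
    moreover have "x \<in> interior {p - 1..x + 1}" using False by simp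
    ultimately show ?thesis by (metis at_within_interior)
  qed
  have Tq: "T x = T q" if "x \<ge> q" for x
  proof (cases "x = q")
    case False
    with that have "q < x" by simp
    then show ?thesis
    proof (rule DERIV_isconst_end)
      show "continuous_on {q..x} T" using dT by (auto intro!: continuous_at_imp_continuous_on DERIV_isCont)
      show "(T has_real_derivative 0) (at y)" if "q < y" "y < x" for y using dT[of y] zero[of y] that by simp
    qed
  qed simp
  have "T p < T q"
  proof (rule DERIV_pos_imp_increasing_open[OF assms])
    show "\<exists>y. (T has_real_derivative y) (at x) \<and> 0 < y" if "p < x" "x < q" for x
      using dT[of x] pos[of x] that by auto
    show "continuous_on {p..q} T" using dT by (auto intro!: continuous_at_imp_continuous_on DERIV_isCont)
  qed
  then have Tpos: "T q > 0" using T0[of p] by simp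
  \<comment> \<open>the zero summand turns the multiple into a linear combination of the required form\<close>
  have hd: "(deriv ^^ n) (\<lambda>x. (1 / T q) * \<beta> x + 0 * \<beta> x) = (\<lambda>x. (1 / T q) * (deriv ^^ n) \<beta> x + 0 * (deriv ^^ n) \<beta> x)" for n
    by (rule higher_deriv_lincomb[OF sm sm])
  show ?thesis
  proof (rule that[of "\<lambda>x. T x / T q" "\<lambda>x. (1 / T q) * \<beta> x + 0 * \<beta> x"])
    show "((\<lambda>x. T x / T q) has_real_derivative (1 / T q) * \<beta> x + 0 * \<beta> x) (at x)" for x
      using DERIV_cdivide[OF dT[of x], of "T q"] by simp
    show "(deriv ^^ n) (\<lambda>x. (1 / T q) * \<beta> x + 0 * \<beta> x) field_differentiable at x" for n x
      unfolding hd by (intro field_differentiable_add field_differentiable_mult sm field_differentiable_const)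
    show "(1 / T q) * \<beta> x + 0 * \<beta> x \<ge> 0" for x
      using pos[of x] zero[of x] Tpos by (cases "x \<in> {p<..<q}") auto
    show "(1 / T q) * \<beta> x + 0 * \<beta> x = 0" if "x \<notin> {p<..<q}" for x using zero[OF that] by simp
    show "T x / T q = 0" if "x \<le> p" for x using T0[OF that] by simp
    show "T x / T q = 1" if "x \<ge> q" for x using Tq[OF that] Tpos by simp
  qed
qed

text \<open>
  The derivative \<open>b\<close> of a smooth step is a weight of total mass \<open>1\<close>. Concentrated near \<open>a\<close>, it averages
  a continuous function to nearly its value at \<open>a\<close>.
\<close>

lemma smooth_average_near:
  fixes d :: "real \<Rightarrow> real"
  assumes d: "continuous_on {-1..1} d" and a: "a \<in> {-1<..<1}" and "\<epsilon> > 0"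
  obtains S b :: "real \<Rightarrow> real" and p q :: real where
    "\<And>x. (S has_real_derivative b x) (at x)" "\<And>n x. (deriv ^^ n) b field_differentiable at x"
    "-1 < p" "p < q" "q < 1" "\<And>x. x \<le> p \<Longrightarrow> S x = 0" "\<And>x. x \<ge> q \<Longrightarrow> S x = 1"
    "integrable lborel (\<lambda>x. indicator {-1..1} x *\<^sub>R (d x * b x))"
    "\<bar>(LINT x|lborel. indicator {-1..1} x *\<^sub>R (d x * b x)) - d a\<bar> \<le> \<epsilon>"
proof -
  have "a \<in> {-1..1}" using a by auto
  then obtain \<delta> where \<delta>: "\<delta> > 0" "\<And>x. x \<in> {-1..1} \<Longrightarrow> dist x a < \<delta> \<Longrightarrow> dist (d x) (d a) < \<epsilon>"
    using d \<open>\<epsilon> > 0\<close> unfolding continuous_on_iff by meson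
  define q where "q = a + min \<delta> (1 - a) / 2"
  have q: "a < q" "q < 1" "q < a + \<delta>" using \<delta>(1) a by (auto simp: q_def min_def field_simps)
  obtain S b where Sb: "\<And>x. (S has_real_derivative b x) (at x)" "\<And>n x. (deriv ^^ n) b field_differentiable at x"
    "\<And>x. b x \<ge> 0" "\<And>x. x \<notin> {a<..<q} \<Longrightarrow> b x = 0" "\<And>x. x \<le> a \<Longrightarrow> S x = 0" "\<And>x. x \<ge> q \<Longrightarrow> S x = 1"
    using smooth_step_exists[OF \<open>a < q\<close>] by metis
  have bc: "continuous_on {-1..1} b"
    using Sb(2)[of 0] by (auto intro!: continuous_at_imp_continuous_on field_differentiable_imp_continuous_at)
  have i1: "integrable lborel (\<lambda>x. indicator {-1..1} x *\<^sub>R (d x * b x))"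
    using borel_integrable_atLeastAtMost'[OF continuous_on_mult[OF d bc]] by (simp add: set_integrable_def)
  have i2: "integrable lborel (\<lambda>x. indicator {-1..1} x *\<^sub>R b x)"
    using borel_integrable_atLeastAtMost'[OF bc] by (simp add: set_integrable_def)
  have one: "(LINT x|lborel. indicator {-1..1} x *\<^sub>R b x) = 1"
  proof -
    have "(LINT x|lborel. indicator {-1..1} x *\<^sub>R b x) = S 1 - S (-1)"
      by (rule integral_FTC_atLeastAtMost[OF _ _ bc])
         (use Sb(1) in \<open>auto simp: has_real_derivative_iff_has_vector_derivative[symmetric]
            intro: has_field_derivative_at_within\<close>)
    then show ?thesis using Sb(5)[of "-1"] Sb(6)[of 1] a q by auto
  qed
  have "\<bar>(LINT x|lborel. indicator {-1..1} x *\<^sub>R (d x * b x))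
        - d a * (LINT x|lborel. indicator {-1..1} x *\<^sub>R b x)\<bar>
      = \<bar>LINT x|lborel. indicator {-1..1} x *\<^sub>R (d x * b x) - d a * (indicator {-1..1} x *\<^sub>R b x)\<bar>"
    using i1 i2 by simp
  also have "\<dots> \<le> (LINT x|lborel. \<bar>indicator {-1..1} x *\<^sub>R (d x * b x) - d a * (indicator {-1..1} x *\<^sub>R b x)\<bar>)"
    by (rule integral_abs_bound)
  also have "\<dots> \<le> (LINT x|lborel. \<epsilon> * (indicator {-1..1} x *\<^sub>R b x))"
  proof (rule integral_mono)
    show "integrable lborel (\<lambda>x. \<bar>indicator {-1..1} x *\<^sub>R (d x * b x) - d a * (indicator {-1..1} x *\<^sub>R b x)\<bar>)"
      using i1 i2 by (intro integrable_abs Bochner_Integration.integrable_diff integrable_mult_right)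
    show "integrable lborel (\<lambda>x. \<epsilon> * (indicator {-1..1} x *\<^sub>R b x))" using i2 by (rule integrable_mult_right)
    show "\<bar>indicator {-1..1} x *\<^sub>R (d x * b x) - d a * (indicator {-1..1} x *\<^sub>R b x)\<bar>
        \<le> \<epsilon> * (indicator {-1..1} x *\<^sub>R b x)" for x
    proof (cases "x \<in> {a<..<q}")
      case True
      then have "x \<in> {-1..1}" "dist x a < \<delta>" using a q by (auto simp: dist_real_def)
      then have "\<bar>d x - d a\<bar> \<le> \<epsilon>" using \<delta>(2)[of x] by (simp add: dist_real_def)
      then have "\<bar>d x - d a\<bar> * b x \<le> \<epsilon> * b x" using Sb(3) by (intro mult_right_mono)
      moreover have "\<bar>d x * b x - d a * b x\<bar> = \<bar>d x - d a\<bar> * b x"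
        using Sb(3)[of x] by (simp add: left_diff_distrib[symmetric] abs_mult)
      ultimately show ?thesis using \<open>x \<in> {-1..1}\<close> by simp
    qed (use Sb(4) in simp)
  qed
  also have "\<dots> = \<epsilon>" using one by simp
  finally have "\<bar>(LINT x|lborel. indicator {-1..1} x *\<^sub>R (d x * b x)) - d a\<bar> \<le> \<epsilon>"
    by (simp only: one mult_1_right)
  then show ?thesis
    using that[of S b a q] Sb(1,2,5,6) i1 q(1,2) a by simp
qed

text \<open>
  The difference of two smooth steps is a test function. Testing with it compares the averages of \<open>d\<close>
  near two given points.
\<close>

lemma du_Bois_Reymond:
  fixes d :: "real \<Rightarrow> real"
  assumes d: "continuous_on {-1..1} d"
    and test: "\<And>\<phi>. test_function {-1<..<1} \<phi> \<Longrightarrow>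
       (LINT x|lborel. indicator {-1..1} x *\<^sub>R (d x * deriv \<phi> x)) = 0"
    and "x \<in> {-1..1}"
  shows "d x = d (-1)"
proof -
  have eq: "d a = d a'" if a: "a \<in> {-1<..<1}" "a' \<in> {-1<..<1}" for a a'
  proof (rule ccontr)
    assume "d a \<noteq> d a'"
    define \<epsilon> where "\<epsilon> = \<bar>d a - d a'\<bar> / 3"
    have "\<epsilon> > 0" using \<open>d a \<noteq> d a'\<close> by (simp add: \<epsilon>_def)
    obtain S b p q where Sb: "\<And>x. (S has_real_derivative b x) (at x)" "\<And>n x. (deriv ^^ n) b field_differentiable at x"
      "-1 < p" "p < q" "q < 1" "\<And>x. x \<le> p \<Longrightarrow> S x = 0" "\<And>x. x \<ge> q \<Longrightarrow> S x = 1"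
      "integrable lborel (\<lambda>x. indicator {-1..1} x *\<^sub>R (d x * b x))"
      "\<bar>(LINT x|lborel. indicator {-1..1} x *\<^sub>R (d x * b x)) - d a\<bar> \<le> \<epsilon>"
      by (rule smooth_average_near[OF d a(1) \<open>\<epsilon> > 0\<close>]) (rule that)
    obtain S' b' p' q' where Sb': "\<And>x. (S' has_real_derivative b' x) (at x)" "\<And>n x. (deriv ^^ n) b' field_differentiable at x"
      "-1 < p'" "p' < q'" "q' < 1" "\<And>x. x \<le> p' \<Longrightarrow> S' x = 0" "\<And>x. x \<ge> q' \<Longrightarrow> S' x = 1"
      "integrable lborel (\<lambda>x. indicator {-1..1} x *\<^sub>R (d x * b' x))"
      "\<bar>(LINT x|lborel. indicator {-1..1} x *\<^sub>R (d x * b' x)) - d a'\<bar> \<le> \<epsilon>"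
      by (rule smooth_average_near[OF d a(2) \<open>\<epsilon> > 0\<close>]) (rule that)
    define \<phi> where "\<phi> x = S x - S' x" for x
    have d\<phi>: "(\<phi> has_real_derivative 1 * b x + (-1) * b' x) (at x)" for x
      unfolding \<phi>_def using DERIV_diff[OF Sb(1) Sb'(1)] by simp
    then have deriv\<phi>: "deriv \<phi> = (\<lambda>x. 1 * b x + (-1) * b' x)" by (intro ext DERIV_imp_deriv)
    have "test_function {-1<..<1} \<phi>"
      unfolding test_function_def
    proof (intro conjI allI)
      show "(deriv ^^ n) \<phi> field_differentiable at x" for n x
      proof (cases n)
        case 0
        then show ?thesis using d\<phi> by (auto simp: field_differentiable_def)
      next
        case (Suc m)
        then have "(deriv ^^ n) \<phi> = (deriv ^^ m) (deriv \<phi>)" by (simp only: funpow_Suc_right o_apply)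
        then show ?thesis
          unfolding deriv\<phi> higher_deriv_lincomb[OF Sb(2) Sb'(2)]
          by (simp only:) (intro field_differentiable_add field_differentiable_mult Sb(2) Sb'(2) field_differentiable_const)
      qed
      show "\<exists>K. compact K \<and> K \<subseteq> {-1<..<1} \<and> (\<forall>x. x \<notin> K \<longrightarrow> \<phi> x = 0)"
      proof (intro exI[of _ "{min p p'..max q q'}"] conjI allI impI)
        show "\<phi> x = 0" if "x \<notin> {min p p'..max q q'}" for x
        proof (cases "x < min p p'")
          case True
          then show ?thesis using Sb(6)[of x] Sb'(6)[of x] by (simp add: \<phi>_def)
        next
          case False
          then have "x > max q q'" using that by auto
          then show ?thesis using Sb(7)[of x] Sb'(7)[of x] by (simp add: \<phi>_def)
        qed
      qed (use Sb(3-5) Sb'(3-5) in auto)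
    qed
    from test[OF this] have "(LINT x|lborel. indicator {-1..1} x *\<^sub>R (d x * b x) - indicator {-1..1} x *\<^sub>R (d x * b' x)) = 0"
      unfolding deriv\<phi> by (simp add: algebra_simps)
    then have "(LINT x|lborel. indicator {-1..1} x *\<^sub>R (d x * b x)) = (LINT x|lborel. indicator {-1..1} x *\<^sub>R (d x * b' x))"
      using Sb(8) Sb'(8) by simp
    then have "\<bar>d a - d a'\<bar> \<le> 2 * \<epsilon>" using Sb(9) Sb'(9) by linarith
    moreover have "\<bar>d a - d a'\<bar> = 3 * \<epsilon>" by (simp add: \<epsilon>_def)
    ultimately show False using \<open>\<epsilon> > 0\<close> by linarith
  qed
  have cl: "closure {-1<..<1} = {-1..1::real}" by (rule closure_greaterThanLessThan) simp
  have "d y = d 0" if "y \<in> {-1..1}" for y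
  proof (rule continuous_constant_on_closure[of "{-1<..<1}" d])
    show "d x = d 0" if "x \<in> {-1<..<1}" for x using eq[OF that, of 0] by simp
  qed (use d that cl in auto)
  from this[OF \<open>x \<in> {-1..1}\<close>] this[of "-1"] show ?thesis by simp
qed

section \<open>Elements of \<open>H10\<close> as primitives\<close>

text \<open>
  The primitive of \<open>G\<close> that vanishes at \<open>-\<infinity>\<close>; for \<open>G\<close> supported in \<open>(-1, 1)\<close> it vanishes on
  \<open>(-\<infinity>, -1]\<close>.
\<close>

definition primitive :: "(real \<Rightarrow> real) \<Rightarrow> real \<Rightarrow> real" where
  "primitive G x = (LINT t|lborel. indicator {..x} t * G t)"

lemma integrable_of_square_integrable:
  fixes G :: "real \<Rightarrow> real"
  assumes [measurable]: "G \<in> borel_measurable borel" and supp: "\<And>x. x \<notin> {-1<..<1} \<Longrightarrow> G x = 0"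
    and G2: "integrable lborel (\<lambda>x. (G x)\<^sup>2)"
  shows "integrable lborel G" and "(LINT x|lborel. \<bar>G x\<bar>)\<^sup>2 \<le> 2 * (LINT x|lborel. (G x)\<^sup>2)"
proof -
  let ?I = "indicator {-1..1} :: real \<Rightarrow> real"
  have sq: "(\<lambda>x. (?I x)\<^sup>2) = ?I" by (auto simp: indicator_def)
  have I: "integrable lborel (\<lambda>x. (?I x)\<^sup>2)" unfolding sq by simp
  have eq: "(\<lambda>x. ?I x * G x) = G"
  proof
    show "?I x * G x = G x" for x using supp[of x] by (cases "x \<in> {-1..1}") auto
  qed
  show "integrable lborel G"
    using Cauchy_Schwarz_integral(1)[OF _ _ I G2] by (simp add: eq)
  have "(LINT x|lborel. \<bar>?I x * G x\<bar>)\<^sup>2 \<le> (LINT x|lborel. (?I x)\<^sup>2) * (LINT x|lborel. (G x)\<^sup>2)"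
    by (rule Cauchy_Schwarz_integral(2)[OF _ _ I G2]) auto
  moreover have "(\<lambda>x. \<bar>?I x * G x\<bar>) = (\<lambda>x. \<bar>G x\<bar>)" using eq by metis
  ultimately show "(LINT x|lborel. \<bar>G x\<bar>)\<^sup>2 \<le> 2 * (LINT x|lborel. (G x)\<^sup>2)"
    unfolding sq by simp
qed

lemma primitive_Hoelder:
  fixes G :: "real \<Rightarrow> real"
  assumes [measurable]: "G \<in> borel_measurable borel" and G: "integrable lborel G"
    and G2: "integrable lborel (\<lambda>x. (G x)\<^sup>2)"
  shows "(primitive G x - primitive G y)\<^sup>2 \<le> \<bar>x - y\<bar> * (LINT x|lborel. (G x)\<^sup>2)"
proof -
  have *: "(primitive G x - primitive G y)\<^sup>2 \<le> \<bar>x - y\<bar> * (LINT x|lborel. (G x)\<^sup>2)" if "y \<le> x" for x y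
  proof -
    let ?I = "indicator {y<..x} :: real \<Rightarrow> real"
    have sq: "(\<lambda>t. (?I t)\<^sup>2) = ?I" by (auto simp: indicator_def)
    have I: "integrable lborel (\<lambda>t. (?I t)\<^sup>2)"
      unfolding sq by (rule integrable_real_indicator) (use that in auto)
    have int: "integrable lborel (\<lambda>t. indicator {..x} t * G t)" for x
      using integrable_mult_indicator[OF _ G, of "{..x}"] by simp
    have "primitive G x - primitive G y = (LINT t|lborel. indicator {..x} t * G t - indicator {..y} t * G t)"
      unfolding primitive_def using int by simp
    also have "(\<lambda>t. indicator {..x} t * G t - indicator {..y} t * G t) = (\<lambda>t. ?I t * G t)"
      using that by (auto simp: indicator_def)
    finally have "\<bar>primitive G x - primitive G y\<bar> \<le> (LINT t|lborel. \<bar>?I t * G t\<bar>)"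
      using integral_abs_bound[of lborel "\<lambda>t. ?I t * G t"] by simp
    then have "\<bar>primitive G x - primitive G y\<bar>\<^sup>2 \<le> (LINT t|lborel. \<bar>?I t * G t\<bar>)\<^sup>2"
      by (intro power_mono) auto
    also have "\<dots> \<le> (LINT t|lborel. (?I t)\<^sup>2) * (LINT t|lborel. (G t)\<^sup>2)"
      by (rule Cauchy_Schwarz_integral(2)[OF _ _ I G2]) auto
    finally show ?thesis unfolding sq using that by simp
  qed
  show ?thesis
    using *[of x y] *[of y x] by (cases "y \<le> x") (auto simp: power2_commute abs_minus_commute)
qed

lemma primitive_continuous:
  fixes G :: "real \<Rightarrow> real"
  assumes "G \<in> borel_measurable borel" "integrable lborel G" "integrable lborel (\<lambda>x. (G x)\<^sup>2)"
  shows "continuous_on UNIV (primitive G)"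
proof -
  have "isCont (primitive G) x" for x
  proof -
    let ?N = "LINT x|lborel. (G x)\<^sup>2"
    have "((\<lambda>y. primitive G y - primitive G x) \<longlongrightarrow> 0) (at x)"
    proof (rule Lim_null_comparison)
      show "eventually (\<lambda>y. norm (primitive G y - primitive G x) \<le> sqrt (\<bar>y - x\<bar> * ?N)) (at x)"
        using primitive_Hoelder[OF assms] by (auto intro!: always_eventually real_le_rsqrt)
      have "((\<lambda>y. sqrt (\<bar>y - x\<bar> * ?N)) \<longlongrightarrow> sqrt (\<bar>x - x\<bar> * ?N)) (at x)" by (intro tendsto_intros)
      then show "((\<lambda>y. sqrt (\<bar>y - x\<bar> * ?N)) \<longlongrightarrow> 0) (at x)" by simp
    qed
    then show ?thesis by (simp add: isCont_def LIM_zero_iff)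
  qed
  then show ?thesis by (simp add: continuous_on_eq_continuous_at)
qed

lemma primitive_outside:
  fixes G :: "real \<Rightarrow> real"
  assumes supp: "\<And>x. x \<notin> {-1<..<1} \<Longrightarrow> G x = 0" and "(LINT x|lborel. G x) = 0" "x \<notin> {-1<..<1}"
  shows "primitive G x = 0"
proof (cases "x \<le> -1")
  case True
  have "(\<lambda>t. indicator {..x} t * G t) = (\<lambda>t. 0)"
  proof
    show "indicator {..x} t * G t = 0" for t using supp[of t] True by (cases "t \<le> x") auto
  qed
  then show ?thesis by (simp add: primitive_def)
next
  case False
  then have "x \<ge> 1" using assms(3) by auto
  have "(\<lambda>t. indicator {..x} t * G t) = G"
  proof
    show "indicator {..x} t * G t = G t" for t using supp[of t] \<open>x \<ge> 1\<close> by (cases "t \<le> x") auto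
  qed
  then show ?thesis using assms(2) by (simp add: primitive_def)
qed

text \<open>
  Integrals over \<open>(-1, 1)\<close> of Lebesgue measurable functions are moved to Borel measurable functions on
  the line, where product measures are available.
\<close>

lemma LINT_lebesgue_on_eq_lborel:
  fixes F F' :: "real \<Rightarrow> 'a :: {banach, second_countable_topology}"
  assumes "F \<in> borel_measurable (lebesgue_on {-1<..<1})" and F': "F' \<in> borel_measurable borel"
    and "AE x in lebesgue_on {-1<..<1}. F x = F' x" and supp: "\<And>x. x \<notin> {-1<..<1} \<Longrightarrow> F' x = 0"
  shows "(LINT x|lebesgue_on {-1<..<1}. F x) = (LINT x|lborel. F' x)"
    and "integrable (lebesgue_on {-1<..<1}) F \<longleftrightarrow> integrable lborel F'"
proof -
  have m: "F' \<in> borel_measurable (lebesgue_on {-1<..<1})"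
    by (intro measurable_restrict_space1 measurable_completion) (use F' in simp)
  have e: "(\<lambda>x. indicator {-1<..<1} x *\<^sub>R F' x) = F'"
    using supp by (auto simp: indicator_def fun_eq_iff)
  have "(LINT x|lebesgue_on {-1<..<1}. F x) = (LINT x|lebesgue_on {-1<..<1}. F' x)"
    by (rule integral_cong_AE) (use assms(1,3) m in auto)
  also have "\<dots> = (LINT x|lebesgue. F' x)"
    by (subst integral_restrict_space) (simp_all add: e)
  also have "\<dots> = (LINT x|lborel. F' x)"
    by (rule integral_completion) (use F' in simp)
  finally show "(LINT x|lebesgue_on {-1<..<1}. F x) = (LINT x|lborel. F' x)" .
  have "integrable (lebesgue_on {-1<..<1}) F \<longleftrightarrow> integrable (lebesgue_on {-1<..<1}) F'"
    by (rule integrable_cong_AE) (use assms(1,3) m in auto)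
  also have "\<dots> \<longleftrightarrow> integrable lebesgue F'"
    by (subst integrable_restrict_space) (simp_all add: e)
  also have "\<dots> \<longleftrightarrow> integrable lborel F'"
    by (rule integrable_completion) (use F' in simp)
  finally show "integrable (lebesgue_on {-1<..<1}) F \<longleftrightarrow> integrable lborel F'" .
qed

lemma borel_version:
  fixes g :: "real \<Rightarrow> real"
  assumes "g \<in> borel_measurable (lebesgue_on {-1<..<1})"
  obtains G where "G \<in> borel_measurable borel" "\<And>x. x \<notin> {-1<..<1} \<Longrightarrow> G x = 0"
    "AE x in lebesgue_on {-1<..<1}. g x = G x"
proof -
  have "(\<lambda>x. indicator {-1<..<1} x * g x) \<in> borel_measurable lebesgue"
    using assms borel_measurable_restrict_space_iff[of "{-1<..<1}" lebesgue g] by simp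
  then obtain G0 where G0: "G0 \<in> borel_measurable lborel" "AE x in lborel. indicator {-1<..<1} x * g x = G0 x"
    using completion_ex_borel_measurable_real by blast
  show ?thesis
  proof (rule that[of "\<lambda>x. indicator {-1<..<1} x * G0 x"])
    show "(\<lambda>x. indicator {-1<..<1} x * G0 x) \<in> borel_measurable borel" using G0(1) by simp
    have "AE x in lebesgue. indicator {-1<..<1} x * g x = G0 x" using G0(2) by (rule AE_completion)
    then show "AE x in lebesgue_on {-1<..<1}. g x = indicator {-1<..<1} x * G0 x"
      by (subst AE_restrict_space_iff) (auto elim!: eventually_mono)
  qed auto
qed

lemma test_function_deriv:
  assumes "test_function {-1<..<1} \<phi>"
  shows "(\<phi> has_real_derivative deriv \<phi> x) (at x)" "continuous_on A (deriv \<phi>)"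
    "x \<notin> {-1<..<1} \<Longrightarrow> \<phi> x = 0"
proof -
  have d: "(deriv ^^ n) \<phi> field_differentiable at x" for n x
    using assms by (auto simp: test_function_def)
  show "(\<phi> has_real_derivative deriv \<phi> x) (at x)"
    using d[of 0] by (simp add: field_differentiable_derivI)
  show "continuous_on A (deriv \<phi>)"
    using d[of 1] by (auto intro!: continuous_at_imp_continuous_on field_differentiable_imp_continuous_at)
  show "\<phi> x = 0" if "x \<notin> {-1<..<1}" using assms that by (auto simp: test_function_def)
qed

text \<open>
  The elements of \<open>H10\<close> are primitives of square-integrable functions of mean zero. Here \<open>G\<close> is a Borel
  version of the weak derivative: the continuous representative and the primitive of \<open>G\<close> have the same
  weak derivative, hence differ by a constant, which is zero by the boundary value at \<open>-1\<close>. The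
  boundary value at \<open>1\<close> then says that \<open>G\<close> has mean zero.
\<close>

lemma H10_primitive:
  assumes f: "f \<in> H10"
  obtains G where "G \<in> borel_measurable borel" "\<And>x. x \<notin> {-1<..<1} \<Longrightarrow> G x = 0"
    "integrable lborel G" "integrable lborel (\<lambda>x. (G x)\<^sup>2)" "(LINT x|lborel. G x) = 0"
    "f \<in> borel_measurable (lebesgue_on {-1<..<1})"
    "AE x in lebesgue_on {-1<..<1}. f x = primitive G x"
    "L2_norm_on {-1<..<1} (weak_deriv {-1<..<1} f) = sqrt (LINT x|lborel. (G x)\<^sup>2)"
proof -
  define g where "g = weak_deriv {-1<..<1} f"
  have "\<exists>g. g square_integrable_on {-1<..<1} \<and> has_weak_derivative_on f g {-1<..<1}"
    using f by (auto simp: H10_def H1_def)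
  then have g: "g square_integrable_on {-1<..<1}" "has_weak_derivative_on f g {-1<..<1}"
    unfolding g_def weak_deriv_def by (metis (mono_tags, lifting) someI_ex)+
  have fm: "f \<in> borel_measurable (lebesgue_on {-1<..<1})"
    using f by (auto simp: H10_def H1_def square_integrable_on_def)
  obtain u where u: "continuous_on {-1..1} u" "AE x in lebesgue_on {-1<..<1}. f x = u x" "u (-1) = 0" "u 1 = 0"
    using f by (auto simp: H10_def)
  have gm: "g \<in> borel_measurable (lebesgue_on {-1<..<1})"
    "integrable (lebesgue_on {-1<..<1}) (\<lambda>x. (norm (g x))\<^sup>2)"
    using g(1) by (auto simp: square_integrable_on_def)
  obtain G where G: "G \<in> borel_measurable borel" "\<And>x. x \<notin> {-1<..<1} \<Longrightarrow> G x = 0"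
    "AE x in lebesgue_on {-1<..<1}. g x = G x"
    using borel_version[OF gm(1)] by metis
  note [measurable] = G(1) gm(1) fm
  have sqm: "(\<lambda>x. (norm (g x))\<^sup>2) \<in> borel_measurable (lebesgue_on {-1<..<1})" by measurable
  have AE2: "AE x in lebesgue_on {-1<..<1}. (norm (g x))\<^sup>2 = (G x)\<^sup>2"
    using G(3) by (rule eventually_mono) simp
  note conv = LINT_lebesgue_on_eq_lborel[OF sqm _ AE2]
  have G2: "integrable lborel (\<lambda>x. (G x)\<^sup>2)" using gm(2) conv(2) G(2) by simp
  have norm: "L2_norm_on {-1<..<1} g = sqrt (LINT x|lborel. (G x)\<^sup>2)"
    unfolding L2_norm_on_def using conv(1) G(2) by simp
  have Gi: "integrable lborel G" by (rule integrable_of_square_integrable[OF G(1,2) G2])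
  let ?U = "primitive G"
  have Uc: "continuous_on A ?U" for A
    using primitive_continuous[OF G(1) Gi G2] continuous_on_subset by blast
  have "u x - ?U x = u (-1) - ?U (-1)" if "x \<in> {-1..1}" for x
  proof (rule du_Bois_Reymond[OF _ _ that])
    show "continuous_on {-1..1} (\<lambda>x. u x - ?U x)" by (intro continuous_intros u Uc)
    fix \<phi> assume \<phi>: "test_function {-1<..<1} \<phi>"
    note d\<phi> = test_function_deriv[OF \<phi>]
    have \<phi>c: "continuous_on A \<phi>" for A
      using d\<phi>(1) by (auto intro!: continuous_at_imp_continuous_on DERIV_isCont)
    have [measurable]: "\<phi> \<in> borel_measurable borel" "deriv \<phi> \<in> borel_measurable borel"
      using \<phi>c d\<phi>(2) by (auto intro!: borel_measurable_continuous_onI)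
    have [measurable]: "\<phi> \<in> borel_measurable (lebesgue_on {-1<..<1})"
      "deriv \<phi> \<in> borel_measurable (lebesgue_on {-1<..<1})"
      by (auto intro!: measurable_restrict_space1 measurable_completion)
    have eq1: "(LINT x|lebesgue_on {-1<..<1}. f x * deriv \<phi> x) = (LINT x|lborel. indicator {-1..1} x *\<^sub>R (u x * deriv \<phi> x))"
    proof -
      have "continuous_on {-1<..<1} (\<lambda>x. u x * deriv \<phi> x)"
        by (intro continuous_intros d\<phi>(2) continuous_on_subset[OF u(1)]) auto
      then have m: "(\<lambda>x. indicator {-1<..<1} x *\<^sub>R (u x * deriv \<phi> x)) \<in> borel_measurable borel"
        by (intro borel_measurable_continuous_on_indicator) auto
      have "continuous_on {-1..1} (\<lambda>x. u x * deriv \<phi> x)"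
        by (intro continuous_intros d\<phi>(2) u(1))
      then have m': "(\<lambda>x. indicator {-1..1} x *\<^sub>R (u x * deriv \<phi> x)) \<in> borel_measurable borel"
        by (intro borel_measurable_continuous_on_indicator) auto
      have "(LINT x|lebesgue_on {-1<..<1}. f x * deriv \<phi> x) = (LINT x|lborel. indicator {-1<..<1} x *\<^sub>R (u x * deriv \<phi> x))"
      proof (rule LINT_lebesgue_on_eq_lborel(1)[OF _ m])
        show "AE x in lebesgue_on {-1<..<1}. f x * deriv \<phi> x = indicator {-1<..<1} x *\<^sub>R (u x * deriv \<phi> x)"
          using u(2) by (simp add: AE_restrict_space_iff) (auto elim!: eventually_mono)
      qed auto
      also have "\<dots> = (LINT x|lborel. indicator {-1..1} x *\<^sub>R (u x * deriv \<phi> x))"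
      proof (rule integral_cong_AE)
        have "AE x in lborel. x \<noteq> -1 \<and> x \<noteq> (1::real)"
          using AE_lborel_singleton[of "-1::real"] AE_lborel_singleton[of "1::real"] by eventually_elim auto
        then show "AE x in lborel. indicator {-1<..<1} x *\<^sub>R (u x * deriv \<phi> x) = indicator {-1..1} x *\<^sub>R (u x * deriv \<phi> x)"
          by eventually_elim (auto simp: indicator_def)
      qed (use m m' in auto)
      finally show ?thesis .
    qed
    have eq2: "(LINT x|lebesgue_on {-1<..<1}. g x * \<phi> x) = (LINT x|lborel. G x * \<phi> x)"
    proof (rule LINT_lebesgue_on_eq_lborel(1))
      show "AE x in lebesgue_on {-1<..<1}. g x * \<phi> x = G x * \<phi> x" using G(3) by (rule eventually_mono) simp
    qed (use G(2) in auto)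
    have parts: "(LINT x|lborel. indicator {-1..1} x *\<^sub>R (?U x *\<^sub>R deriv \<phi> x)) = (LINT t|lborel. G t) *\<^sub>R \<phi> 1 - (LINT t|lborel. G t *\<^sub>R \<phi> t)"
      unfolding primitive_def
      by (rule primitive_by_parts[OF Gi G(2) _ d\<phi>(2)])
         (use d\<phi>(1) in \<open>auto simp: has_real_derivative_iff_has_vector_derivative[symmetric] intro: has_field_derivative_at_within\<close>)
    have wk: "(LINT x|lebesgue_on {-1<..<1}. f x * deriv \<phi> x) = - (LINT x|lebesgue_on {-1<..<1}. g x * \<phi> x)"
      using g(2) \<phi> by (auto simp: has_weak_derivative_on_def)
    have i: "integrable lborel (\<lambda>x. indicator {-1..1} x *\<^sub>R (v x * deriv \<phi> x))" if "continuous_on {-1..1} v" for v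
      using borel_integrable_atLeastAtMost'[OF continuous_on_mult[OF that d\<phi>(2)]] by (simp add: set_integrable_def)
    have "(LINT x|lborel. indicator {-1..1} x *\<^sub>R ((u x - ?U x) * deriv \<phi> x)) =
        (LINT x|lborel. indicator {-1..1} x *\<^sub>R (u x * deriv \<phi> x) - indicator {-1..1} x *\<^sub>R (?U x * deriv \<phi> x))"
      by (rule Bochner_Integration.integral_cong) (auto simp: algebra_simps)
    also have "\<dots> = (LINT x|lborel. indicator {-1..1} x *\<^sub>R (u x * deriv \<phi> x)) - (LINT x|lborel. indicator {-1..1} x *\<^sub>R (?U x * deriv \<phi> x))"
      by (rule Bochner_Integration.integral_diff[OF i[OF u(1)] i[OF Uc]])
    also have "\<dots> = 0"
      using eq1 eq2 parts wk d\<phi>(3)[of 1] by simp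
    finally show "(LINT x|lborel. indicator {-1..1} x *\<^sub>R ((u x - ?U x) * deriv \<phi> x)) = 0" .
  qed
  moreover have "?U (-1) = 0"
  proof -
    have "(\<lambda>t. indicator {..-1} t * G t) = (\<lambda>t. 0)"
      using G(2) by (auto simp: indicator_def fun_eq_iff)
    then show ?thesis by (simp add: primitive_def)
  qed
  ultimately have uU: "u x = ?U x" if "x \<in> {-1..1}" for x using that u(3) by fastforce
  have "?U 1 = (LINT t|lborel. G t)"
    unfolding primitive_def
    by (rule Bochner_Integration.integral_cong) (use G(2) in \<open>auto simp: indicator_def\<close>)
  then have mean: "(LINT t|lborel. G t) = 0" using uU[of 1] u(4) by simp
  have "AE x in lebesgue_on {-1<..<1}. f x = ?U x"
    using u(2) uU by (simp add: AE_restrict_space_iff)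
  then show ?thesis
    using that[of G] G Gi G2 mean fm norm by (simp add: g_def)
qed

section \<open>Energy and pointwise estimates on frequency bands\<close>

lemma integrable_band:
  assumes U: "integrable lborel (U :: real \<Rightarrow> real)"
  shows "integrable lborel (\<lambda>\<xi>. indicator {-B..B} \<xi> * (cmod (ft U \<xi>))\<^sup>2)"
proof -
  have [measurable]: "U \<in> borel_measurable borel" using U by auto
  let ?C = "(1 / sqrt (2 * pi) * (LINT x|lborel. \<bar>U x\<bar>))\<^sup>2"
  show ?thesis
  proof (rule Bochner_Integration.integrable_bound[of _ "\<lambda>\<xi>. ?C * indicator {-B..B} \<xi>"])
    show "integrable lborel (\<lambda>\<xi>. ?C * indicator {-B..B} \<xi>)"
      by (intro integrable_mult_right integrable_real_indicator) (auto simp: emeasure_lborel_Icc_eq)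
    have "(cmod (ft U \<xi>))\<^sup>2 \<le> ?C" for \<xi> using cmod_ft_le[OF U] by (intro power_mono) auto
    then show "AE \<xi> in lborel. norm (indicator {-B..B} \<xi> * (cmod (ft U \<xi>))\<^sup>2) \<le> norm (?C * indicator {-B..B} \<xi>)"
      by (intro AE_I2) (auto simp: indicator_def)
  qed measurable
qed

text \<open>Bessel's inequality: the Gaussian forms are bounded by the norm, uniformly in \<open>\<sigma>\<close>.\<close>

lemma band_energy_le:
  assumes G: "integrable lborel (G :: real \<Rightarrow> real)" and G2: "integrable lborel (\<lambda>x. (G x)\<^sup>2)"
  shows "(LINT \<xi>|lborel. indicator {-B..B} \<xi> * (cmod (ft G \<xi>))\<^sup>2) \<le> (LINT x|lborel. (G x)\<^sup>2)"
    (is "?S \<le> ?N")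
proof -
  have le: "?S \<le> exp ((\<sigma> * B)\<^sup>2 / 2) * ?N" if "\<sigma> > 0" for \<sigma>
  proof -
    have "?S \<le> (LINT \<xi>|lborel. exp ((\<sigma> * B)\<^sup>2 / 2) * ((cmod (ft G \<xi>))\<^sup>2 * exp (- (\<sigma> * \<xi>)\<^sup>2 / 2)))"
    proof (rule integral_mono[OF integrable_band[OF G]])
      show "integrable lborel (\<lambda>\<xi>. exp ((\<sigma> * B)\<^sup>2 / 2) * ((cmod (ft G \<xi>))\<^sup>2 * exp (- (\<sigma> * \<xi>)\<^sup>2 / 2)))"
        by (intro integrable_mult_right ft_gaussian(1)[OF G that])
      show "indicator {-B..B} \<xi> * (cmod (ft G \<xi>))\<^sup>2
          \<le> exp ((\<sigma> * B)\<^sup>2 / 2) * ((cmod (ft G \<xi>))\<^sup>2 * exp (- (\<sigma> * \<xi>)\<^sup>2 / 2))" for \<xi>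
      proof (cases "\<xi> \<in> {-B..B}")
        case True
        then have "\<bar>\<sigma> * \<xi>\<bar> \<le> \<bar>\<sigma> * B\<bar>" using that by (simp add: abs_mult abs_le_iff)
        then have "(\<sigma> * \<xi>)\<^sup>2 \<le> (\<sigma> * B)\<^sup>2" by (simp add: abs_le_square_iff)
        then have "1 \<le> exp ((\<sigma> * B)\<^sup>2 / 2) * exp (- (\<sigma> * \<xi>)\<^sup>2 / 2)"
          by (simp flip: exp_add)
        then have "(cmod (ft G \<xi>))\<^sup>2 * 1 \<le> (cmod (ft G \<xi>))\<^sup>2 * (exp ((\<sigma> * B)\<^sup>2 / 2) * exp (- (\<sigma> * \<xi>)\<^sup>2 / 2))"
          by (intro mult_left_mono) auto
        then show ?thesis using True by (simp add: mult_ac)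
      qed simp
    qed
    also have "\<dots> = exp ((\<sigma> * B)\<^sup>2 / 2) * (LINT \<xi>|lborel. (cmod (ft G \<xi>))\<^sup>2 * exp (- (\<sigma> * \<xi>)\<^sup>2 / 2))"
      by (rule integral_mult_right_zero)
    also have "\<dots> \<le> exp ((\<sigma> * B)\<^sup>2 / 2) * ?N"
      using gaussian_form_le[OF G G2 that] ft_gaussian(2)[OF G that] by (intro mult_left_mono) auto
    finally show ?thesis .
  qed
  have "((\<lambda>\<sigma>. exp ((\<sigma> * B)\<^sup>2 / 2) * ?N) \<longlongrightarrow> exp ((0 * B)\<^sup>2 / 2) * ?N) (at_right 0)"
    by (intro tendsto_intros) auto
  then have "?S \<le> exp ((0 * B)\<^sup>2 / 2) * ?N"
    by (rule tendsto_lowerbound)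
       (use le eventually_at_right_less[of "0::real"] in \<open>auto elim: eventually_mono\<close>)
  then show ?thesis by simp
qed

text \<open>
  The continuous representative \<open>U\<close> of an element of \<open>H10\<close>, extended by zero to the line, is the
  primitive of its weak derivative \<open>G\<close>.
\<close>

locale H10_representative =
  fixes G :: "real \<Rightarrow> real"
  assumes G_borel [measurable]: "G \<in> borel_measurable borel"
    and G_supp: "\<And>x. x \<notin> {-1<..<1} \<Longrightarrow> G x = 0"
    and G2: "integrable lborel (\<lambda>x. (G x)\<^sup>2)"
    and G_mean: "(LINT x|lborel. G x) = 0"
begin

abbreviation "U \<equiv> primitive G"

lemma G_int: "integrable lborel G"
  by (rule integrable_of_square_integrable[OF G_borel G_supp G2])

lemma U_cont: "continuous_on A U"
  using primitive_continuous[OF G_borel G_int G2] continuous_on_subset by blast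

lemma U_borel [measurable]: "U \<in> borel_measurable borel"
  using U_cont by (rule borel_measurable_continuous_onI)

lemma U_supp: "x \<notin> {-1<..<1} \<Longrightarrow> U x = 0"
  using primitive_outside[OF G_supp G_mean] .

lemma U_sq_le: "(U x)\<^sup>2 \<le> 2 * (LINT x|lborel. (G x)\<^sup>2)"
proof (cases "x \<in> {-1<..<1}")
  case True
  have "(U x - U (-1))\<^sup>2 \<le> \<bar>x - (-1)\<bar> * (LINT x|lborel. (G x)\<^sup>2)"
    by (rule primitive_Hoelder[OF G_borel G_int G2])
  also have "\<dots> \<le> 2 * (LINT x|lborel. (G x)\<^sup>2)"
    using True by (intro mult_right_mono) auto
  finally show ?thesis using U_supp[of "-1"] by simp
next
  case False
  then show ?thesis by (simp add: U_supp)
qed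

lemma U2: "integrable lborel (\<lambda>x. (U x)\<^sup>2)"
  and Poincare: "(LINT x|lborel. (U x)\<^sup>2) \<le> 4 * (LINT x|lborel. (G x)\<^sup>2)"
proof -
  let ?N = "LINT x|lborel. (G x)\<^sup>2"
  have "?N \<ge> 0" by simp
  have i: "integrable lborel (\<lambda>x::real. 2 * ?N * indicator {-1..1} x)"
    by (intro integrable_mult_right integrable_real_indicator) auto
  have le: "(U x)\<^sup>2 \<le> 2 * ?N * indicator {-1..1} x" for x
    using U_sq_le[of x] U_supp[of x] by (cases "x \<in> {-1..1}") auto
  show *: "integrable lborel (\<lambda>x. (U x)\<^sup>2)"
    by (rule Bochner_Integration.integrable_bound[OF i]) (use le \<open>?N \<ge> 0\<close> in auto)
  have "(LINT x|lborel. (U x)\<^sup>2) \<le> (LINT x::real|lborel. 2 * ?N * indicator {-1..1} x)"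
    by (rule integral_mono[OF * i le])
  then show "(LINT x|lborel. (U x)\<^sup>2) \<le> 4 * ?N" by simp
qed

lemma U_int: "integrable lborel U"
  and U_L1: "(LINT x|lborel. \<bar>U x\<bar>) \<le> sqrt 2 * sqrt (LINT x|lborel. (U x)\<^sup>2)"
proof -
  show "integrable lborel U"
    by (rule integrable_of_square_integrable[OF U_borel U_supp U2])
  show "(LINT x|lborel. \<bar>U x\<bar>) \<le> sqrt 2 * sqrt (LINT x|lborel. (U x)\<^sup>2)"
    using integrable_of_square_integrable(2)[OF U_borel U_supp U2]
    by (metis real_le_rsqrt real_sqrt_mult)
qed

lemma ft_derivative: "ft G \<xi> = \<i> * of_real \<xi> * ft U \<xi>"
proof -
  let ?e = "\<lambda>x. exp (- \<i> * complex_of_real (x * \<xi>))"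
  have "(LINT x|lborel. indicator {-1..1} x *\<^sub>R (primitive G x *\<^sub>R (- \<i> * of_real \<xi> * ?e x)))
      = (LINT t|lborel. G t) *\<^sub>R ?e 1 - (LINT t|lborel. G t *\<^sub>R ?e t)"
    unfolding primitive_def
  proof (rule primitive_by_parts[OF G_int G_supp])
    show "(?e has_vector_derivative - \<i> * of_real \<xi> * ?e x) (at x within {-1..1})" for x
      using exp_scaleR_has_vector_derivative_right[of "- \<i> * of_real \<xi>" x "{-1..1}"]
      by (simp add: scaleR_conv_of_real mult_ac)
  qed (auto intro!: continuous_intros)
  moreover have "(\<lambda>x. indicator {-1..1} x *\<^sub>R (primitive G x *\<^sub>R (- \<i> * of_real \<xi> * ?e x)))
      = (\<lambda>x. (- \<i> * of_real \<xi>) * (complex_of_real (U x) * ?e x))"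
  proof
    show "indicator {-1..1} x *\<^sub>R (primitive G x *\<^sub>R (- \<i> * of_real \<xi> * ?e x))
        = (- \<i> * of_real \<xi>) * (complex_of_real (U x) * ?e x)" for x
      using U_supp[of x] by (cases "x \<in> {-1..1}") (auto simp: scaleR_conv_of_real)
  qed
  ultimately have "(LINT x|lborel. (- \<i> * of_real \<xi>) * (complex_of_real (U x) * ?e x))
      = - (LINT t|lborel. complex_of_real (G t) * ?e t)"
    using G_mean by (simp only: scaleR_conv_of_real of_real_0 mult_zero_left diff_0)
  then have "(- \<i> * of_real \<xi>) * (LINT x|lborel. complex_of_real (U x) * ?e x)
      = - (LINT t|lborel. complex_of_real (G t) * ?e t)"
    by (simp only: integral_mult_right_zero)
  then show ?thesis by (simp add: ft_def del: of_real_mult)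
qed

text \<open>
  If the frequency number is small compared to \<open>B0\<close>, then most of the energy lies in \<open>[-B0, B0]\<close>: the
  indicator of the band is at least \<open>1 - (\<xi> / B0)\<^sup>2\<close>, and \<open>\<xi>\<^sup>2 |ft U|\<^sup>2 = |ft G|\<^sup>2\<close>. The Gaussian factor
  makes both parts integrable.
\<close>

lemma band_energy_ge:
  assumes "B0 > 0"
  shows "(LINT x|lborel. (U x)\<^sup>2) - (LINT x|lborel. (G x)\<^sup>2) / B0\<^sup>2
    \<le> (LINT \<xi>|lborel. indicator {-B0..B0} \<xi> * (cmod (ft U \<xi>))\<^sup>2)" (is "?u - ?g / _ \<le> ?S")
proof -
  define A where "A H n = (LINT \<xi>|lborel. (cmod (ft H \<xi>))\<^sup>2 * exp (- (1 / Suc n * \<xi>)\<^sup>2 / 2))" for H and n :: nat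
  have le: "A U n \<le> ?S + ?g / B0\<^sup>2" for n
  proof -
    let ?E = "\<lambda>\<xi>. exp (- (1 / Suc n * \<xi>)\<^sup>2 / 2)"
    have iU: "integrable lborel (\<lambda>\<xi>. (cmod (ft U \<xi>))\<^sup>2 * ?E \<xi>)"
      and iG: "integrable lborel (\<lambda>\<xi>. (cmod (ft G \<xi>))\<^sup>2 * ?E \<xi>)"
      by (rule ft_gaussian(1)[OF U_int] ft_gaussian(1)[OF G_int]; simp)+
    have "A U n \<le> (LINT \<xi>|lborel. indicator {-B0..B0} \<xi> * (cmod (ft U \<xi>))\<^sup>2 + 1 / B0\<^sup>2 * ((cmod (ft G \<xi>))\<^sup>2 * ?E \<xi>))"
      unfolding A_def
    proof (rule integral_mono[OF iU])
      show "integrable lborel (\<lambda>\<xi>. indicator {-B0..B0} \<xi> * (cmod (ft U \<xi>))\<^sup>2 + 1 / B0\<^sup>2 * ((cmod (ft G \<xi>))\<^sup>2 * ?E \<xi>))"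
        by (intro Bochner_Integration.integrable_add integrable_mult_right iG integrable_band U_int)
      fix \<xi> :: real
      have G: "(cmod (ft G \<xi>))\<^sup>2 = \<xi>\<^sup>2 * (cmod (ft U \<xi>))\<^sup>2"
        unfolding ft_derivative by (simp add: norm_mult power_mult_distrib)
      show "(cmod (ft U \<xi>))\<^sup>2 * ?E \<xi>
          \<le> indicator {-B0..B0} \<xi> * (cmod (ft U \<xi>))\<^sup>2 + 1 / B0\<^sup>2 * ((cmod (ft G \<xi>))\<^sup>2 * ?E \<xi>)"
      proof (cases "\<xi> \<in> {-B0..B0}")
        case True
        have "(cmod (ft U \<xi>))\<^sup>2 * ?E \<xi> \<le> (cmod (ft U \<xi>))\<^sup>2 * 1" by (intro mult_left_mono) auto
        also have "\<dots> \<le> (cmod (ft U \<xi>))\<^sup>2 * 1 + 1 / B0\<^sup>2 * ((cmod (ft G \<xi>))\<^sup>2 * ?E \<xi>)"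
          by simp
        finally show ?thesis using True by simp
      next
        case False
        then have "B0\<^sup>2 \<le> \<xi>\<^sup>2" using assms by (auto simp: abs_le_square_iff[symmetric])
        then have "1 \<le> 1 / B0\<^sup>2 * \<xi>\<^sup>2" using assms by simp
        then have "1 * ((cmod (ft U \<xi>))\<^sup>2 * ?E \<xi>) \<le> 1 / B0\<^sup>2 * \<xi>\<^sup>2 * ((cmod (ft U \<xi>))\<^sup>2 * ?E \<xi>)"
          by (intro mult_right_mono) auto
        then show ?thesis using False by (simp add: G mult_ac)
      qed
    qed
    also have "\<dots> = ?S + 1 / B0\<^sup>2 * A G n"
      unfolding A_def using iG integrable_band[OF U_int] by simp
    also have "A G n \<le> ?g"
      using ft_gaussian(2)[OF G_int, of "1 / Suc n"] gaussian_form_le[OF G_int G2, of "1 / Suc n"]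
      unfolding A_def by simp
    finally show ?thesis using assms by (simp add: divide_right_mono)
  qed
  have "(\<lambda>n. A U n) \<longlonglongrightarrow> ?u"
  proof -
    have "\<bar>U x\<bar> \<le> sqrt (2 * ?g)" for x using U_sq_le[of x] by (intro real_le_rsqrt) simp
    from gaussian_form_tendsto[OF U_int U_cont this] show ?thesis
      unfolding A_def by (subst ft_gaussian(2)[OF U_int]) auto
  qed
  then have "?u \<le> ?S + ?g / B0\<^sup>2" by (rule LIMSEQ_le_const2) (use le in auto)
  then show ?thesis by simp
qed

text \<open>The holomorphic extension of \<open>ft U\<close> to the complex plane.\<close>

definition transform :: "complex \<Rightarrow> complex" where
  "transform z = complex_of_real (1 / sqrt (2 * pi)) *
     (LINT x|lborel. complex_of_real (U x) * exp (- \<i> * (complex_of_real x * z)))"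

lemma transform_of_real: "transform (of_real \<xi>) = ft U \<xi>"
  by (simp add: transform_def ft_def)

lemma transform_integrable: "integrable lborel (\<lambda>x. complex_of_real (U x) * exp (- \<i> * (complex_of_real x * z)))"
  and transform_eq_integral: "(LINT x|lborel. complex_of_real (U x) * exp (- \<i> * (complex_of_real x * z)))
    = integral (cbox (-1) 1) (\<lambda>x. complex_of_real (U x) * exp (- \<i> * (complex_of_real x * z)))"
proof -
  let ?h = "\<lambda>x. complex_of_real (U x) * exp (- \<i> * (complex_of_real x * z))"
  have "continuous_on {-1..1} ?h" by (intro continuous_intros U_cont)
  then have s: "set_integrable lborel {-1..1} ?h" by (rule borel_integrable_atLeastAtMost')
  have eq: "(\<lambda>x. indicator {-1..1} x *\<^sub>R ?h x) = ?h"
  proof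
    show "indicator {-1..1} x *\<^sub>R ?h x = ?h x" for x
      using U_supp[of x] by (cases "x \<in> {-1..1}") auto
  qed
  show "integrable lborel ?h" using s unfolding set_integrable_def eq .
  show "(LINT x|lborel. ?h x) = integral (cbox (-1) 1) ?h"
    using set_borel_integral_eq_integral(2)[OF s] unfolding set_lebesgue_integral_def eq by simp
qed

lemma transform_holomorphic: "transform holomorphic_on UNIV"
proof -
  have "(\<lambda>z. integral (cbox (-1) 1) (\<lambda>x. complex_of_real (U x) * exp (- \<i> * (complex_of_real x * z)))) holomorphic_on UNIV"
  proof (rule leibniz_rule_holomorphic)
    show "((\<lambda>z. complex_of_real (U x) * exp (- \<i> * (complex_of_real x * z))) has_field_derivative
        complex_of_real (U x) * (exp (- \<i> * (complex_of_real x * z)) * (- \<i> * of_real x))) (at z within UNIV)" for z x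
      by (auto intro!: derivative_eq_intros)
    show "(\<lambda>x. complex_of_real (U x) * exp (- \<i> * (complex_of_real x * z))) integrable_on cbox (-1) 1" for z
      by (intro integrable_continuous continuous_intros U_cont)
    have "continuous_on (UNIV \<times> cbox (-1) 1) (\<lambda>p :: complex \<times> real. U (snd p))"
      by (rule continuous_on_compose2[OF U_cont[of UNIV]]) (auto intro: continuous_intros)
    then show "continuous_on (UNIV \<times> cbox (-1) 1)
       (\<lambda>(z, x). complex_of_real (U x) * (exp (- \<i> * (complex_of_real x * z)) * (- \<i> * of_real x)))"
      unfolding case_prod_beta by (intro continuous_intros)
  qed simp
  then show ?thesis
    unfolding transform_def transform_eq_integral by (intro holomorphic_intros)
qed

abbreviation "normU \<equiv> sqrt (LINT x|lborel. (U x)\<^sup>2)"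

lemma transform_le:
  assumes "\<bar>Im z\<bar> \<le> L" shows "cmod (transform z) \<le> normU * exp L / sqrt pi"
proof -
  have "cmod (LINT x|lborel. complex_of_real (U x) * exp (- \<i> * (complex_of_real x * z)))
     \<le> (LINT x|lborel. cmod (complex_of_real (U x) * exp (- \<i> * (complex_of_real x * z))))"
    by (rule integral_norm_bound)
  also have "\<dots> \<le> (LINT x|lborel. \<bar>U x\<bar> * exp L)"
  proof (rule integral_mono)
    show "integrable lborel (\<lambda>x. cmod (complex_of_real (U x) * exp (- \<i> * (complex_of_real x * z))))"
      using transform_integrable by (rule integrable_norm)
    show "integrable lborel (\<lambda>x. \<bar>U x\<bar> * exp L)" using U_int by simp
    show "cmod (complex_of_real (U x) * exp (- \<i> * (complex_of_real x * z))) \<le> \<bar>U x\<bar> * exp L" for x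
    proof (cases "x \<in> {-1<..<1}")
      case True
      then have "\<bar>x * Im z\<bar> \<le> 1 * L" unfolding abs_mult using assms by (intro mult_mono) auto
      then have "x * Im z \<le> L" by linarith
      then show ?thesis by (simp add: norm_mult mult_left_mono)
    qed (simp add: U_supp)
  qed
  also have "\<dots> \<le> sqrt 2 * normU * exp L" using U_L1 by simp
  finally have "cmod (transform z) \<le> 1 / sqrt (2 * pi) * (sqrt 2 * normU * exp L)"
    unfolding transform_def norm_mult by (intro mult_mono) (auto simp: norm_divide)
  then show ?thesis by (simp add: real_sqrt_mult)
qed

lemma ft_Lipschitz: "\<bar>cmod (ft U \<xi>) - cmod (ft U \<eta>)\<bar> \<le> normU / sqrt pi * \<bar>\<xi> - \<eta>\<bar>"
proof -
  let ?e = "\<lambda>\<xi> x. complex_of_real (U x) * exp (- \<i> * complex_of_real (x * \<xi>))"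
  have i: "integrable lborel (?e \<xi>)" for \<xi> by (rule integrable_ft_kernel[OF U_int])
  have "cmod ((LINT x|lborel. ?e \<xi> x) - (LINT x|lborel. ?e \<eta> x)) \<le> (LINT x|lborel. cmod (?e \<xi> x - ?e \<eta> x))"
    unfolding Bochner_Integration.integral_diff[OF i i, symmetric] by (rule integral_norm_bound)
  also have "\<dots> \<le> (LINT x|lborel. \<bar>U x\<bar> * \<bar>\<xi> - \<eta>\<bar>)"
  proof (rule integral_mono)
    show "integrable lborel (\<lambda>x. cmod (?e \<xi> x - ?e \<eta> x))"
      by (intro integrable_norm Bochner_Integration.integrable_diff i)
    show "integrable lborel (\<lambda>x. \<bar>U x\<bar> * \<bar>\<xi> - \<eta>\<bar>)" using U_int by simp
    show "cmod (?e \<xi> x - ?e \<eta> x) \<le> \<bar>U x\<bar> * \<bar>\<xi> - \<eta>\<bar>" for x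
    proof (cases "x \<in> {-1<..<1}")
      case True
      have "?e \<xi> x - ?e \<eta> x = complex_of_real (U x) * (exp (- \<i> * complex_of_real (x * \<eta>)) * (iexp (x * (\<eta> - \<xi>)) - 1))"
        by (simp add: algebra_simps flip: exp_add)
      then have "cmod (?e \<xi> x - ?e \<eta> x) = \<bar>U x\<bar> * cmod (iexp (x * (\<eta> - \<xi>)) - 1)"
        by (simp add: norm_mult)
      also have "cmod (iexp (x * (\<eta> - \<xi>)) - 1) \<le> \<bar>x * (\<eta> - \<xi>)\<bar>"
        using iexp_approx1[of "x * (\<eta> - \<xi>)" 0] by simp
      also have "\<bar>x * (\<eta> - \<xi>)\<bar> \<le> 1 * \<bar>\<xi> - \<eta>\<bar>"
        unfolding abs_mult using True by (intro mult_mono) auto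
      finally show ?thesis by (simp add: mult_left_mono)
    qed (simp add: U_supp)
  qed
  also have "\<dots> \<le> sqrt 2 * normU * \<bar>\<xi> - \<eta>\<bar>" using U_L1 by (simp add: mult_right_mono)
  finally have "cmod (ft U \<xi> - ft U \<eta>) \<le> 1 / sqrt (2 * pi) * (sqrt 2 * normU * \<bar>\<xi> - \<eta>\<bar>)"
    unfolding ft_def right_diff_distrib[symmetric] norm_mult
    by (intro mult_mono) (auto simp: norm_divide)
  also have "\<dots> = normU / sqrt pi * \<bar>\<xi> - \<eta>\<bar>" by (simp add: real_sqrt_mult)
  finally show ?thesis using norm_triangle_ineq3[of "ft U \<xi>" "ft U \<eta>"] by linarith
qed

lemma ft_even: "cmod (ft U (- \<xi>)) = cmod (ft U \<xi>)"
proof -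
  have "ft U (- \<xi>) = cnj (ft U \<xi>)"
    unfolding ft_def complex_cnj_mult Bochner_Integration.integral_cnj[symmetric] by (simp add: exp_cnj)
  then show ?thesis by simp
qed

text \<open>The norm in \<open>L\<^sup>2\<close> of the transform of \<open>U\<close> truncated to \<open>[-B, B]\<close>.\<close>

definition band_norm :: "real \<Rightarrow> real" where
  "band_norm B = sqrt (LINT \<xi>|lborel. indicator {-B..B} \<xi> * (cmod (ft U \<xi>))\<^sup>2)"

lemma band_norm_le: "band_norm B \<le> normU"
  unfolding band_norm_def using band_energy_le[OF U_int U2] by simp

lemma band_norm_sq: "(band_norm B)\<^sup>2 = (LINT \<xi>|lborel. indicator {-B..B} \<xi> * (cmod (ft U \<xi>))\<^sup>2)"
  unfolding band_norm_def by (subst real_sqrt_pow2) auto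

text \<open>
  A pointwise bound by the truncated norm. By the Lipschitz bound, \<open>|ft U|\<close> stays above \<open>3/4\<close> of its value
  \<open>M\<close> at \<open>\<xi>\<close> on a one-sided interval of length \<open>l = min (B/2) (M / (4 D))\<close> inside \<open>[0, B]\<close>, where \<open>D\<close> is the
  Lipschitz constant. If the first term is the minimum, then the summand \<open>4 / B\<close> of the constant
  suffices; otherwise the constant enters through \<open>(X + Y)\<^sup>3 \<ge> 27/4 X\<^sup>2 Y\<close>, where \<open>X = (B / pi)\<close> to the power \<open>1/4\<close> and \<open>Y = 2 / sqrt B\<close>, so that
  \<open>X\<^sup>2 Y\<close> does not depend on \<open>B\<close>.
\<close>

lemma band_sup_le:
  assumes "B > 0" "0 \<le> \<xi>" "\<xi> \<le> B"
  shows "(cmod (ft U \<xi>))\<^sup>2 \<le> (B powr (1/4) / pi powr (1/4) + 2 / sqrt B)\<^sup>2 * (band_norm B * normU)"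
proof (cases "ft U \<xi> = 0")
  case True
  then show ?thesis by (simp add: band_norm_def)
next
  case False
  define M where "M = cmod (ft U \<xi>)"
  have "M > 0" using False by (simp add: M_def)
  define N where "N = band_norm B"
  define D where "D = normU / sqrt pi"
  have nn: "0 \<le> N" "N \<le> normU" using band_norm_le by (auto simp: N_def band_norm_def)
  have "normU > 0"
  proof (rule ccontr)
    assume "\<not> normU > 0"
    then have "normU = 0" using nn by linarith
    then have "M \<le> 0" using transform_le[of "of_real \<xi>" 0] by (simp add: transform_of_real M_def)
    with \<open>M > 0\<close> show False by simp
  qed
  then have "D > 0" by (simp add: D_def)
  define l where "l = min (B / 2) (M / (4 * D))"
  have l: "l > 0" "l \<le> B / 2" "D * l \<le> M / 4"
  proof -
    show "l > 0" "l \<le> B / 2" using assms \<open>M > 0\<close> \<open>D > 0\<close> by (auto simp: l_def)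
    have "D * l \<le> D * (M / (4 * D))" using \<open>D > 0\<close> by (intro mult_left_mono) (auto simp: l_def)
    then show "D * l \<le> M / 4" using \<open>D > 0\<close> by simp
  qed
  define J where "J = (if \<xi> \<le> B / 2 then {\<xi>..\<xi> + l} else {\<xi> - l..\<xi>})"
  have J: "J \<subseteq> {-B..B}" "\<And>\<eta>. \<eta> \<in> J \<Longrightarrow> \<bar>\<xi> - \<eta>\<bar> \<le> l"
    using assms l by (auto simp: J_def split: if_splits)
  have Jm: "J \<in> sets lborel" "measure lborel J = l" "emeasure lborel J < \<infinity>"
    using l(1) by (auto simp: J_def)
  have big: "(3 / 4 * M)\<^sup>2 \<le> (cmod (ft U \<eta>))\<^sup>2" if "\<eta> \<in> J" for \<eta>
  proof -
    have "\<bar>cmod (ft U \<xi>) - cmod (ft U \<eta>)\<bar> \<le> D * \<bar>\<xi> - \<eta>\<bar>"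
      unfolding D_def by (rule ft_Lipschitz)
    also have "\<dots> \<le> D * l" using J(2)[OF that] \<open>D > 0\<close> by (intro mult_left_mono) auto
    finally have "3 / 4 * M \<le> cmod (ft U \<eta>)" using l(3) unfolding M_def by linarith
    then show ?thesis using \<open>M > 0\<close> by (intro power_mono) auto
  qed
  have "l * (3 / 4 * M)\<^sup>2 = (LINT \<eta>|lborel. (3 / 4 * M)\<^sup>2 * indicator J \<eta>)"
    using Jm by simp
  also have "\<dots> \<le> (LINT \<eta>|lborel. indicator {-B..B} \<eta> * (cmod (ft U \<eta>))\<^sup>2)"
  proof (rule integral_mono[OF _ integrable_band[OF U_int]])
    show "integrable lborel (\<lambda>\<eta>. (3 / 4 * M)\<^sup>2 * indicator J \<eta>)"
      by (intro integrable_mult_right integrable_real_indicator Jm)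
    show "(3 / 4 * M)\<^sup>2 * indicator J \<eta> \<le> indicator {-B..B} \<eta> * (cmod (ft U \<eta>))\<^sup>2" for \<eta>
      using big[of \<eta>] J(1) by (cases "\<eta> \<in> J") auto
  qed
  finally have "l * (3 / 4 * M)\<^sup>2 \<le> N\<^sup>2" unfolding N_def band_norm_sq .
  then have en: "l * (9 / 16 * M\<^sup>2) \<le> N\<^sup>2"
    by (simp add: power_mult_distrib power2_eq_square)
  define X where "X = B powr (1/4) / pi powr (1/4)"
  define Y where "Y = 2 / sqrt B"
  have XY: "X > 0" "Y > 0" using assms by (auto simp: X_def Y_def)
  have X2Y: "X\<^sup>2 * Y = 2 / sqrt pi"
  proof -
    have "X\<^sup>2 = B powr (1/2) / pi powr (1/2)"
      using assms by (simp add: X_def power_divide powr_power)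
    then show ?thesis using assms by (simp add: Y_def powr_half_sqrt)
  qed
  have "M\<^sup>2 \<le> (X + Y)\<^sup>2 * (N * normU)"
  proof (cases "B / 2 \<le> M / (4 * D)")
    case True
    then have "B / 2 * (9 / 16 * M\<^sup>2) \<le> N\<^sup>2" using en by (simp add: l_def)
    then have "M\<^sup>2 \<le> 32 / 9 / B * N\<^sup>2" using assms by (simp add: field_simps)
    also have "\<dots> \<le> Y\<^sup>2 * N\<^sup>2"
    proof (rule mult_right_mono)
      show "32 / 9 / B \<le> Y\<^sup>2"
        using assms divide_right_mono[of "32 / 9" 4 B] by (simp add: Y_def power_divide)
    qed simp
    also have "\<dots> \<le> (X + Y)\<^sup>2 * (N * normU)"
      using XY nn by (intro mult_mono power_mono) (auto simp: power2_eq_square mult_left_mono)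
    finally show ?thesis .
  next
    case False
    then have "M / (4 * D) * (9 / 16 * M\<^sup>2) \<le> N\<^sup>2" using en by (simp add: l_def min_def)
    then have "M ^ 3 \<le> 64 / 9 * D * N\<^sup>2"
      using \<open>D > 0\<close> by (simp add: field_simps power3_eq_cube power2_eq_square)
    also have "\<dots> \<le> 27 / 4 * (X\<^sup>2 * Y) * (normU * N\<^sup>2)"
    proof -
      have "64 / 9 * (normU / sqrt pi * N\<^sup>2) \<le> 27 / 2 * (normU / sqrt pi * N\<^sup>2)"
        using \<open>normU > 0\<close> by (intro mult_right_mono) auto
      then show ?thesis unfolding X2Y D_def by simp
    qed
    also have "\<dots> \<le> (X + Y) ^ 3 * (normU * N\<^sup>2)"
    proof (rule mult_right_mono)
      have "(X + Y) ^ 3 - 27 / 4 * (X\<^sup>2 * Y) = (2 * Y - X)\<^sup>2 * (Y + 4 * X) / 4"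
        by (simp add: power2_eq_square power3_eq_cube algebra_simps)
      moreover have "\<dots> \<ge> 0" using XY by simp
      ultimately show "27 / 4 * (X\<^sup>2 * Y) \<le> (X + Y) ^ 3" by linarith
    qed (use \<open>normU > 0\<close> in simp)
    finally have M3: "M ^ 3 \<le> (X + Y) ^ 3 * (normU * N\<^sup>2)" .
    have "(M\<^sup>2) ^ 3 = (M ^ 3)\<^sup>2" by (simp flip: power_mult)
    also have "\<dots> \<le> ((X + Y) ^ 3 * (normU * N\<^sup>2))\<^sup>2" using M3 \<open>M > 0\<close> by (intro power_mono) auto
    also have "\<dots> = ((X + Y)\<^sup>2) ^ 3 * (normU\<^sup>2 * N ^ 3 * N)"
      by (simp add: power_mult_distrib power2_eq_square power3_eq_cube mult_ac)
    also have "\<dots> \<le> ((X + Y)\<^sup>2) ^ 3 * (normU\<^sup>2 * N ^ 3 * normU)"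
      using nn \<open>normU > 0\<close> by (intro mult_left_mono) auto
    also have "\<dots> = ((X + Y)\<^sup>2 * (N * normU)) ^ 3"
      by (simp add: power_mult_distrib power2_eq_square power3_eq_cube mult_ac)
    finally show ?thesis
      using nn \<open>normU > 0\<close> by (subst (asm) power_mono_iff) auto
  qed
  then show ?thesis by (simp add: M_def X_def Y_def N_def)
qed

end

section \<open>The bound by the truncated transform\<close>

text \<open>
  The exponents \<open>1/w \<ge> 1\<close> and \<open>2 L (1 - w) / w \<ge> 0\<close> can only increase the constant when the base is at
  least \<open>1\<close>. This suffices for the two infinite limits, without the behaviour of \<open>w\<close>.
\<close>

lemma k_const_ge:
  assumes "L > 0" "0 < B" "B < b" "\<gamma> > 1" "1 \<le> 2 * b / (1 - 1 / \<gamma>)"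
  shows "k_const \<gamma> L b B \<ge> (B powr (1/4) / pi powr (1/4) + 2 / sqrt B)\<^sup>2 * (2 * b / (1 - 1 / \<gamma>))"
proof -
  define w where "w = slit_measure L (of_real b) B"
  have w: "0 < w" "w \<le> 1" using slit_measure_props[OF assms(1-3)] by (auto simp: w_def)
  let ?c = "(B powr (1/4) / pi powr (1/4) + 2 / sqrt B)\<^sup>2" and ?Q = "2 * b / (1 - 1 / \<gamma>)"
  have "?Q = ?Q powr 1" using assms(5) by (intro powr_one[symmetric]) linarith
  also have "\<dots> \<le> ?Q powr (1 / w)" using w assms(5) by (intro powr_mono) auto
  finally have Qle: "?Q \<le> ?Q powr (1 / w)" .
  have "?c * ?Q * 1 \<le> ?c * ?Q powr (1 / w) * exp (2 * L * (1 - w) / w)"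
  proof (rule mult_mono)
    show "?c * ?Q \<le> ?c * ?Q powr (1 / w)" using Qle by (rule mult_left_mono) simp
  qed (use w assms(1) in auto)
  then show ?thesis by (simp add: k_const_def Let_def w_def)
qed

context H10_representative
begin

text \<open>
  For \<open>\<xi>\<close> between \<open>B\<close> and \<open>B0\<close> the harmonic measure at \<open>\<xi>\<close> is at least \<open>w\<close>, and \<open>\<mu>\<^sup>w M\<^sup>1\<^sup>-\<^sup>w\<close> decreases in
  the exponent because \<open>\<mu> \<le> M\<close>. For negative \<open>\<xi>\<close> the symmetry of \<open>|ft U|\<close> is used.
\<close>

lemma transform_two_constants:
  assumes L: "L > 0" and B: "0 < B" "B < B0" and \<mu>: "\<mu> > 0" "\<mu> \<le> M"
    and M: "M = normU * exp L / sqrt pi"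
    and sup: "\<And>\<xi>. 0 \<le> \<xi> \<Longrightarrow> \<xi> \<le> B \<Longrightarrow> cmod (ft U \<xi>) \<le> \<mu>"
    and \<xi>: "\<bar>\<xi>\<bar> \<le> B0"
  defines "w \<equiv> slit_measure L (of_real B0) B"
  shows "cmod (ft U \<xi>) \<le> \<mu> powr w * M powr (1 - w)"
proof -
  note props = slit_measure_props[OF L B(1)]
  have "M > 0" using \<mu> by simp
  have mono: "\<mu> powr v * M powr (1 - v) \<le> \<mu> powr w * M powr (1 - w)" if "w \<le> v" for v
  proof -
    have eq: "\<mu> powr v * M powr (1 - v) = M * (\<mu> / M) powr v" for v
      using \<open>M > 0\<close> \<mu> by (simp add: powr_diff powr_divide)
    have "(\<mu> / M) powr v \<le> (\<mu> / M) powr w"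
      using that \<mu> \<open>M > 0\<close> by (intro powr_mono') auto
    then show ?thesis unfolding eq using \<open>M > 0\<close> by (intro mult_left_mono) auto
  qed
  have pos: "cmod (ft U t) \<le> \<mu> powr w * M powr (1 - w)" if t: "0 \<le> t" "t \<le> B0" for t
  proof (cases "t \<le> B")
    case True
    have "cmod (ft U t) \<le> \<mu> powr 1 * M powr (1 - 1)"
      using sup[OF t(1) True] \<mu> \<open>M > 0\<close> by simp
    also have "\<dots> \<le> \<mu> powr w * M powr (1 - w)"
      using props(2)[OF B(2)] by (intro mono) (simp add: w_def)
    finally show ?thesis .
  next
    case False
    then have "t > B" by simp
    have "cmod (transform (of_real t)) \<le> \<mu> powr slit_measure L (of_real t) B * M powr (1 - slit_measure L (of_real t) B)"
    proof (rule two_constants[OF L B(1) transform_holomorphic _ \<mu> _ \<open>t > B\<close>])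
      show "cmod (transform z) \<le> M" if "\<bar>Im z\<bar> \<le> L" for z
        unfolding M using that by (rule transform_le)
      show "cmod (transform z) \<le> \<mu>" if "z \<in> slit B" for z
        using that sup by (auto simp: slit_def transform_of_real)
    qed
    also have "\<dots> \<le> \<mu> powr w * M powr (1 - w)"
      using props(3)[OF \<open>t > B\<close> t(2)] by (intro mono) (simp add: w_def)
    finally show ?thesis by (simp add: transform_of_real)
  qed
  show ?thesis
    using pos[of \<xi>] pos[of "-\<xi>"] \<xi> ft_even[of \<xi>] by (cases "\<xi> \<ge> 0") auto
qed

text \<open>
  A bound \<open>\<mu>\<close> for \<open>|ft U|\<close> on the slit controls it on the band \<open>[-B0, B0]\<close>, hence the norm of \<open>U\<close>; and
  \<open>\<mu>\<^sup>2\<close> can be taken as \<open>c N' normU\<close>, or \<open>M\<^sup>2\<close> if that is smaller, for every \<open>N'\<close> above the truncated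
  norm. The strict inequality keeps \<open>\<mu>\<close> positive without knowing in advance that the truncated norm is.
\<close>

lemma norm_le_k_const:
  assumes L: "L > 0" and B: "0 < B" "B < B0" and \<gamma>: "\<gamma> > 1" and normU: "normU > 0"
    and B0: "\<gamma> * (LINT x|lborel. (G x)\<^sup>2) \<le> B0\<^sup>2 * normU\<^sup>2"
  shows "normU \<le> k_const \<gamma> L B0 B * band_norm B"
proof -
  define w where "w = slit_measure L (of_real B0) B"
  define c where "c = (B powr (1/4) / pi powr (1/4) + 2 / sqrt B)\<^sup>2"
  define Q where "Q = 2 * B0 / (1 - 1 / \<gamma>)"
  define M where "M = normU * exp L / sqrt pi"
  define K where "K = Q powr (1 / w) * exp (2 * L * (1 - w) / w)"
  have w: "0 < w" "w \<le> 1" using slit_measure_props[OF L B] by (auto simp: w_def)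
  have "c > 0" unfolding c_def using B(1) by (intro zero_less_power add_nonneg_pos) auto
  have "Q > 0" using B \<gamma> by (simp add: Q_def)
  have "M > 0" using normU by (simp add: M_def)
  have K: "K > 0" using \<open>Q > 0\<close> by (simp add: K_def)
  have k: "k_const \<gamma> L B0 B = c * K" by (simp add: k_const_def Let_def c_def K_def w_def Q_def)
  have n2: "normU\<^sup>2 = (LINT x|lborel. (U x)\<^sup>2)" by (subst real_sqrt_pow2) auto
  have step: "normU\<^sup>2 \<le> K * \<mu>\<^sup>2"
    if \<mu>: "\<mu> > 0" "\<mu> \<le> M" and sup: "\<And>\<xi>. 0 \<le> \<xi> \<Longrightarrow> \<xi> \<le> B \<Longrightarrow> cmod (ft U \<xi>) \<le> \<mu>" for \<mu>
  proof -
    define S where "S = \<mu> powr w * M powr (1 - w)"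
    have "(1 - 1 / \<gamma>) * normU\<^sup>2 \<le> (LINT x|lborel. (U x)\<^sup>2) - (LINT x|lborel. (G x)\<^sup>2) / B0\<^sup>2"
    proof -
      have "(LINT x|lborel. (G x)\<^sup>2) / B0\<^sup>2 \<le> normU\<^sup>2 / \<gamma>"
        using B0 B \<gamma> by (simp add: field_simps del: real_sqrt_pow2)
      then have "(1 - 1 / \<gamma>) * normU\<^sup>2 \<le> normU\<^sup>2 - (LINT x|lborel. (G x)\<^sup>2) / B0\<^sup>2"
        by (simp add: algebra_simps del: real_sqrt_pow2)
      then show ?thesis by (simp only: n2)
    qed
    also have "\<dots> \<le> (LINT \<xi>|lborel. indicator {-B0..B0} \<xi> * (cmod (ft U \<xi>))\<^sup>2)"
      using B by (intro band_energy_ge) simp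
    also have "\<dots> \<le> (LINT \<xi>|lborel. S\<^sup>2 * indicator {-B0..B0} \<xi>)"
    proof (rule integral_mono[OF integrable_band[OF U_int]])
      show "integrable lborel (\<lambda>\<xi>. S\<^sup>2 * indicator {-B0..B0} \<xi>)"
        by (intro integrable_mult_right integrable_real_indicator) (auto simp: emeasure_lborel_Icc_eq)
      show "indicator {-B0..B0} \<xi> * (cmod (ft U \<xi>))\<^sup>2 \<le> S\<^sup>2 * indicator {-B0..B0} \<xi>" for \<xi>
        using transform_two_constants[OF L B \<mu> M_def sup, of \<xi>]
        by (cases "\<bar>\<xi>\<bar> \<le> B0") (auto simp: S_def w_def indicator_def abs_le_iff intro!: power_mono)
    qed
    also have "\<dots> = S\<^sup>2 * (2 * B0)" using B by simp
    finally have "normU\<^sup>2 \<le> Q * S\<^sup>2"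
      using \<gamma> by (simp add: Q_def field_simps del: real_sqrt_pow2)
    also have "S\<^sup>2 = \<mu>\<^sup>2 powr w * M\<^sup>2 powr (1 - w)"
      unfolding S_def power_mult_distrib using \<mu> \<open>M > 0\<close>
      by (simp add: powr_powr powr_numeral[symmetric] mult.commute del: powr_numeral)
    also have "M\<^sup>2 powr (1 - w) \<le> (normU\<^sup>2) powr (1 - w) * exp (2 * L * (1 - w))"
    proof -
      have "M\<^sup>2 \<le> normU\<^sup>2 * exp (2 * L)"
      proof -
        have "M\<^sup>2 = normU\<^sup>2 * exp (2 * L) / pi"
          by (simp add: M_def power_divide power_mult_distrib exp_double del: real_sqrt_pow2)
        also have "\<dots> \<le> normU\<^sup>2 * exp (2 * L) / 1"
          using pi_ge_two by (intro divide_left_mono) auto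
        finally show ?thesis by simp
      qed
      then have "M\<^sup>2 powr (1 - w) \<le> (normU\<^sup>2 * exp (2 * L)) powr (1 - w)"
        using w by (intro powr_mono2) auto
      also have "\<dots> = (normU\<^sup>2) powr (1 - w) * exp (2 * L * (1 - w))"
        by (subst powr_mult) (auto simp: powr_def)
      finally show ?thesis .
    qed
    finally have le: "normU\<^sup>2 \<le> Q * (\<mu>\<^sup>2 powr w * ((normU\<^sup>2) powr (1 - w) * exp (2 * L * (1 - w))))"
      using \<open>Q > 0\<close> \<mu> by (simp add: mult_left_mono del: real_sqrt_pow2)
    have "normU\<^sup>2 > 0" using normU by (intro zero_less_power)
    have "(normU\<^sup>2) powr w = normU\<^sup>2 / (normU\<^sup>2) powr (1 - w)"
      using \<open>normU\<^sup>2 > 0\<close> by (simp add: powr_diff del: real_sqrt_pow2)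
    also have "\<dots> \<le> Q * exp (2 * L * (1 - w)) * \<mu>\<^sup>2 powr w"
      using le \<open>normU\<^sup>2 > 0\<close> by (simp add: field_simps del: real_sqrt_pow2)
    finally have "((normU\<^sup>2) powr w) powr (1 / w) \<le> (Q * exp (2 * L * (1 - w)) * \<mu>\<^sup>2 powr w) powr (1 / w)"
      using w by (intro powr_mono2) auto
    also have "\<dots> = K * \<mu>\<^sup>2"
      using \<open>Q > 0\<close> \<mu> w by (simp add: K_def powr_mult powr_powr) (simp add: powr_def)
    finally show "normU\<^sup>2 \<le> K * \<mu>\<^sup>2"
      using \<open>normU\<^sup>2 > 0\<close> w by (simp add: powr_powr del: real_sqrt_pow2)
  qed
  have "normU / (c * K) \<le> N'" if "N' > band_norm B" for N'
  proof -
    have "N' > 0" using that by (simp add: band_norm_def order_le_less_trans[rotated])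
    define \<mu> where "\<mu> = min (sqrt (c * N' * normU)) M"
    have "normU\<^sup>2 \<le> K * \<mu>\<^sup>2"
    proof (rule step)
      show "\<mu> > 0" "\<mu> \<le> M" using \<open>c > 0\<close> \<open>N' > 0\<close> normU \<open>M > 0\<close> by (auto simp: \<mu>_def)
      fix \<xi> assume \<xi>: "0 \<le> \<xi>" "\<xi> \<le> B"
      have "(cmod (ft U \<xi>))\<^sup>2 \<le> c * (band_norm B * normU)"
        unfolding c_def using band_sup_le[OF B(1) \<xi>] .
      also have "\<dots> \<le> c * (N' * normU)"
        using that normU \<open>c > 0\<close> by (intro mult_left_mono mult_right_mono) auto
      finally have "cmod (ft U \<xi>) \<le> sqrt (c * N' * normU)" by (simp add: real_le_rsqrt mult.assoc)
      moreover have "cmod (ft U \<xi>) \<le> M"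
        using transform_le[of "of_real \<xi>" L] L by (simp add: transform_of_real M_def)
      ultimately show "cmod (ft U \<xi>) \<le> \<mu>" by (simp add: \<mu>_def)
    qed
    also have "\<dots> \<le> K * (c * N' * normU)"
    proof (rule mult_left_mono)
      have "0 \<le> c * N' * normU" using \<open>c > 0\<close> \<open>N' > 0\<close> normU by simp
      have "\<mu>\<^sup>2 \<le> (sqrt (c * N' * normU))\<^sup>2"
        using \<open>c > 0\<close> \<open>N' > 0\<close> normU \<open>M > 0\<close> by (intro power_mono) (auto simp: \<mu>_def)
      then show "\<mu>\<^sup>2 \<le> c * N' * normU" using \<open>0 \<le> c * N' * normU\<close> by (simp only: real_sqrt_pow2)
    qed (use K in simp)
    finally have "normU * normU \<le> (K * c * N') * normU" by (simp add: power2_eq_square mult_ac)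
    then have "normU \<le> K * c * N'" using normU by (metis mult_le_cancel_right not_less_iff_gr_or_eq)
    then show ?thesis using \<open>c > 0\<close> K by (simp add: field_simps)
  qed
  then have "normU / (c * K) \<le> band_norm B" by (rule dense_ge)
  then show ?thesis unfolding k using \<open>c > 0\<close> K by (simp add: field_simps)
qed

end

theorem theorem7:
  fixes f :: "real \<Rightarrow> real" and \<gamma> B0 :: real
  assumes "f \<in> H10"
    and "\<not> (AE x in lebesgue_on {-1<..<1}. f x = 0)"
    and "\<gamma> > 1"
    and "B0 \<ge> sqrt \<gamma> * frequency_number f"
  shows "\<forall>L>0.
           (\<forall>B. 0 < B \<and> B < B0 \<longrightarrow>
              L2_norm_on {-1<..<1} f \<le> k_const \<gamma> L B0 B * L2_norm_on UNIV (truncated_fourier B f)) \<and>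
           filterlim (\<lambda>B. k_const \<gamma> L B0 B) at_top (at_right 0) \<and>
           ((\<lambda>B. k_const \<gamma> L B0 B) \<longlongrightarrow>
              (B0 powr (1/4) / pi powr (1/4) + 2 / sqrt B0)\<^sup>2 * (2 * B0 / (1 - 1/\<gamma>))) (at_left B0) \<and>
           (\<forall>B>0. filterlim (\<lambda>b. k_const \<gamma> L b B) at_top at_top)"
proof -
  obtain G where G: "G \<in> borel_measurable borel" "\<And>x. x \<notin> {-1<..<1} \<Longrightarrow> G x = 0"
    "integrable lborel G" "integrable lborel (\<lambda>x. (G x)\<^sup>2)" "(LINT x|lborel. G x) = 0"
    "f \<in> borel_measurable (lebesgue_on {-1<..<1})"
    "AE x in lebesgue_on {-1<..<1}. f x = primitive G x"
    "L2_norm_on {-1<..<1} (weak_deriv {-1<..<1} f) = sqrt (LINT x|lborel. (G x)\<^sup>2)"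
    by (rule H10_primitive[OF assms(1)]) (rule that)
  interpret H10_representative G by unfold_locales (rule G; assumption?)+
  have norm_f: "L2_norm_on {-1<..<1} f = normU"
  proof -
    have "(LINT x|lebesgue_on {-1<..<1}. (norm (f x))\<^sup>2) = (LINT x|lborel. (U x)\<^sup>2)"
    proof (rule LINT_lebesgue_on_eq_lborel(1))
      show "(\<lambda>x. (norm (f x))\<^sup>2) \<in> borel_measurable (lebesgue_on {-1<..<1})" using G(6) by measurable
      show "AE x in lebesgue_on {-1<..<1}. (norm (f x))\<^sup>2 = (U x)\<^sup>2" using G(7) by (rule eventually_mono) simp
    qed (use U_supp in auto)
    then show ?thesis by (simp add: L2_norm_on_def)
  qed
  have fourier_f: "fourier f \<xi> = ft U \<xi>" for \<xi>
  proof -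
    have "(LINT x|lebesgue_on {-1<..<1}. complex_of_real (f x) * exp (- \<i> * complex_of_real (x * \<xi>)))
        = (LINT x|lborel. complex_of_real (U x) * exp (- \<i> * complex_of_real (x * \<xi>)))"
    proof (rule LINT_lebesgue_on_eq_lborel(1))
      have "(\<lambda>x. exp (- \<i> * complex_of_real (x * \<xi>))) \<in> borel_measurable (lebesgue_on {-1<..<1})"
        by (intro measurable_restrict_space1 measurable_completion) measurable
      then show "(\<lambda>x. complex_of_real (f x) * exp (- \<i> * complex_of_real (x * \<xi>))) \<in> borel_measurable (lebesgue_on {-1<..<1})"
        using G(6) by measurable
      show "AE x in lebesgue_on {-1<..<1}. complex_of_real (f x) * exp (- \<i> * complex_of_real (x * \<xi>))
          = complex_of_real (U x) * exp (- \<i> * complex_of_real (x * \<xi>))"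
        using G(7) by (rule eventually_mono) simp
    qed (use U_supp in auto)
    then show ?thesis unfolding fourier_def ft_def by simp
  qed
  have norm_Ff: "L2_norm_on UNIV (truncated_fourier B f) = band_norm B" for B
  proof -
    have "(LINT \<xi>|lebesgue_on UNIV. (cmod (truncated_fourier B f \<xi>))\<^sup>2)
        = (LINT \<xi>|lebesgue. indicator {-B..B} \<xi> * (cmod (ft U \<xi>))\<^sup>2)"
      by (auto simp: truncated_fourier_def fourier_f norm_mult indicator_def lebesgue_on_UNIV_eq intro!: Bochner_Integration.integral_cong)
    also have "\<dots> = (LINT \<xi>|lborel. indicator {-B..B} \<xi> * (cmod (ft U \<xi>))\<^sup>2)"
      by (rule integral_completion) measurable
    finally show ?thesis by (simp add: L2_norm_on_def band_norm_def)
  qed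
  have normU: "normU > 0"
  proof (rule ccontr)
    assume "\<not> normU > 0"
    moreover have "(LINT x|lborel. (U x)\<^sup>2) \<ge> 0" by simp
    ultimately have "(LINT x|lborel. (U x)\<^sup>2) = 0" by (simp add: not_less)
    then have "AE x in lborel. (U x)\<^sup>2 = 0"
      using integral_nonneg_eq_0_iff_AE[OF U2] by simp
    then have "AE x in lebesgue. U x = 0" by (intro AE_completion) simp
    then have "AE x in lebesgue_on {-1<..<1}. U x = 0"
      by (simp add: AE_restrict_space_iff eventually_mono)
    with G(7) have "AE x in lebesgue_on {-1<..<1}. f x = 0" by eventually_elim simp
    with assms(2) show False by simp
  qed
  define N where "N = (LINT x|lborel. (G x)\<^sup>2)"
  have "N \<ge> 0" by (simp add: N_def)
  have n2: "normU\<^sup>2 = (LINT x|lborel. (U x)\<^sup>2)" by (subst real_sqrt_pow2) auto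
  have freq: "sqrt \<gamma> * sqrt N \<le> B0 * normU"
    using assms(4) normU by (simp add: frequency_number_def G(8) norm_f N_def field_simps)
  have freq2: "\<gamma> * N \<le> B0\<^sup>2 * normU\<^sup>2"
  proof -
    have "(sqrt \<gamma> * sqrt N)\<^sup>2 \<le> (B0 * normU)\<^sup>2"
      using freq assms(3) \<open>N \<ge> 0\<close> by (intro power_mono) auto
    moreover have "(sqrt \<gamma>)\<^sup>2 = \<gamma>" "(sqrt N)\<^sup>2 = N" using assms(3) \<open>N \<ge> 0\<close> by simp_all
    ultimately show ?thesis by (simp only: power_mult_distrib)
  qed
  \<comment> \<open>The Poincare inequality bounds the frequency number from below, hence the base in \<open>k_const\<close>.\<close>
  have "normU\<^sup>2 \<le> 4 * N" using Poincare by (simp add: n2 N_def)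
  then have "(normU / 2)\<^sup>2 \<le> N" by (simp add: power_divide del: real_sqrt_pow2)
  then have "normU / 2 \<le> sqrt N" by (rule real_le_rsqrt)
  also have "\<dots> \<le> sqrt \<gamma> * sqrt N" using assms(3) \<open>N \<ge> 0\<close> mult_right_mono[of 1 "sqrt \<gamma>" "sqrt N"] by simp
  also have "\<dots> \<le> B0 * normU" by (rule freq)
  finally have "1 / 2 * normU \<le> B0 * normU" by simp
  then have B0: "B0 \<ge> 1 / 2" using normU mult_le_cancel_right[of "1/2" normU B0] by simp
  have \<gamma>: "0 < 1 - 1 / \<gamma>" "1 - 1 / \<gamma> \<le> 1" using assms(3) by (auto simp: field_simps)
  have Q: "2 * b \<le> 2 * b / (1 - 1 / \<gamma>)" if "b \<ge> 1 / 2" for b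
  proof -
    have "2 * b / 1 \<le> 2 * b / (1 - 1 / \<gamma>)" using \<gamma> that by (intro divide_left_mono) auto
    then show ?thesis by simp
  qed
  show ?thesis
  proof (intro allI impI conjI)
    fix L :: real assume L: "L > 0"
    show "L2_norm_on {-1<..<1} f \<le> k_const \<gamma> L B0 B * L2_norm_on UNIV (truncated_fourier B f)"
      if "0 < B \<and> B < B0" for B
      unfolding norm_f norm_Ff
      using norm_le_k_const[OF L _ _ assms(3) normU, of B B0] that freq2 by (simp add: N_def)
    show "filterlim (\<lambda>B. k_const \<gamma> L B0 B) at_top (at_right 0)"
    proof (rule filterlim_at_top_mono)
      have "filterlim (\<lambda>B::real. inverse B) at_top (at_right 0)" by (rule filterlim_inverse_at_top_right)
      then show "filterlim (\<lambda>B::real. 4 * inverse B) at_top (at_right 0)"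
        by (rule filterlim_tendsto_pos_mult_at_top[OF tendsto_const, rotated]) simp
      have "eventually (\<lambda>B. B \<in> {0<..<B0}) (at_right 0)"
        using B0 by (intro eventually_at_right_real) simp
      then show "eventually (\<lambda>B. 4 * inverse B \<le> k_const \<gamma> L B0 B) (at_right 0)"
      proof eventually_elim
        case (elim B)
        let ?c = "(B powr (1/4) / pi powr (1/4) + 2 / sqrt B)\<^sup>2"
        have "(2 / sqrt B)\<^sup>2 \<le> ?c" using elim by (intro power_mono) auto
        moreover have "4 * inverse B = (2 / sqrt B)\<^sup>2" using elim by (simp add: power_divide) (simp add: divide_inverse)
        ultimately have "4 * inverse B \<le> ?c * 1" by (simp only: mult_1_right)
        also have "\<dots> \<le> ?c * (2 * B0 / (1 - 1 / \<gamma>))"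
        proof (rule mult_left_mono)
          show "1 \<le> 2 * B0 / (1 - 1 / \<gamma>)" using Q[OF B0] B0 by linarith
        qed simp
        also have "\<dots> \<le> k_const \<gamma> L B0 B"
        proof (rule k_const_ge[OF L _ _ assms(3)])
          show "1 \<le> 2 * B0 / (1 - 1 / \<gamma>)" using Q[OF B0] B0 by linarith
        qed (use elim in auto)
        finally show ?case by simp
      qed
    qed
    show "((\<lambda>B. k_const \<gamma> L B0 B) \<longlongrightarrow>
        (B0 powr (1/4) / pi powr (1/4) + 2 / sqrt B0)\<^sup>2 * (2 * B0 / (1 - 1/\<gamma>))) (at_left B0)"
    proof -
      have Q0: "2 * B0 / (1 - 1 / \<gamma>) > 0" using B0 \<gamma> by simp
      have id: "((\<lambda>B. B) \<longlongrightarrow> B0) (at_left B0)" by (rule tendsto_ident_at)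
      have w: "((\<lambda>B. slit_measure L (of_real B0) B) \<longlongrightarrow> 1) (at_left B0)"
        using B0 by (intro slit_measure_tendsto_1 L) simp
      have "((\<lambda>B. k_const \<gamma> L B0 B) \<longlongrightarrow>
          (B0 powr (1/4) / pi powr (1/4) + 2 / sqrt B0)\<^sup>2 * (2 * B0 / (1 - 1/\<gamma>)) powr (1 / 1)
             * exp (2 * L * (1 - 1) / 1)) (at_left B0)"
        unfolding k_const_def Let_def
        using B0 Q0 by (intro tendsto_intros id w) auto
      then show ?thesis
        using powr_one[OF less_imp_le[OF Q0]]
        by (simp only: div_by_1 diff_self mult_zero_right exp_zero mult_1_right)
    qed
    show "filterlim (\<lambda>b. k_const \<gamma> L b B) at_top at_top" if B: "B > 0" for B
    proof (rule filterlim_at_top_mono)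
      let ?c = "(B powr (1/4) / pi powr (1/4) + 2 / sqrt B)\<^sup>2"
      have c: "?c > 0" using B by (intro zero_less_power add_nonneg_pos) auto
      show "filterlim (\<lambda>b. ?c * 2 * b) at_top at_top"
        using c by (intro filterlim_tendsto_pos_mult_at_top[OF tendsto_const _ filterlim_ident]) simp
      show "eventually (\<lambda>b. ?c * 2 * b \<le> k_const \<gamma> L b B) at_top"
        using eventually_gt_at_top[of B] eventually_ge_at_top[of "1 / 2"]
      proof eventually_elim
        case (elim b)
        have "?c * 2 * b \<le> ?c * (2 * b / (1 - 1 / \<gamma>))"
          unfolding mult.assoc by (rule mult_left_mono[OF Q[OF elim(2)]]) simp
        also have "\<dots> \<le> k_const \<gamma> L b B"
        proof (rule k_const_ge[OF L B elim(1) assms(3)])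
          show "1 \<le> 2 * b / (1 - 1 / \<gamma>)" using Q[OF elim(2)] elim(2) by linarith
        qed
        finally show ?case .
      qed
    qed
  qed
qed

end
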